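(* There exists an adaptive randomized algorithm that solves the Graph Reconstruction problem with a CC oracle using $\mathcal{O}\big(\min\{m/\log m,\ \Delta^2,\ k^2\} \cdot \log n\big)$ CC queries, where $n$, $m$, $\Delta$ and $k$ are the number of vertices, the number of edges, the maximum degree and the treewidth of the hidden graph (none of $m,\Delta,k$ is given to the algorithm). The output of the algorithm is correct with high probability.
   Context: Graph Reconstruction (GR): an unknown ("hidden") simple undirected graph $G=(V,E)$ on a known vertex set $V$ with $|V|=n$ is to be determined; the algorithm must output $E$. It accesses $G$ only through a connected components (CC) oracle: a query is a set $S\subseteq V$, and the answer is the set of connected components of the induced subgraph $G[S]$, i.e. the partition of $S$ into the vertex sets of the connected components of $G[S]$. Complexity is measured by the number of queries. An algorithm is non-adaptive if all its (possibly random) queries are fixed before any answer is seen, and adaptive otherwise. A randomized algorithm is correct with high probability if the probability that it outputs the hidden graph tends to $1$ as $n\to\infty$. *)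

theory Defs
  imports "HOL-Probability.Probability"
begin

section \<open>Finite simple graphs\<close>

definition simple_graph :: "'a set \<Rightarrow> 'a set set \<Rightarrow> bool" where
  "simple_graph V E \<longleftrightarrow> finite V \<and> (\<forall>e\<in>E. e \<subseteq> V \<and> card e = 2)"

definition connected_rel :: "'a set set \<Rightarrow> 'a set \<Rightarrow> ('a \<times> 'a) set" where
  "connected_rel E S =
     {(u, v). u \<in> S \<and> v \<in> S \<and> (u, v) \<in> {(x, y). x \<in> S \<and> y \<in> S \<and> {x, y} \<in> E}\<^sup>*}"

text \<open>The vertex sets of the connected components of the induced subgraph \<open>G[S]\<close>.\<close>

definition induced_components :: "'a set set \<Rightarrow> 'a set \<Rightarrow> 'a set set" where
  "induced_components E S = S // connected_rel E S"

definition connected_on :: "'a set set \<Rightarrow> 'a set \<Rightarrow> bool" where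
  "connected_on E S \<longleftrightarrow> (\<forall>u\<in>S. \<forall>v\<in>S. (u, v) \<in> connected_rel E S)"

definition max_degree :: "'a set \<Rightarrow> 'a set set \<Rightarrow> nat" where
  "max_degree V E = Max (insert 0 ((\<lambda>v. card {e \<in> E. v \<in> e}) ` V))"


section \<open>Treewidth\<close>

definition is_cycle :: "'a set set \<Rightarrow> 'a list \<Rightarrow> bool" where
  "is_cycle E xs \<longleftrightarrow> length xs \<ge> 3 \<and> distinct xs \<and>
     (\<forall>i < length xs. {xs ! i, xs ! (Suc i mod length xs)} \<in> E)"

definition is_tree :: "'a set \<Rightarrow> 'a set set \<Rightarrow> bool" where
  "is_tree I F \<longleftrightarrow> simple_graph I F \<and> I \<noteq> {} \<and> connected_on F I \<and> (\<nexists>xs. is_cycle F xs)"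

text \<open>The decomposition tree has vertex set \<open>I\<close> and edge set \<open>F\<close>; the bag of node \<open>i\<close> is \<open>B i\<close>.
  Since decomposition trees are finite, naming their nodes by natural numbers loses nothing.\<close>

definition tree_decomposition ::
  "'a set \<Rightarrow> 'a set set \<Rightarrow> nat set \<Rightarrow> nat set set \<Rightarrow> (nat \<Rightarrow> 'a set) \<Rightarrow> bool" where
  "tree_decomposition V E I F B \<longleftrightarrow>
     is_tree I F \<and>
     (\<forall>i\<in>I. B i \<subseteq> V) \<and>
     (\<forall>v\<in>V. \<exists>i\<in>I. v \<in> B i) \<and>
     (\<forall>e\<in>E. \<exists>i\<in>I. e \<subseteq> B i) \<and>
     (\<forall>v\<in>V. connected_on F {i \<in> I. v \<in> B i})"

definition width :: "nat set \<Rightarrow> (nat \<Rightarrow> 'a set) \<Rightarrow> nat" where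
  "width I B = Max ((\<lambda>i. card (B i)) ` I) - 1"

definition treewidth :: "'a set \<Rightarrow> 'a set set \<Rightarrow> nat" where
  "treewidth V E = (LEAST w. \<exists>I F B. tree_decomposition V E I F B \<and> w = width I B)"


section \<open>Adaptive query algorithms\<close>

text \<open>A deterministic adaptive algorithm is a decision tree: it either stops and outputs an edge
  set, or asks a query \<open>S\<close> and continues depending on the answer, a family of vertex sets.
  A randomized adaptive algorithm is a probability distribution on such trees.\<close>

datatype 'a cc_alg =
    Output "'a set set"
  | Query "'a set" "'a set set \<Rightarrow> 'a cc_alg"

primrec queries_within :: "'a set \<Rightarrow> 'a cc_alg \<Rightarrow> bool" where
  "queries_within V (Output F) \<longleftrightarrow> True"
| "queries_within V (Query S c) \<longleftrightarrow> S \<subseteq> V \<and> (\<forall>a. queries_within V (c a))"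

primrec result :: "('a set \<Rightarrow> 'a set set) \<Rightarrow> 'a cc_alg \<Rightarrow> 'a set set" where
  "result oracle_fn (Output F) = F"
| "result oracle_fn (Query S c) = result oracle_fn (c (oracle_fn S))"

primrec num_queries :: "('a set \<Rightarrow> 'a set set) \<Rightarrow> 'a cc_alg \<Rightarrow> nat" where
  "num_queries oracle_fn (Output F) = 0"
| "num_queries oracle_fn (Query S c) = Suc (num_queries oracle_fn (c (oracle_fn S)))"

text \<open>The expression \<open>min {m / log m, \<Delta>\<^sup>2, k\<^sup>2} \<cdot> log n\<close>. The inner \<open>max 1\<close> matters only for \<open>m \<le> 1\<close>,
  where \<open>log m\<close> is not positive; the outer one only for edgeless graphs (and \<open>n \<le> 1\<close>), where the
  expression is \<open>0\<close> although for \<open>n \<ge> 2\<close> at least one query is unavoidable.\<close>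

definition query_bound :: "'a set \<Rightarrow> 'a set set \<Rightarrow> real" where
  "query_bound V E =
     (let n = real (card V); m = real (card E);
          \<Delta> = real (max_degree V E); k = real (treewidth V E)
      in max 1 (Min {m / max 1 (log 2 m), \<Delta>\<^sup>2, k\<^sup>2} * log 2 n))"

end

theory Submission
  imports Defs
begin

text \<open>The algorithm is deterministic. Fix a scale \<open>D\<close>. A greedy covering argument (the averaging step is
  a Bonferroni estimate for a random vertex set of density \<open>1/D\<close>) yields \<open>O(D\<^sup>2 log n)\<close> queries such
  that for every set \<open>X\<close> of at most \<open>D\<close> vertices and any \<open>D\<close> pairs disjoint from \<open>X\<close>, some query
  avoids \<open>X\<close> and contains one of these pairs. Allowing a few exceptional pairs is what makes one
  family work for all graphs at once. Let \<open>H\<close> be the graph of candidate pairs, those never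
  separated by an answer; it contains the hidden graph \<open>G\<close>.

  If \<open>G\<close> has treewidth below \<open>D\<close>, then \<open>X\<close> can be any bag of a tree decomposition, so \<open>H\<close> has balanced
  separators of size \<open>3 D\<close> and is contained in a \<open>K\<close>-tree with \<open>K = O(D)\<close>. Greedily colouring
  the \<open>K\<close>-tree makes the union of any two colour classes induce a forest, so the \<open>O(D\<^sup>2)\<close> queries
  given by pairs of colours determine \<open>G\<close>.

  Otherwise take \<open>X\<close> to be the neighbourhood of a vertex: vertices of degree at most \<open>D\<close> have fewer
  than \<open>2 D\<close> candidate neighbours. A strong edge colouring resolves the candidates between such
  vertices with \<open>O(D\<^sup>2)\<close> queries, which is everything if the maximum degree is at most \<open>D\<close>.
  With \<open>M = D\<^sup>2 log n\<close> and at most \<open>M\<close> edges there are only \<open>O(M / D)\<close> remaining vertices, and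
  repeating the argument on them for \<open>2 D, 4 D, \<dots>, \<surd>M\<close> costs \<open>O(M)\<close> in total.

  No parameter needs to be known: every algorithm above is exact on all graphs, so that one can
  run it with a query budget, for \<open>D = 2, 4, 8, \<dots>\<close>, until one run finishes.\<close>

section \<open>Connected components of induced subgraphs\<close>

abbreviation adj :: "'a set set \<Rightarrow> 'a set \<Rightarrow> ('a \<times> 'a) set" where
  "adj E S \<equiv> {(x, y). x \<in> S \<and> y \<in> S \<and> {x, y} \<in> E}"

lemma conn_iff: "(u, v) \<in> connected_rel E S \<longleftrightarrow> u \<in> S \<and> v \<in> S \<and> (u, v) \<in> (adj E S)\<^sup>*"
  by (simp add: connected_rel_def)

lemma conn_in: "(u, v) \<in> connected_rel E S \<Longrightarrow> u \<in> S \<and> v \<in> S"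
  by (simp add: conn_iff)

lemma conn_refl: "u \<in> S \<Longrightarrow> (u, u) \<in> connected_rel E S"
  by (simp add: conn_iff)

lemma conn_edge: "u \<in> S \<Longrightarrow> v \<in> S \<Longrightarrow> {u, v} \<in> E \<Longrightarrow> (u, v) \<in> connected_rel E S"
  by (auto simp: conn_iff)

lemma conn_trans:
  "(u, v) \<in> connected_rel E S \<Longrightarrow> (v, w) \<in> connected_rel E S \<Longrightarrow> (u, w) \<in> connected_rel E S"
  by (auto simp: conn_iff)

lemma conn_sym: "(u, v) \<in> connected_rel E S \<Longrightarrow> (v, u) \<in> connected_rel E S"
proof -
  have "sym (adj E S)" by (auto simp: sym_def insert_commute)
  then have "sym ((adj E S)\<^sup>*)" by (rule sym_rtrancl)
  then show "(u, v) \<in> connected_rel E S \<Longrightarrow> (v, u) \<in> connected_rel E S"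
    by (auto simp: conn_iff dest: symD)
qed

lemma conn_induct [consumes 1, case_names base step]:
  assumes "(u, v) \<in> connected_rel E S"
    and "P u"
    and "\<And>x y. (u, x) \<in> connected_rel E S \<Longrightarrow> x \<in> S \<Longrightarrow> y \<in> S \<Longrightarrow> {x, y} \<in> E \<Longrightarrow> P x \<Longrightarrow> P y"
  shows "P v"
proof -
  have uS: "u \<in> S" and "(u, v) \<in> (adj E S)\<^sup>*" using assms(1) by (auto simp: conn_iff)
  from this(2) have "v \<in> S \<longrightarrow> P v"
  proof (induction rule: rtrancl_induct)
    case base
    then show ?case using assms(2) by simp
  next
    case (step y z)
    then show ?case using assms(3)[of y z] uS by (auto simp: conn_iff)
  qed
  then show ?thesis using assms(1) by (auto simp: conn_iff)
qed

lemma conn_mono: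
  assumes "(u, v) \<in> connected_rel E S" "S \<subseteq> T" "\<And>x y. x \<in> S \<Longrightarrow> y \<in> S \<Longrightarrow> {x, y} \<in> E \<Longrightarrow> {x, y} \<in> E'"
  shows "(u, v) \<in> connected_rel E' T"
  using assms(1)
proof (induction rule: conn_induct)
  case base
  show ?case using conn_in[OF assms(1)] assms(2) by (intro conn_refl) blast
next
  case (step x y)
  have "(x, y) \<in> connected_rel E' T"
    using step.hyps assms(2,3) by (intro conn_edge) blast+
  with step.IH show ?case by (rule conn_trans)
qed

text \<open>A walk from \<open>k\<close> through \<open>i\<close> would put \<open>i\<close> into
  the component of \<open>k\<close>, so no walk inside \<open>S\<close> that starts at
  \<open>k\<close> meets \<open>i\<close>.\<close>

lemma conn_avoid:
  assumes "(k, l) \<in> connected_rel E S" "(k, i) \<notin> connected_rel E S"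
  shows "(k, l) \<in> connected_rel E (S - {i})"
  using assms(1)
proof (induction rule: conn_induct)
  case base
  have "k \<in> S" using conn_in[OF assms(1)] by simp
  then show ?case using assms(2) conn_refl[of k S E] by (intro conn_refl) auto
next
  case (step x y)
  have "(k, y) \<in> connected_rel E S"
    using step.hyps conn_trans[OF step.hyps(1) conn_edge] by blast
  then have "x \<noteq> i" "y \<noteq> i" using step.hyps assms(2) by auto
  then have "(x, y) \<in> connected_rel E (S - {i})" using step.hyps by (intro conn_edge) auto
  with step.IH show ?case by (rule conn_trans)
qed

text \<open>The first step of a walk from \<open>u\<close> must use an edge at \<open>u\<close>
  inside \<open>S\<close>, and only \<open>{u, v}\<close> is possible. This is how single edges are
  read off from answers.\<close>

lemma conn_pendant_iff:
  assumes "u \<in> S" "v \<in> S" "u \<noteq> v" "\<And>w. w \<in> S \<Longrightarrow> {u, w} \<in> E \<Longrightarrow> w = v"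
  shows "(u, v) \<in> connected_rel E S \<longleftrightarrow> {u, v} \<in> E"
proof
  assume "(u, v) \<in> connected_rel E S"
  then have "(u, v) \<in> (adj E S)\<^sup>*" by (simp add: conn_iff)
  then show "{u, v} \<in> E"
  proof (cases rule: converse_rtranclE)
    case (step w)
    then have "w \<in> S" "{u, w} \<in> E" by auto
    then show ?thesis using assms(4)[of w] by simp
  qed (use assms(3) in simp)
qed (rule conn_edge[OF assms(1,2)])

text \<open>A vertex with at most one neighbour in \<open>S\<close> is of no use to a walk between
  other vertices. In the induction over a \<open>K\<close>-tree this turns answers about the larger
  graph into answers about the smaller one.\<close>

lemma conn_remove_pendant:
  assumes "x \<in> S" "y \<in> S" "x \<noteq> v" "y \<noteq> v" "\<And>w. w \<in> S \<Longrightarrow> {v, w} \<in> E \<Longrightarrow> w = u"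
  shows "(x, y) \<in> connected_rel E S \<longleftrightarrow> (x, y) \<in> connected_rel E (S - {v})"
proof
  assume "(x, y) \<in> connected_rel E S"
  \<comment> \<open>A walk may visit \<open>v\<close>; retracting \<open>v\<close> to its only neighbour \<open>u\<close> keeps it a walk.\<close>
  then have "(x, if y = v then u else y) \<in> connected_rel E (S - {v})"
  proof (induction rule: conn_induct)
    case base
    then show ?case using assms by (simp add: conn_refl)
  next
    case (step z z')
    show ?case
    proof (cases "z = v \<or> z' = v")
      case True
      have "z = v \<Longrightarrow> z' = u" using step assms(5)[of z'] by simp
      moreover have "z' = v \<Longrightarrow> z = u" using step assms(5)[of z] by (simp add: insert_commute)
      ultimately show ?thesis using step.IH True by (cases "z = v"; cases "z' = v") simp_all
    next
      case False
      then have "(z, z') \<in> connected_rel E (S - {v})" using step by (intro conn_edge) auto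
      then show ?thesis using step.IH False conn_trans[of x z E "S - {v}" z'] by simp
    qed
  qed
  then show "(x, y) \<in> connected_rel E (S - {v})" using assms by simp
next
  assume "(x, y) \<in> connected_rel E (S - {v})"
  then show "(x, y) \<in> connected_rel E S" by (rule conn_mono) auto
qed

lemma equiv_conn: "equiv S (connected_rel E S)"
  by (auto simp: equiv_def refl_on_def sym_def trans_def dest: conn_in intro: conn_refl conn_sym conn_trans)

lemma conn_iff_component:
  "(x, y) \<in> connected_rel E S \<longleftrightarrow> (\<exists>C\<in>induced_components E S. x \<in> C \<and> y \<in> C)"
proof
  assume *: "(x, y) \<in> connected_rel E S"
  then have "connected_rel E S `` {x} \<in> induced_components E S"
    unfolding induced_components_def using conn_in[OF *] by (intro quotientI) simp
  then show "\<exists>C\<in>induced_components E S. x \<in> C \<and> y \<in> C"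
    using * conn_refl[of x S E] conn_in[OF *] by (intro bexI[of _ "connected_rel E S `` {x}"]) auto
next
  assume "\<exists>C\<in>induced_components E S. x \<in> C \<and> y \<in> C"
  then obtain C where "C \<in> S // connected_rel E S" "x \<in> C" "y \<in> C"
    by (auto simp: induced_components_def)
  then show "(x, y) \<in> connected_rel E S"
    using quotient_eq_iff[OF equiv_conn, of C S E C x y] by simp
qed

lemma conn_eq_if_components_eq:
  "induced_components E S = induced_components E' S \<Longrightarrow> connected_rel E S = connected_rel E' S"
  by (auto simp: conn_iff_component)

lemma simple_graphD:
  assumes "simple_graph V E"
  shows "finite V" "E \<subseteq> Pow V" "e \<in> E \<Longrightarrow> e \<subseteq> V" "e \<in> E \<Longrightarrow> card e = 2" "finite E"
  using assms finite_subset[of E "Pow V"] by (auto simp: simple_graph_def)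

section \<open>Exact learning with a bounded number of queries\<close>

text \<open>\<open>\<G>\<close> is the set of graphs still possible. The output must be right on all
  of it, but the cost bound is promised only where \<open>P\<close> holds: a wrong guess about the
  parameters may cost queries, never correctness.\<close>

definition learnable ::
  "'a set \<Rightarrow> 'a set set set \<Rightarrow> ('a set set \<Rightarrow> bool) \<Rightarrow> ('a set set \<Rightarrow> real) \<Rightarrow> bool" where
  "learnable V \<G> P c \<longleftrightarrow>
     (\<exists>A. queries_within V A \<and>
       (\<forall>E\<in>\<G>. result (induced_components E) A = E \<and>
          (P E \<longrightarrow> real (num_queries (induced_components E) A) \<le> c E)))"

lemma learnable_mono:
  assumes "learnable V \<G> P c" "\<G>' \<subseteq> \<G>"
    and "\<And>E. E \<in> \<G>' \<Longrightarrow> P' E \<Longrightarrow> P E" "\<And>E. E \<in> \<G>' \<Longrightarrow> P' E \<Longrightarrow> c E \<le> c' E"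
  shows "learnable V \<G>' P' c'"
  using assms unfolding learnable_def by (meson order_trans subsetD)

lemma learnable_unique:
  assumes "\<And>E E'. E \<in> \<G> \<Longrightarrow> E' \<in> \<G> \<Longrightarrow> E = E'" "\<And>E. E \<in> \<G> \<Longrightarrow> P E \<Longrightarrow> 0 \<le> c E"
  shows "learnable V \<G> P c"
proof (cases "\<G> = {}")
  case True
  then show ?thesis unfolding learnable_def by (intro exI[of _ "Output {}"]) simp
next
  case False
  then obtain F where "F \<in> \<G>" by blast
  then show ?thesis
    unfolding learnable_def using assms by (intro exI[of _ "Output F"]) auto
qed

text \<open>A batch of queries splits \<open>\<G>\<close> by the answers received; the rest is
  learned in each class separately, and the costs add up. Adaptive stages are composed in this
  way.\<close>

lemma learnable_ask:
  assumes "finite \<S>" "\<S> \<subseteq> Pow V"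
    and "\<And>E0. E0 \<in> \<G> \<Longrightarrow>
      learnable V {E \<in> \<G>. \<forall>S\<in>\<S>. induced_components E S = induced_components E0 S} P c"
  shows "learnable V \<G> P (\<lambda>E. real (card \<S>) + c E)"
  using assms
proof (induction \<S> arbitrary: \<G> rule: finite_induct)
  case empty
  then show ?case
    by (cases "\<G> = {}") (auto intro: learnable_unique)
next
  case (insert S \<S>)
  define good where "good a A \<longleftrightarrow> queries_within V A \<and>
       (\<forall>E\<in>{E \<in> \<G>. induced_components E S = a}. result (induced_components E) A = E \<and>
          (P E \<longrightarrow> real (num_queries (induced_components E) A) \<le> real (card \<S>) + c E))" for a A
  \<comment> \<open>For an answer \<open>a\<close> that no graph of \<open>\<G>\<close> gives, the
    class is empty and the premise of the induction hypothesis is vacuous; so a continuation exists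
    for every \<open>a\<close>.\<close>
  have "\<exists>A. good a A" for a
  proof -
    have "learnable V {E \<in> \<G>. induced_components E S = a} P (\<lambda>E. real (card \<S>) + c E)"
    proof (rule insert.IH)
      fix E0 assume E0: "E0 \<in> {E \<in> \<G>. induced_components E S = a}"
      have "{E \<in> {E \<in> \<G>. induced_components E S = a}. \<forall>S\<in>\<S>. induced_components E S = induced_components E0 S}
        = {E \<in> \<G>. \<forall>S\<in>insert S \<S>. induced_components E S = induced_components E0 S}"
        using E0 by auto
      then show "learnable V {E \<in> {E \<in> \<G>. induced_components E S = a}. \<forall>S\<in>\<S>. induced_components E S = induced_components E0 S} P c"
        using insert.prems(2)[of E0] E0 by simp
    qed (use insert.prems in auto)
    then show ?thesis unfolding learnable_def good_def .
  qed
  then obtain A where "\<And>a. good a (A a)" by metis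
  then have A: "\<And>a. queries_within V (A a)"
      "\<And>E. E \<in> \<G> \<Longrightarrow> result (induced_components E) (A (induced_components E S)) = E"
      "\<And>E. E \<in> \<G> \<Longrightarrow> P E \<Longrightarrow>
         real (num_queries (induced_components E) (A (induced_components E S))) \<le> real (card \<S>) + c E"
    by (auto simp: good_def)
  show ?case
    unfolding learnable_def
    using A insert.prems insert.hyps by (intro exI[of _ "Query S A"]) (auto simp: card_insert_if)
qed

lemma learnable_determined:
  assumes "finite \<S>" "\<S> \<subseteq> Pow V"
    and "\<And>E E'. E \<in> \<G> \<Longrightarrow> E' \<in> \<G> \<Longrightarrow>
      (\<And>S. S \<in> \<S> \<Longrightarrow> connected_rel E S = connected_rel E' S) \<Longrightarrow> E = E'"
  shows "learnable V \<G> P (\<lambda>_. real (card \<S>))"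
proof -
  have "learnable V \<G> P (\<lambda>E. real (card \<S>) + (\<lambda>_. 0) E)"
  proof (rule learnable_ask[OF assms(1,2)], rule learnable_unique)
    fix E0 E E'
    assume "E \<in> {E \<in> \<G>. \<forall>S\<in>\<S>. induced_components E S = induced_components E0 S}"
      "E' \<in> {E \<in> \<G>. \<forall>S\<in>\<S>. induced_components E S = induced_components E0 S}"
    then have "E \<in> \<G>" "E' \<in> \<G>"
      "\<And>S. S \<in> \<S> \<Longrightarrow> induced_components E S = induced_components E' S" by auto
    then show "E = E'"
      using assms(3) conn_eq_if_components_eq by metis
  qed simp
  then show ?thesis by simp
qed

lemma pairs_determine:
  assumes "simple_graph V E" "simple_graph V E'"
    and "\<And>u v. u \<in> V \<Longrightarrow> v \<in> V \<Longrightarrow> u \<noteq> v \<Longrightarrow> {u, v} \<in> E \<longleftrightarrow> {u, v} \<in> E'"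
  shows "E = E'"
proof -
  have "e \<in> E \<longleftrightarrow> e \<in> E'" for e
  proof (cases "e \<subseteq> V \<and> card e = 2")
    case True
    then obtain u v where "e = {u, v}" "u \<noteq> v" by (auto simp: card_2_iff)
    then show ?thesis using assms(3) True by auto
  next
    case False
    then show ?thesis using assms(1,2) by (auto simp: simple_graph_def)
  qed
  then show ?thesis by blast
qed

lemma conn_pair_iff:
  assumes "simple_graph V E" "u \<noteq> v"
  shows "(u, v) \<in> connected_rel E {u, v} \<longleftrightarrow> {u, v} \<in> E"
proof (rule conn_pendant_iff)
  fix w assume "w \<in> {u, v}" "{u, w} \<in> E"
  moreover have "{u, u} \<notin> E" using assms(1) by (auto simp: simple_graph_def)
  ultimately show "w = v" by auto
qed (use assms in auto)

text \<open>Used in branches where the answers already refute \<open>P\<close>. The cost is then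
  unconstrained, but exactness has to be kept; asking all subsets of \<open>V\<close>, in particular
  all pairs, achieves it.\<close>

lemma learnable_brute_force:
  assumes "finite V" "\<And>E. E \<in> \<G> \<Longrightarrow> simple_graph V E" "\<And>E. E \<in> \<G> \<Longrightarrow> \<not> P E"
  shows "learnable V \<G> P c"
proof -
  have "learnable V \<G> P (\<lambda>_. real (card (Pow V)))"
  proof (rule learnable_determined)
    fix E E' assume *: "E \<in> \<G>" "E' \<in> \<G>" "\<And>S. S \<in> Pow V \<Longrightarrow> connected_rel E S = connected_rel E' S"
    show "E = E'"
    proof (rule pairs_determine)
      fix u v assume "u \<in> V" "v \<in> V" "u \<noteq> v"
      then have "connected_rel E {u, v} = connected_rel E' {u, v}" using *(3) by simp
      then show "{u, v} \<in> E \<longleftrightarrow> {u, v} \<in> E'"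
        using conn_pair_iff[OF assms(2)[OF *(1)] \<open>u \<noteq> v\<close>] conn_pair_iff[OF assms(2)[OF *(2)] \<open>u \<noteq> v\<close>]
        by simp
    qed (rule assms(2)[OF *(1)], rule assms(2)[OF *(2)])
  qed (use assms(1) in auto)
  then show ?thesis by (rule learnable_mono[OF _ order_refl]) (use assms(3) in auto)
qed

section \<open>Running algorithms with query budgets\<close>

text \<open>\<open>A\<close> is cut off when it wants to ask query number \<open>n + 1\<close>;
  \<open>B\<close> then starts afresh, without the answers obtained so far.\<close>

primrec try_for :: "'a cc_alg \<Rightarrow> nat \<Rightarrow> 'a cc_alg \<Rightarrow> 'a cc_alg" where
  "try_for (Output F) n B = Output F"
| "try_for (Query S A) n B = (case n of 0 \<Rightarrow> B | Suc n' \<Rightarrow> Query S (\<lambda>a. try_for (A a) n' B))"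

lemma queries_within_try_for:
  "queries_within V A \<Longrightarrow> queries_within V B \<Longrightarrow> queries_within V (try_for A n B)"
proof (induction A arbitrary: n)
  case (Query S A)
  then show ?case by (cases n) auto
qed simp

lemma result_try_for:
  "result \<phi> (try_for A n B) = (if num_queries \<phi> A \<le> n then result \<phi> A else result \<phi> B)"
proof (induction A arbitrary: n)
  case (Query S A)
  then show ?case by (cases n) auto
qed simp

lemma num_queries_try_for:
  "num_queries \<phi> (try_for A n B) =
    (if num_queries \<phi> A \<le> n then num_queries \<phi> A else n + num_queries \<phi> B)"
proof (induction A arbitrary: n)
  case (Query S A)
  then show ?case by (cases n) auto
qed simp

text \<open>The algorithms are chained by \<open>try_for\<close> with budgets \<open>r i\<close>,
  and the last one runs without limit, so the chain is exact. If run \<open>i\<close> fits its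
  budget, the chain ends there at the latest, having spent at most the budgets up to
  \<open>i\<close>.\<close>

lemma dovetail:
  fixes A :: "nat \<Rightarrow> 'a cc_alg" and r :: "nat \<Rightarrow> nat"
  assumes "\<And>i. i \<le> L \<Longrightarrow> queries_within V (A i)"
    and "\<And>i E. i \<le> L \<Longrightarrow> E \<in> \<G> \<Longrightarrow> result (induced_components E) (A i) = E"
  shows "\<exists>B. queries_within V B \<and> (\<forall>E\<in>\<G>. result (induced_components E) B = E \<and>
    (\<forall>i\<le>L. num_queries (induced_components E) (A i) \<le> r i \<longrightarrow>
       num_queries (induced_components E) B \<le> (\<Sum>j\<le>i. r j)))"
  using assms
proof (induction L arbitrary: A r)
  case 0
  then show ?case by (intro exI[of _ "A 0"]) auto
next
  case (Suc L)
  obtain B where B: "queries_within V B"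
    "\<And>E. E \<in> \<G> \<Longrightarrow> result (induced_components E) B = E"
    "\<And>E i. E \<in> \<G> \<Longrightarrow> i \<le> L \<Longrightarrow> num_queries (induced_components E) (A (Suc i)) \<le> r (Suc i) \<Longrightarrow>
       num_queries (induced_components E) B \<le> (\<Sum>j\<le>i. r (Suc j))"
    using Suc.IH[of "\<lambda>i. A (Suc i)" "\<lambda>i. r (Suc i)"] Suc.prems by auto
  have "num_queries (induced_components E) (try_for (A 0) (r 0) B) \<le> (\<Sum>j\<le>i. r j)"
    if "E \<in> \<G>" "i \<le> Suc L" "num_queries (induced_components E) (A i) \<le> r i" for E i
  proof (cases i)
    case 0
    then show ?thesis using that by (simp add: num_queries_try_for)
  next
    case (Suc i')
    then have "num_queries (induced_components E) B \<le> (\<Sum>j\<le>i'. r (Suc j))"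
      using B(3)[of E i'] that by simp
    then show ?thesis
      unfolding Suc num_queries_try_for sum.atMost_Suc_shift by simp
  qed
  then show ?case
    using B Suc.prems
    by (intro exI[of _ "try_for (A 0) (r 0) B"]) (simp add: queries_within_try_for result_try_for)
qed

section \<open>Separating query families\<close>

text \<open>Averaging: \<open>w\<close> is a probability distribution on \<Omega> under which each
  target is hit with probability at least \<alpha>, so some set hits an \<alpha>-fraction of the
  targets still missed. Taking the best set \<open>k\<close> times leaves at most the fraction
  \<open>(1 - \<alpha>) ^ k\<close>.\<close>

lemma greedy_cover:
  fixes w :: "'s \<Rightarrow> real" and \<alpha> :: real
  assumes "finite \<Omega>" "\<And>S. S \<in> \<Omega> \<Longrightarrow> 0 \<le> w S" "sum w \<Omega> = 1" "finite \<T>"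
    and hit: "\<And>T. T \<in> \<T> \<Longrightarrow> \<alpha> \<le> sum w {S \<in> \<Omega>. hit S T}" and "\<alpha> \<le> 1"
  shows "\<exists>\<S>\<subseteq>\<Omega>. finite \<S> \<and> card \<S> \<le> k \<and>
    real (card {T \<in> \<T>. \<forall>S\<in>\<S>. \<not> hit S T}) \<le> (1 - \<alpha>) ^ k * real (card \<T>)"
proof (induction k)
  case 0
  then show ?case by (intro exI[of _ "{}"]) simp
next
  case (Suc k)
  then obtain \<S> where S: "\<S> \<subseteq> \<Omega>" "finite \<S>" "card \<S> \<le> k"
    "real (card {T \<in> \<T>. \<forall>S\<in>\<S>. \<not> hit S T}) \<le> (1 - \<alpha>) ^ k * real (card \<T>)"
    by blast
  define U where "U = {T \<in> \<T>. \<forall>S\<in>\<S>. \<not> hit S T}"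
  define c where "c S = card {T \<in> U. hit S T}" for S
  have fU: "finite U" using assms(4) by (simp add: U_def)
  have "\<Omega> \<noteq> {}" using assms(3) by auto
  then have "Max (c ` \<Omega>) \<in> c ` \<Omega>" using assms(1) by (intro Max_in) auto
  then obtain S0 where S0: "S0 \<in> \<Omega>" "c S0 = Max (c ` \<Omega>)" by auto
  have "\<alpha> * real (card U) = (\<Sum>T\<in>U. \<alpha>)" by simp
  also have "\<dots> \<le> (\<Sum>T\<in>U. sum w {S \<in> \<Omega>. hit S T})"
    by (intro sum_mono hit) (simp add: U_def)
  also have "\<dots> = (\<Sum>T\<in>U. \<Sum>S\<in>\<Omega>. if hit S T then w S else 0)"
    using assms(1) by (simp add: sum.inter_filter)
  also have "\<dots> = (\<Sum>S\<in>\<Omega>. \<Sum>T\<in>U. if hit S T then w S else 0)"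
    by (rule sum.swap)
  also have "\<dots> = (\<Sum>S\<in>\<Omega>. w S * real (c S))"
    using fU by (simp add: c_def sum.inter_filter[symmetric] mult.commute)
  also have "\<dots> \<le> (\<Sum>S\<in>\<Omega>. w S * real (c S0))"
    using assms(1,2) S0 by (intro sum_mono mult_left_mono) auto
  also have "\<dots> = real (c S0)" using assms(3) by (simp add: sum_distrib_right[symmetric])
  finally have c0: "\<alpha> * real (card U) \<le> real (c S0)" .
  have "{T \<in> \<T>. \<forall>S\<in>insert S0 \<S>. \<not> hit S T} = U - {T \<in> U. hit S0 T}"
    by (auto simp: U_def)
  then have "card {T \<in> \<T>. \<forall>S\<in>insert S0 \<S>. \<not> hit S T} = card U - c S0"
    using fU by (simp add: card_Diff_subset c_def)
  moreover have "c S0 \<le> card U" using fU by (auto simp: c_def intro: card_mono)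
  ultimately have "real (card {T \<in> \<T>. \<forall>S\<in>insert S0 \<S>. \<not> hit S T}) = real (card U) - real (c S0)"
    by (simp add: of_nat_diff)
  also have "\<dots> \<le> (1 - \<alpha>) * real (card U)" using c0 by (simp add: algebra_simps)
  also have "\<dots> \<le> (1 - \<alpha>) * ((1 - \<alpha>) ^ k * real (card \<T>))"
    using S(4) assms(6) by (intro mult_left_mono) (auto simp: U_def)
  finally show ?case
    using S S0 by (intro exI[of _ "insert S0 \<S>"]) (auto simp: card_insert_if mult.assoc)
qed

section \<open>Random vertex sets and their hitting probabilities\<close>

lemma sum_power_card_Pow:
  fixes x y :: real
  assumes "finite V"
  shows "(\<Sum>S\<in>Pow V. x ^ card S * y ^ card (V - S)) = (x + y) ^ card V"
  using prod_add[OF assms, of "\<lambda>_. x" "\<lambda>_. y"] by simp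

text \<open>Independence for a random vertex set that contains each vertex with probability
  \<open>p\<close>: the sum is the probability of containing \<open>A\<close> and missing
  \<open>B\<close>.\<close>

lemma random_subset_cylinder:
  fixes p :: real
  assumes "finite V" "A \<subseteq> V" "B \<subseteq> V" "A \<inter> B = {}"
  shows "(\<Sum>S\<in>{S \<in> Pow V. A \<subseteq> S \<and> S \<inter> B = {}}. p ^ card S * (1 - p) ^ card (V - S)) =
    p ^ card A * (1 - p) ^ card B"
proof -
  \<comment> \<open>Weights of putting \<open>v\<close> into the set and of leaving it out; a zero
    rules out the choice forbidden by \<open>B\<close> or by \<open>A\<close>. Expanding the product
    over \<open>V\<close> yields the sum over the allowed sets.\<close>
  let ?f = "\<lambda>v. if v \<in> B then 0 else p" and ?g = "\<lambda>v. if v \<in> A then 0 else 1 - p"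
  have "(\<Prod>v\<in>V. ?f v + ?g v) = (\<Prod>v\<in>V. (if v \<in> A then p else 1) * (if v \<in> B then 1 - p else 1))"
    using assms(4) by (intro prod.cong) auto
  also have "\<dots> = p ^ card A * (1 - p) ^ card B"
    using assms by (simp add: prod.distrib prod.If_cases Int_absorb1)
  finally have 1: "(\<Prod>v\<in>V. ?f v + ?g v) = p ^ card A * (1 - p) ^ card B" .
  have "prod ?f S * prod ?g (V - S) =
      (if A \<subseteq> S \<and> S \<inter> B = {} then p ^ card S * (1 - p) ^ card (V - S) else 0)"
    if "S \<in> Pow V" for S
  proof (cases "A \<subseteq> S \<and> S \<inter> B = {}")
    case True
    then have "prod ?f S = (\<Prod>v\<in>S. p)" "prod ?g (V - S) = (\<Prod>v\<in>V - S. 1 - p)"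
      by (intro prod.cong; auto)+
    then show ?thesis using True by simp
  next
    case False
    then consider a where "a \<in> A" "a \<notin> S" | b where "b \<in> S" "b \<in> B" by blast
    then show ?thesis
    proof cases
      case 1
      then have "prod ?g (V - S) = 0" using assms by (intro prod_zero) auto
      then show ?thesis using False by auto
    next
      case 2
      then have "prod ?f S = 0" using that assms(1) finite_subset by (intro prod_zero) auto
      then show ?thesis using False by auto
    qed
  qed
  then have "(\<Sum>S\<in>Pow V. prod ?f S * prod ?g (V - S)) =
      (\<Sum>S\<in>Pow V. if A \<subseteq> S \<and> S \<inter> B = {} then p ^ card S * (1 - p) ^ card (V - S) else 0)"
    by (rule sum.cong[OF refl])
  then show ?thesis
    using 1 prod_add[OF assms(1), of ?f ?g] assms(1)
    by (simp only: sum.inter_filter finite_Pow_iff)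
qed

text \<open>Bernoulli's inequality at exponent \<open>D\<close> gives only 0. At exponent
  \<open>D div 2\<close> it gives about 1/2, and squaring yields 1/4; for odd \<open>D\<close> one
  more factor is left over.\<close>

lemma one_minus_inverse_power:
  assumes "2 \<le> D"
  shows "1 / 4 \<le> (1 - 1 / real D) ^ D"
proof -
  define h where "h = D div 2"
  have h: "1 \<le> real h" using assms by (simp add: h_def)
  have "1 + real h * (- 1 / real D) \<le> (1 + - 1 / real D) ^ h"
    using assms by (intro Bernoulli_inequality) (simp add: field_simps)
  then have bern: "1 - real h / real D \<le> (1 - 1 / real D) ^ h" by simp
  show ?thesis
  proof (cases "even D")
    case True
    then have "D = 2 * h" by (simp add: h_def)
    then have D: "real D = 2 * real h" by simp
    have "(1 / 2)\<^sup>2 \<le> ((1 - 1 / real D) ^ h)\<^sup>2"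
      using bern h by (intro power_mono) (simp_all add: D)
    also have "\<dots> = (1 - 1 / real D) ^ D"
      using True by (simp add: h_def power_mult[symmetric] mult.commute)
    finally show ?thesis by (simp add: power2_eq_square)
  next
    case False
    then have Dn: "D = Suc (2 * h)" by (simp add: h_def)
    then have D: "real D = 2 * real h + 1" by simp
    \<comment> \<open>Cleared of denominators, this says
      \<open>1 <= 2 * h + 4 * h^2\<close>.\<close>
    have "1 / 4 \<le> ((real h + 1) / (2 * real h + 1))\<^sup>2 * (2 * real h / (2 * real h + 1))"
    proof -
      have "1 \<le> real h * 2 + real h * (real h * 4)"
        using h mult_nonneg_nonneg[of "real h" "real h * 4"] by linarith
      then show ?thesis
        using h by (simp add: divide_simps power2_eq_square) (simp add: algebra_simps)
    qed
    also have "(real h + 1) / (2 * real h + 1) = 1 - real h / real D"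
      using h by (simp add: D field_simps)
    also have "2 * real h / (2 * real h + 1) = 1 - 1 / real D"
      using h by (simp add: D field_simps)
    also have "(1 - real h / real D)\<^sup>2 * (1 - 1 / real D) \<le> ((1 - 1 / real D) ^ h)\<^sup>2 * (1 - 1 / real D)"
      using bern h by (intro mult_right_mono power_mono) (simp_all add: D field_simps)
    also have "\<dots> = (1 - 1 / real D) ^ D"
      unfolding Dn by (simp add: power_mult[symmetric] mult.commute)
    finally show ?thesis .
  qed
qed

text \<open>Second moments. \<open>N\<close> counts the pairs of \<open>M\<close> in a random set of
  density \<open>1 / D\<close>, restricted to the event, of probability \<open>q\<close>, that
  \<open>X\<close> is avoided. Its mean is \<open>q / D\<close> and its second moment at most
  \<open>2 * q / D\<close>; Bonferroni then gives at least \<open>q / (2 * D)\<close>, and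
  \<open>q\<close> is at least 1/4.\<close>

lemma hit_probability:
  fixes D :: nat
  defines "p \<equiv> 1 / real D"
  assumes "finite V" "2 \<le> D" "X \<subseteq> V" "card X \<le> D"
    and M: "\<And>e. e \<in> M \<Longrightarrow> e \<subseteq> V - X \<and> card e = 2" "card M = D"
  shows "1 / (8 * real D) \<le>
    (\<Sum>S\<in>{S \<in> Pow V. S \<inter> X = {} \<and> (\<exists>e\<in>M. e \<subseteq> S)}. p ^ card S * (1 - p) ^ card (V - S))"
proof -
  define w where "w S = p ^ card S * (1 - p) ^ card (V - S)" for S
  define q where "q = (1 - p) ^ card X"
  define \<Omega> where "\<Omega> = {S \<in> Pow V. S \<inter> X = {}}"
  define N where "N S = card {e \<in> M. e \<subseteq> S}" for S
  have D: "real D \<ge> 2" using assms(3) by simp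
  then have p: "0 < p" "p \<le> 1 / 2" "real D * p = 1" by (auto simp: p_def field_simps)
  have fM: "finite M" using M(2) assms(3) by (intro card_ge_0_finite) simp
  have f\<Omega>: "finite \<Omega>" using assms(2) by (simp add: \<Omega>_def)
  have w0: "0 \<le> w S" for S using p by (simp add: w_def)
  have N_eq: "real (N S) = (\<Sum>e\<in>M. if e \<subseteq> S then 1 else 0)" for S
    using fM by (simp add: N_def sum.inter_filter[symmetric])
  have cyl: "(\<Sum>S\<in>\<Omega>. w S * (if A \<subseteq> S then 1 else 0)) = p ^ card A * q" if "A \<subseteq> V - X" for A
  proof -
    have "(\<Sum>S\<in>\<Omega>. w S * (if A \<subseteq> S then 1 else 0)) = (\<Sum>S\<in>\<Omega>. if A \<subseteq> S then w S else 0)"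
      by (intro sum.cong) auto
    also have "\<dots> = (\<Sum>S\<in>{S \<in> \<Omega>. A \<subseteq> S}. w S)"
      using f\<Omega> by (simp add: sum.inter_filter)
    also have "{S \<in> \<Omega>. A \<subseteq> S} = {S \<in> Pow V. A \<subseteq> S \<and> S \<inter> X = {}}"
      by (auto simp: \<Omega>_def)
    also have "(\<Sum>S\<in>{S \<in> Pow V. A \<subseteq> S \<and> S \<inter> X = {}}. w S) = p ^ card A * q"
      unfolding w_def q_def using that assms by (intro random_subset_cylinder) auto
    finally show ?thesis .
  qed
  have first: "(\<Sum>S\<in>\<Omega>. w S * real (N S)) = real D * p\<^sup>2 * q"
  proof -
    have "(\<Sum>S\<in>\<Omega>. w S * real (N S)) = (\<Sum>e\<in>M. \<Sum>S\<in>\<Omega>. w S * (if e \<subseteq> S then 1 else 0))"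
      unfolding N_eq sum_distrib_left by (rule sum.swap)
    also have "\<dots> = (\<Sum>e\<in>M. p\<^sup>2 * q)" using cyl M(1) by (intro sum.cong) auto
    finally show ?thesis using M(2) by simp
  qed
  have second: "(\<Sum>S\<in>\<Omega>. w S * (real (N S))\<^sup>2) \<le> real D * (p\<^sup>2 + real D * p ^ 3) * q"
  proof -
    have "(\<Sum>S\<in>\<Omega>. w S * (real (N S))\<^sup>2) =
        (\<Sum>S\<in>\<Omega>. \<Sum>e\<in>M. \<Sum>e'\<in>M. w S * (if e \<union> e' \<subseteq> S then 1 else 0))"
      unfolding N_eq power2_eq_square sum_product sum_distrib_left
      by (intro sum.cong refl) (simp add: sum_distrib_left)
    also have "\<dots> = (\<Sum>e\<in>M. \<Sum>S\<in>\<Omega>. \<Sum>e'\<in>M. w S * (if e \<union> e' \<subseteq> S then 1 else 0))"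
      by (rule sum.swap)
    also have "\<dots> = (\<Sum>e\<in>M. \<Sum>e'\<in>M. \<Sum>S\<in>\<Omega>. w S * (if e \<union> e' \<subseteq> S then 1 else 0))"
      by (intro sum.cong refl sum.swap)
    also have "\<dots> = (\<Sum>e\<in>M. \<Sum>e'\<in>M. p ^ card (e \<union> e') * q)"
      using M(1) by (intro sum.cong refl cyl) auto
    also have "\<dots> \<le> (\<Sum>e\<in>M. (p\<^sup>2 + real D * p ^ 3) * q)"
    proof (rule sum_mono)
      fix e assume e: "e \<in> M"
      \<comment> \<open>Two distinct pairs may share a vertex but span at least three, whence the
        exponent 3.\<close>
      have "p ^ card (e \<union> e') \<le> (if e' = e then p\<^sup>2 else 0) + p ^ 3" if "e' \<in> M" for e'
      proof (cases "e' = e")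
        case True
        then show ?thesis using M(1)[OF e] p by simp
      next
        case False
        have fin: "finite e" "finite e'" using M(1)[OF e] M(1)[OF that] by (auto intro: card_ge_0_finite)
        have "\<not> e' \<subseteq> e" using False M(1)[OF e] M(1)[OF that] fin card_subset_eq by metis
        then have "e \<subset> e \<union> e'" by auto
        then have "card e < card (e \<union> e')" using fin by (intro psubset_card_mono) auto
        then have "p ^ card (e \<union> e') \<le> p ^ 3"
          using p M(1)[OF e] by (intro power_decreasing) auto
        then show ?thesis using False by simp
      qed
      then have "(\<Sum>e'\<in>M. p ^ card (e \<union> e')) \<le> (\<Sum>e'\<in>M. (if e' = e then p\<^sup>2 else 0) + p ^ 3)"
        by (rule sum_mono)
      also have "\<dots> = p\<^sup>2 + real D * p ^ 3" using fM e M(2) by (simp add: sum.distrib)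
      finally show "(\<Sum>e'\<in>M. p ^ card (e \<union> e') * q) \<le> (p\<^sup>2 + real D * p ^ 3) * q"
        unfolding sum_distrib_right[symmetric] using p by (intro mult_right_mono) (auto simp: q_def)
    qed
    finally show ?thesis using M(2) by simp
  qed
  \<comment> \<open>The left side is \<open>n - (n choose 2)\<close>, the lower Bonferroni bound for
    the event that \<open>n\<close> is not 0.\<close>
  have bonf: "(3 * real n - (real n)\<^sup>2) / 2 \<le> (if n \<noteq> 0 then 1 else 0)" for n :: nat
  proof -
    have "0 \<le> (real n - 1) * (real n - 2)"
      by (cases "n \<le> 1") (auto intro: mult_nonpos_nonpos mult_nonneg_nonneg)
    then show ?thesis by (auto simp: power2_eq_square algebra_simps)
  qed
  have q: "1 / 4 \<le> q"
  proof -
    have "1 / 4 \<le> (1 - p) ^ D" using one_minus_inverse_power[OF assms(3)] by (simp add: p_def)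
    also have "\<dots> \<le> q" unfolding q_def using p assms(5) by (intro power_decreasing) auto
    finally show ?thesis .
  qed
  have sq: "real D * p\<^sup>2 = p" "real D * p ^ 3 = p\<^sup>2"
    using p(3) by (auto simp: power2_eq_square power3_eq_cube mult.assoc[symmetric])
  have "1 / (8 * real D) = 1 / 4 * (p / 2)" by (simp add: p_def)
  also have "\<dots> \<le> q * (p / 2)" using q p by (intro mult_right_mono) auto
  also have "\<dots> = (3 * (real D * p\<^sup>2 * q) - real D * (p\<^sup>2 + real D * p ^ 3) * q) / 2"
    by (simp add: sq distrib_left)
  also have "\<dots> \<le> (3 * (\<Sum>S\<in>\<Omega>. w S * real (N S)) - (\<Sum>S\<in>\<Omega>. w S * (real (N S))\<^sup>2)) / 2"
    using first second by simp
  also have "\<dots> = (\<Sum>S\<in>\<Omega>. w S * ((3 * real (N S) - (real (N S))\<^sup>2) / 2))"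
    by (simp add: sum_distrib_left sum_subtractf[symmetric] sum_divide_distrib[symmetric] right_diff_distrib mult.left_commute)
  also have "\<dots> \<le> (\<Sum>S\<in>\<Omega>. w S * (if N S \<noteq> 0 then 1 else 0))"
    by (intro sum_mono mult_left_mono bonf w0)
  also have "\<dots> = (\<Sum>S\<in>\<Omega>. if N S \<noteq> 0 then w S else 0)"
    by (intro sum.cong) auto
  also have "\<dots> = (\<Sum>S\<in>{S \<in> \<Omega>. N S \<noteq> 0}. w S)" using f\<Omega> by (simp only: sum.inter_filter)
  also have "{S \<in> \<Omega>. N S \<noteq> 0} = {S \<in> Pow V. S \<inter> X = {} \<and> (\<exists>e\<in>M. e \<subseteq> S)}"
    using fM by (auto simp: \<Omega>_def N_def)
  finally show ?thesis by (simp add: w_def)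
qed

text \<open>With \<open>k\<close> just above \<open>ln (card \<T>) / \<alpha>\<close>, greedy
  covering leaves fewer than one target, hence none.\<close>

lemma hitting_family:
  fixes \<T> :: "('a set \<times> 'a set set) set"
  assumes "finite V" "2 \<le> D" "finite \<T>"
    and T: "\<And>X M. (X, M) \<in> \<T> \<Longrightarrow>
      X \<subseteq> V \<and> card X \<le> D \<and> card M = D \<and> (\<forall>e\<in>M. e \<subseteq> V - X \<and> card e = 2)"
  shows "\<exists>\<S>\<subseteq>Pow V. finite \<S> \<and> real (card \<S>) \<le> 8 * real D * ln (real (card \<T>)) + 1 \<and>
    (\<forall>X M. (X, M) \<in> \<T> \<longrightarrow> (\<exists>S\<in>\<S>. S \<inter> X = {} \<and> (\<exists>e\<in>M. e \<subseteq> S)))"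
proof (cases "\<T> = {}")
  case True
  then show ?thesis by (intro exI[of _ "{}"]) simp
next
  case False
  define p where "p = 1 / real D"
  define w where "w S = p ^ card S * (1 - p) ^ card (V - S)" for S :: "'a set"
  define hit where "hit S T \<longleftrightarrow> S \<inter> fst T = {} \<and> (\<exists>e\<in>snd T. e \<subseteq> S)" for S :: "'a set" and T
  define \<alpha> where "\<alpha> = 1 / (8 * real D)"
  define l where "l = ln (real (card \<T>))"
  \<comment> \<open>The \<open>+ 1\<close> makes \<open>k\<close> strictly larger than
    \<open>8 * D * l\<close>; strictness is what pushes the number of missed targets below
    1.\<close>
  define k where "k = nat \<lfloor>8 * real D * l\<rfloor> + 1"
  have cT: "1 \<le> card \<T>" using False assms(3) by (simp add: Suc_le_eq card_gt_0_iff)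
  then have l: "0 \<le> l" by (simp add: l_def)
  have D: "2 \<le> real D" using assms(2) by simp
  have \<alpha>: "0 < \<alpha>" "\<alpha> \<le> 1" using D by (auto simp: \<alpha>_def field_simps)
  have "\<alpha> \<le> sum w {S \<in> Pow V. hit S T}" if "T \<in> \<T>" for T
  proof -
    have "(fst T, snd T) \<in> \<T>" using that by simp
    then show ?thesis
      unfolding \<alpha>_def w_def p_def hit_def
      using T[of "fst T" "snd T"] assms(1,2) by (intro hit_probability) auto
  qed
  moreover have "sum w (Pow V) = 1"
    using sum_power_card_Pow[OF assms(1), of p "1 - p"] by (simp add: w_def)
  moreover have "0 \<le> w S" for S using D by (simp add: w_def p_def)
  ultimately obtain \<S> where S: "\<S> \<subseteq> Pow V" "finite \<S>" "card \<S> \<le> k"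
    "real (card {T \<in> \<T>. \<forall>S\<in>\<S>. \<not> hit S T}) \<le> (1 - \<alpha>) ^ k * real (card \<T>)"
    using greedy_cover[of "Pow V" w \<T> \<alpha> hit k] assms(1,3) \<alpha> by auto
  have k: "8 * real D * l < real k" "real k \<le> 8 * real D * l + 1"
    using l by (auto simp: k_def) linarith+
  have "(1 - \<alpha>) ^ k \<le> exp (- \<alpha>) ^ k"
    using \<alpha> exp_ge_add_one_self[of "- \<alpha>"] by (intro power_mono) auto
  also have "\<dots> = exp (- (\<alpha> * real k))" by (simp add: exp_of_nat_mult[symmetric] mult.commute)
  also have "\<dots> < exp (- l)"
    using k(1) D by (simp add: \<alpha>_def field_simps)
  also have "\<dots> = 1 / real (card \<T>)" using cT by (simp add: l_def exp_minus inverse_eq_divide)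
  finally have "(1 - \<alpha>) ^ k * real (card \<T>) < 1" using cT by (simp add: field_simps)
  with S(4) have "card {T \<in> \<T>. \<forall>S\<in>\<S>. \<not> hit S T} = 0" by simp
  then have "{T \<in> \<T>. \<forall>S\<in>\<S>. \<not> hit S T} = {}" using assms(3) by simp
  then have "\<forall>T\<in>\<T>. \<exists>S\<in>\<S>. hit S T" by blast
  then have "\<exists>S\<in>\<S>. S \<inter> X = {} \<and> (\<exists>e\<in>M. e \<subseteq> S)" if "(X, M) \<in> \<T>" for X M
    using bspec[of \<T> "\<lambda>T. \<exists>S\<in>\<S>. hit S T", OF _ that] by (simp add: hit_def)
  moreover have "real (card \<S>) \<le> 8 * real D * ln (real (card \<T>)) + 1"
    using S(3) k(2) unfolding l_def by linarith
  ultimately show ?thesis using S(1,2) by blast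
qed

section \<open>Counting arguments for the size of separating families\<close>

text \<open>Each small \<open>X\<close> is counted with weight
  \<open>(B / D) ^ D * (D / B) ^ card X\<close>, which is at least 1; summed over all subsets of
  \<open>V\<close>, the weights give \<open>(B / D) ^ D * (1 + D / B) ^ card V\<close>. The bound
  \<open>B\<close> in place of \<open>card V\<close> allows \<open>D\<close> to exceed
  \<open>card V\<close>.\<close>

lemma card_small_subsets:
  fixes B :: real
  assumes "finite V" "real (card V) \<le> B" "real D \<le> B" "0 < D"
  shows "real (card {X. X \<subseteq> V \<and> card X \<le> D}) \<le> (exp 1 * B / real D) ^ D"
proof -
  let ?x = "real D / B"
  have B: "0 < B" "1 \<le> B / real D" using assms(3,4) by (auto simp: field_simps)
  have "real (card {X. X \<subseteq> V \<and> card X \<le> D}) = (\<Sum>X\<in>{X \<in> Pow V. card X \<le> D}. 1)" by simp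
  also have "\<dots> \<le> (\<Sum>X\<in>{X \<in> Pow V. card X \<le> D}. (B / real D) ^ D * ?x ^ card X)"
  proof (rule sum_mono)
    fix X assume "X \<in> {X \<in> Pow V. card X \<le> D}"
    then have "(B / real D) ^ D = (B / real D) ^ (D - card X) * (B / real D) ^ card X"
      by (simp add: power_add[symmetric])
    moreover have "(B / real D) ^ card X * ?x ^ card X = 1"
      using assms(4) B by (simp add: power_mult_distrib[symmetric])
    ultimately have "(B / real D) ^ D * ?x ^ card X = (B / real D) ^ (D - card X)"
      by (simp add: mult.assoc)
    then show "1 \<le> (B / real D) ^ D * ?x ^ card X" using B by (simp add: one_le_power)
  qed
  also have "\<dots> \<le> (\<Sum>X\<in>Pow V. (B / real D) ^ D * ?x ^ card X)"
    using assms(1) B by (intro sum_mono2) auto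
  also have "\<dots> = (B / real D) ^ D * (1 + ?x) ^ card V"
    using sum_power_card_Pow[OF assms(1), of ?x 1] by (simp add: sum_distrib_left[symmetric] add.commute)
  also have "\<dots> \<le> (B / real D) ^ D * exp 1 ^ D"
  proof (rule mult_left_mono)
    have "(1 + ?x) ^ card V \<le> exp ?x ^ card V"
      using B by (intro power_mono exp_ge_add_one_self) auto
    also have "\<dots> = exp (?x * real (card V))" by (rule exp_of_nat2_mult[symmetric])
    also have "\<dots> \<le> exp (?x * B)"
      unfolding exp_le_cancel_iff using assms(2) B by (intro mult_left_mono) auto
    also have "\<dots> = exp 1 ^ D" using B by (simp add: exp_of_nat2_mult[symmetric])
    finally show "(1 + ?x) ^ card V \<le> exp 1 ^ D" .
  qed (use B in simp)
  finally show ?thesis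
    using B by (simp add: power_mult_distrib power_divide mult.commute)
qed

text \<open>Equivalently: for every \<open>X\<close> of size at most \<open>D\<close>, fewer than \<open>D\<close> of the pairs disjoint from \<open>X\<close>
  (respectively of those at a given vertex) fail to occur in a query that avoids \<open>X\<close>.\<close>

definition separating :: "'a set \<Rightarrow> nat \<Rightarrow> 'a set set \<Rightarrow> bool" where
  "separating V D \<S> \<longleftrightarrow>
     (\<forall>X M. X \<subseteq> V \<longrightarrow> card X \<le> D \<longrightarrow> card M = D \<longrightarrow> (\<forall>e\<in>M. e \<subseteq> V - X \<and> card e = 2) \<longrightarrow>
       (\<exists>S\<in>\<S>. S \<inter> X = {} \<and> (\<exists>e\<in>M. e \<subseteq> S)))"

definition star_separating :: "'a set \<Rightarrow> nat \<Rightarrow> 'a set set \<Rightarrow> bool" where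
  "star_separating V D \<S> \<longleftrightarrow>
     (\<forall>u X L. u \<in> V \<longrightarrow> X \<subseteq> V - {u} \<longrightarrow> card X \<le> D \<longrightarrow> L \<subseteq> V - X - {u} \<longrightarrow> card L = D \<longrightarrow>
       (\<exists>S\<in>\<S>. u \<in> S \<and> S \<inter> X = {} \<and> S \<inter> L \<noteq> {}))"

lemma separatingD:
  assumes "separating V D \<S>" "X \<subseteq> V" "card X \<le> D" "card M = D"
    and "\<And>e. e \<in> M \<Longrightarrow> e \<subseteq> V - X \<and> card e = 2"
  obtains S e where "S \<in> \<S>" "S \<inter> X = {}" "e \<in> M" "e \<subseteq> S"
proof -
  have "\<exists>S\<in>\<S>. S \<inter> X = {} \<and> (\<exists>e\<in>M. e \<subseteq> S)"
    using assms(1)[unfolded separating_def, rule_format, of X M] assms(2-) by simp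
  then show ?thesis using that by auto
qed

lemma card_star_pairs: "u \<notin> L \<Longrightarrow> card ((\<lambda>v. {u, v}) ` L) = card L"
  by (intro card_image) (auto simp: inj_on_def doubleton_eq_iff)

lemma separating_imp_star_separating:
  assumes "separating V D \<S>"
  shows "star_separating V D \<S>"
  unfolding star_separating_def
proof (intro allI impI)
  fix u X L
  assume *: "u \<in> V" "X \<subseteq> V - {u}" "card X \<le> D" "L \<subseteq> V - X - {u}" "card L = D"
  then have "card ((\<lambda>v. {u, v}) ` L) = D" by (subst card_star_pairs) auto
  moreover have "e \<subseteq> V - X \<and> card e = 2" if e: "e \<in> (\<lambda>v. {u, v}) ` L" for e
  proof -
    obtain v where v: "v \<in> L" "e = {u, v}" using e by auto
    then have "v \<noteq> u" "v \<in> V" "v \<notin> X" using *(4) by auto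
    moreover have "u \<notin> X" using *(2) by auto
    ultimately show ?thesis using v *(1) by (simp add: card_insert_if)
  qed
  moreover have "X \<subseteq> V" using *(2) by auto
  ultimately obtain S e where S: "S \<in> \<S>" "S \<inter> X = {}" "e \<in> (\<lambda>v. {u, v}) ` L" "e \<subseteq> S"
    using separatingD[OF assms, of X] *(3) by metis
  then obtain v where "v \<in> L" "{u, v} \<subseteq> S" by auto
  with S show "\<exists>S\<in>\<S>. u \<in> S \<and> S \<inter> X = {} \<and> S \<inter> L \<noteq> {}" by (intro bexI[of _ S]) auto
qed

lemma ln_le_log2: "1 \<le> x \<Longrightarrow> ln x \<le> log 2 x"
proof -
  assume "1 \<le> x"
  then have "ln x * ln 2 \<le> ln x * 1" using ln_2_less_1 by (intro mult_left_mono) auto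
  then show ?thesis by (simp add: log_def field_simps)
qed

text \<open>There are at most \<open>(exp 1 * n) ^ D\<close> choices of \<open>X\<close> and
  \<open>(n ^ 2) ^ D\<close> of \<open>M\<close>, so the logarithm of the number of targets is O(D
  log n); the hitting probability of order \<open>1 / D\<close> contributes the second factor
  \<open>D\<close>.\<close>

lemma separating_family:
  assumes "finite V" "2 \<le> card V" "2 \<le> D"
  shows "\<exists>\<S>\<subseteq>Pow V. finite \<S> \<and> separating V D \<S> \<and>
    real (card \<S>) \<le> 33 * (real D)\<^sup>2 * log 2 (real (card V))"
proof -
  define n where "n = real (card V)"
  define P where "P = {e. e \<subseteq> V \<and> card e = 2}"
  define \<X> where "\<X> = {X. X \<subseteq> V \<and> card X \<le> D}"
  define \<M> where "\<M> = {M. M \<subseteq> P \<and> card M = D}"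
  define \<T> where "\<T> = {(X, M) \<in> \<X> \<times> \<M>. \<forall>e\<in>M. e \<subseteq> V - X \<and> card e = 2}"
  have n: "2 \<le> n" and D: "2 \<le> real D" using assms by (auto simp: n_def)
  have fin: "finite P" "finite \<X>" using assms(1) by (auto simp: P_def \<X>_def)
  then have "finite \<M>" by (simp add: \<M>_def)
  then have fin': "finite (\<X> \<times> \<M>)" using fin by simp
  then have finT: "finite \<T>" by (rule rev_finite_subset) (auto simp: \<T>_def)
  have \<X>: "real (card \<X>) \<le> (exp 1 * n) ^ D"
  proof -
    \<comment> \<open>\<open>D\<close> may exceed the number of vertices, so the count is applied
      with the bound \<open>max n D\<close>.\<close>
    have "max n (real D) / real D \<le> n" using n D by (auto simp: max_def field_simps)
    then have "exp 1 * (max n (real D) / real D) \<le> exp 1 * n"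
      by (rule mult_left_mono) simp
    then have "exp 1 * max n (real D) / real D \<le> exp 1 * n" by simp
    then have "(exp 1 * max n (real D) / real D) ^ D \<le> (exp 1 * n) ^ D"
      using n by (intro power_mono) auto
    moreover have "real (card \<X>) \<le> (exp 1 * max n (real D) / real D) ^ D"
      unfolding \<X>_def using assms by (intro card_small_subsets) (auto simp: n_def)
    ultimately show ?thesis by linarith
  qed
  have \<M>: "real (card \<M>) \<le> (n ^ 2) ^ D"
  proof -
    have "card P = card V choose 2" unfolding P_def using assms(1) by (rule n_subsets)
    also have "\<dots> \<le> card V ^ 2" using assms(2) by (rule binomial_le_pow)
    finally have P: "card P \<le> card V ^ 2" .
    have "card \<M> = card P choose D" unfolding \<M>_def using fin(1) by (rule n_subsets)
    also have "\<dots> \<le> card P ^ D"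
      by (cases "D \<le> card P") (auto simp: binomial_le_pow binomial_eq_0)
    also have "\<dots> \<le> (card V ^ 2) ^ D" using P by (rule power_mono) simp
    finally have "real (card \<M>) \<le> real ((card V ^ 2) ^ D)" by (simp only: of_nat_le_iff)
    then show ?thesis by (simp add: n_def)
  qed
  have T: "X \<subseteq> V \<and> card X \<le> D \<and> card M = D \<and> (\<forall>e\<in>M. e \<subseteq> V - X \<and> card e = 2)"
    if "(X, M) \<in> \<T>" for X M
    using that by (simp add: \<T>_def \<X>_def \<M>_def)
  obtain \<S> where S: "\<S> \<subseteq> Pow V" "finite \<S>" "real (card \<S>) \<le> 8 * real D * ln (real (card \<T>)) + 1"
    "\<And>X M. (X, M) \<in> \<T> \<Longrightarrow> \<exists>S\<in>\<S>. S \<inter> X = {} \<and> (\<exists>e\<in>M. e \<subseteq> S)"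
    using hitting_family[OF assms(1,3) finT T] by metis
  have "separating V D \<S>"
    unfolding separating_def
  proof (intro allI impI)
    fix X M assume X: "X \<subseteq> V" "card X \<le> D" "card M = D" "\<forall>e\<in>M. e \<subseteq> V - X \<and> card e = 2"
    then have "M \<subseteq> P" by (auto simp: P_def)
    with X have "(X, M) \<in> \<T>" by (simp add: \<T>_def \<X>_def \<M>_def)
    then show "\<exists>S\<in>\<S>. S \<inter> X = {} \<and> (\<exists>e\<in>M. e \<subseteq> S)" by (rule S(4))
  qed
  moreover have "ln (real (card \<T>)) \<le> 4 * real D * log 2 n"
  proof (cases "\<T> = {}")
    case True
    then show ?thesis using n by simp
  next
    case False
    have "real (card \<T>) \<le> real (card (\<X> \<times> \<M>))"
      using fin' by (intro of_nat_mono card_mono) (auto simp: \<T>_def)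
    also have "\<dots> \<le> (exp 1 * n) ^ D * (n ^ 2) ^ D"
      unfolding card_cartesian_product of_nat_mult using \<X> \<M> by (intro mult_mono) auto
    finally have "ln (real (card \<T>)) \<le> ln ((exp 1 * n) ^ D * (n ^ 2) ^ D)"
      using False finT n by (intro ln_mono) (auto simp: card_gt_0_iff)
    also have "\<dots> = real D * (1 + 3 * ln n)"
      using n by (simp add: ln_mult ln_realpow algebra_simps)
    also have "\<dots> \<le> real D * (4 * log 2 n)"
    proof (intro mult_left_mono)
      have "1 \<le> log 2 n" using n by simp
      then show "1 + 3 * ln n \<le> 4 * log 2 n" using ln_le_log2[of n] n by linarith
    qed simp
    finally show ?thesis by simp
  qed
  then have "8 * real D * ln (real (card \<T>)) \<le> 8 * real D * (4 * real D * log 2 n)"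
    using D by (intro mult_left_mono) auto
  moreover have "1 * 1 \<le> (real D)\<^sup>2 * log 2 n"
    using n D by (intro mult_mono one_le_power) auto
  ultimately have "real (card \<S>) \<le> 33 * (real D)\<^sup>2 * log 2 n"
    using S(3) by (simp add: power2_eq_square)
  with \<open>separating V D \<S>\<close> S(1,2) show ?thesis unfolding n_def by blast
qed

text \<open>A target is now a vertex with two small sets. Only the ratio \<open>B / D\<close> enters
  and no factor \<open>log n\<close> appears; this saving keeps the sum over the scales in
  O(M).\<close>

lemma star_separating_family:
  fixes B :: real
  assumes "finite W" "2 \<le> D" "real (card W) \<le> B" "real D \<le> B"
  shows "\<exists>\<S>\<subseteq>Pow W. finite \<S> \<and> star_separating W D \<S> \<and>
    real (card \<S>) \<le> 25 * (real D)\<^sup>2 * (1 + ln (B / real D))"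
proof -
  define \<X> where "\<X> = {X. X \<subseteq> W \<and> card X \<le> D}"
  define \<Y> where "\<Y> = {(u, X, L). u \<in> W \<and> X \<in> \<X> \<and> L \<in> \<X> \<and> X \<subseteq> W - {u} \<and> L \<subseteq> W - X - {u} \<and> card L = D}"
  define \<T> where "\<T> = (\<lambda>(u, X, L). (X, (\<lambda>v. {u, v}) ` L)) ` \<Y>"
  have D: "2 \<le> real D" using assms(2) by simp
  have fX: "finite \<X>" using assms(1) by (simp add: \<X>_def)
  then have fin': "finite (W \<times> \<X> \<times> \<X>)" using assms(1) by simp
  have sub: "\<Y> \<subseteq> W \<times> \<X> \<times> \<X>" by (auto simp: \<Y>_def)
  then have finY: "finite \<Y>" using fin' by (rule finite_subset)
  then have finT: "finite \<T>" by (simp add: \<T>_def)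
  have \<X>: "real (card \<X>) \<le> (exp 1 * B / real D) ^ D"
    unfolding \<X>_def using assms by (intro card_small_subsets) auto
  have T: "X \<subseteq> W \<and> card X \<le> D \<and> card M = D \<and> (\<forall>e\<in>M. e \<subseteq> W - X \<and> card e = 2)"
    if XM: "(X, M) \<in> \<T>" for X M
  proof -
    obtain u L where "(u, X, L) \<in> \<Y>" and M: "M = (\<lambda>v. {u, v}) ` L" using XM by (auto simp: \<T>_def)
    then have *: "u \<in> W" "X \<subseteq> W - {u}" "card X \<le> D" "L \<subseteq> W - X - {u}" "card L = D"
      by (auto simp: \<Y>_def \<X>_def)
    then have "card M = D" unfolding M by (subst card_star_pairs) auto
    moreover have "e \<subseteq> W - X \<and> card e = 2" if e: "e \<in> M" for e
    proof -
      obtain v where v: "v \<in> L" "e = {u, v}" using e M by auto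
      then have "v \<noteq> u" "v \<in> W" "v \<notin> X" using *(4) by auto
      moreover have "u \<notin> X" using *(2) by auto
      ultimately show ?thesis using v *(1) by (simp add: card_insert_if)
    qed
    ultimately show ?thesis using *(2,3) by auto
  qed
  obtain \<S> where S: "\<S> \<subseteq> Pow W" "finite \<S>" "real (card \<S>) \<le> 8 * real D * ln (real (card \<T>)) + 1"
    "\<And>X M. (X, M) \<in> \<T> \<Longrightarrow> \<exists>S\<in>\<S>. S \<inter> X = {} \<and> (\<exists>e\<in>M. e \<subseteq> S)"
    using hitting_family[OF assms(1,2) finT T] by metis
  have "star_separating W D \<S>"
    unfolding star_separating_def
  proof (intro allI impI)
    fix u X L assume "u \<in> W" "X \<subseteq> W - {u}" "card X \<le> D" "L \<subseteq> W - X - {u}" "card L = D"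
    then have "(u, X, L) \<in> \<Y>" by (auto simp: \<Y>_def \<X>_def)
    then have "(X, (\<lambda>v. {u, v}) ` L) \<in> \<T>"
      unfolding \<T>_def by (rule rev_image_eqI) simp
    from S(4)[OF this] obtain S v where "S \<in> \<S>" "S \<inter> X = {}" "v \<in> L" "{u, v} \<subseteq> S" by auto
    then show "\<exists>S\<in>\<S>. u \<in> S \<and> S \<inter> X = {} \<and> S \<inter> L \<noteq> {}" by (intro bexI[of _ S]) auto
  qed
  moreover have "ln (real (card \<T>)) \<le> 3 * real D * (1 + ln (B / real D))"
  proof (cases "\<T> = {}")
    case True
    then show ?thesis using assms(4) D by simp
  next
    case False
    define y where "y = B / real D"
    have y: "1 \<le> y" "B = y * real D" using assms(4) D by (auto simp: y_def field_simps)
    have "real (card \<T>) \<le> real (card (W \<times> \<X> \<times> \<X>))"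
      using card_mono[OF fin' sub] card_image_le[OF finY] unfolding \<T>_def by (meson of_nat_le_iff order_trans)
    also have "\<dots> \<le> B * ((exp 1 * y) ^ D * (exp 1 * y) ^ D)"
      unfolding card_cartesian_product of_nat_mult using \<X> assms(3) by (intro mult_mono) (auto simp: y_def)
    finally have "ln (real (card \<T>)) \<le> ln (B * ((exp 1 * y) ^ D * (exp 1 * y) ^ D))"
      using False finT by (intro ln_mono) (auto simp: card_gt_0_iff)
    also have "\<dots> = ln y + ln (real D) + 2 * (real D * (1 + ln y))"
      using y D by (simp add: ln_mult ln_realpow)
    also have "\<dots> \<le> real D * ln y + real D + 2 * (real D * (1 + ln y))"
    proof -
      have "1 * ln y \<le> real D * ln y" using y D by (intro mult_right_mono) auto
      moreover have "ln (real D) \<le> real D" using ln_le_minus_one[of "real D"] D by simp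
      ultimately show ?thesis by simp
    qed
    finally show ?thesis by (simp add: y_def algebra_simps)
  qed
  then have "8 * real D * ln (real (card \<T>)) \<le> 8 * real D * (3 * real D * (1 + ln (B / real D)))"
    using D by (intro mult_left_mono) auto
  moreover have "1 * 1 \<le> (real D)\<^sup>2 * (1 + ln (B / real D))"
    using assms(4) D by (intro mult_mono one_le_power) auto
  ultimately have "real (card \<S>) \<le> 25 * (real D)\<^sup>2 * (1 + ln (B / real D))"
    using S(3) by (simp add: power2_eq_square)
  with \<open>star_separating W D \<S>\<close> S(1,2) show ?thesis by blast
qed

section \<open>Balanced bags of tree decompositions\<close>

text \<open>A shortest walk from \<open>i\<close> to \<open>j\<close> avoiding the edge
  \<open>{i, j}\<close> is a path, and the edge closes it to a cycle.\<close>

lemma closed_walk_contains_cycle: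
  assumes "{i, j} \<in> F" "i \<noteq> j" and no_loops: "\<And>e. e \<in> F \<Longrightarrow> card e = 2"
    and "(i, j) \<in> (adj (F - {{i, j}}) S)\<^sup>*"
  shows "\<exists>xs. is_cycle F xs"
proof -
  let ?R = "adj (F - {{i, j}}) S"
  have "\<exists>n. (i, j) \<in> ?R ^^ n" using assms(4) by (simp add: rtrancl_power)
  then obtain n where n: "(i, j) \<in> ?R ^^ n" and least: "\<And>m. (i, j) \<in> ?R ^^ m \<Longrightarrow> n \<le> m"
    using exists_least_iff[of "\<lambda>n. (i, j) \<in> ?R ^^ n"] by (meson not_le)
  obtain f where f: "f 0 = i" "f n = j" "\<And>k. k < n \<Longrightarrow> (f k, f (Suc k)) \<in> ?R"
    using n unfolding relpow_fun_conv by auto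
  have walk: "(f a, f b) \<in> ?R ^^ (b - a)" if "a \<le> b" "b \<le> n" for a b
    unfolding relpow_fun_conv using that f(3)
    by (intro exI[of _ "\<lambda>k. f (a + k)"]) auto
  \<comment> \<open>A shortest walk has no repetitions.\<close>
  have "f a \<noteq> f b" if "a < b" "b \<le> n" for a b
  proof
    assume eq: "f a = f b"
    have "(f 0, f a) \<in> ?R ^^ a" "(f a, f n) \<in> ?R ^^ (n - b)"
      using walk[of 0 a] walk[of b n] that by (simp_all add: eq)
    then have "(i, j) \<in> ?R ^^ (a + (n - b))"
      unfolding relpow_add using f(1,2) by auto
    from least[OF this] that show False by simp
  qed
  then have inj: "inj_on f {..n}" by (intro linorder_inj_onI') auto
  \<comment> \<open>Length 0 would mean \<open>i = j\<close>, and length 1 would use the deleted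
    edge; so the cycle has at least three vertices.\<close>
  have "n \<noteq> 0" using f(1,2) assms(2) by (cases n) auto
  moreover have "n \<noteq> 1" using f by auto
  ultimately have n2: "2 \<le> n" by simp
  define xs where "xs = map f [0..<Suc n]"
  have len: "length xs = Suc n" by (simp add: xs_def)
  have nth: "xs ! k = f k" if "k \<le> n" for k
    using that unfolding xs_def by (subst nth_map) (auto simp del: upt_Suc)
  have "{xs ! k, xs ! (Suc k mod length xs)} \<in> F" if "k < length xs" for k
  proof (cases "k = n")
    case True
    then show ?thesis using assms(1) f(1,2) nth by (simp add: len insert_commute)
  next
    case False
    then have "k < n" using that len by simp
    then show ?thesis using f(3)[of k] nth by (simp add: len)
  qed
  moreover have "distinct xs"
    using inj by (simp add: xs_def distinct_map atLeast0LessThan lessThan_Suc_atMost del: upt_Suc)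
  ultimately have "is_cycle F xs" using n2 by (simp add: is_cycle_def len)
  then show ?thesis by blast
qed

lemma tree_edge_is_bridge:
  assumes "is_tree I F" "{i, j} \<in> F" "i \<noteq> j"
  shows "(i, j) \<notin> connected_rel (F - {{i, j}}) I"
  using closed_walk_contains_cycle[of i j F I] assms
  by (auto simp: is_tree_def simple_graph_def conn_iff)

text \<open>Cut the walk after its last visit to \<open>i\<close>.\<close>

lemma conn_first_step:
  assumes "(i, l) \<in> connected_rel F I" "l \<noteq> i"
  shows "\<exists>j\<in>I - {i}. {i, j} \<in> F \<and> (j, l) \<in> connected_rel F (I - {i})"
proof -
  have "l \<noteq> i \<longrightarrow> (\<exists>j\<in>I - {i}. {i, j} \<in> F \<and> (j, l) \<in> connected_rel F (I - {i}))"
    using assms(1)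
  proof (induction rule: conn_induct)
    case base
    then show ?case by simp
  next
    case (step x y)
    show ?case
    proof
      assume y: "y \<noteq> i"
      show "\<exists>j\<in>I - {i}. {i, j} \<in> F \<and> (j, y) \<in> connected_rel F (I - {i})"
      proof (cases "x = i")
        case True
        then show ?thesis using step.hyps y by (intro bexI[of _ y]) (auto intro: conn_refl)
      next
        case False
        then obtain j where j: "j \<in> I - {i}" "{i, j} \<in> F" "(j, x) \<in> connected_rel F (I - {i})"
          using step.IH by blast
        moreover have "(x, y) \<in> connected_rel F (I - {i})"
          using step.hyps y False by (intro conn_edge) auto
        ultimately show ?thesis using conn_trans[OF j(3)] by blast
      qed
    qed
  qed
  then show ?thesis using assms(2) by simp
qed

text \<open>Suppose every bag leaves a component with more than half of \<open>W\<close>. The bags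
  meeting that component lie in one branch of the tree at \<open>i\<close>, so \<open>i\<close>
  points to a neighbour. Two adjacent nodes cannot point at each other, because their heavy
  components share a vertex.\<close>

lemma balanced_bag:
  assumes td: "tree_decomposition V E I F B" and "finite V" "W \<subseteq> V"
  shows "\<exists>i\<in>I. \<forall>x\<in>V - B i. 2 * card {w \<in> W. (x, w) \<in> connected_rel E (V - B i)} \<le> card W"
proof (rule ccontr)
  assume "\<not> ?thesis"
  then have "\<forall>i\<in>I. \<exists>x. x \<in> V - B i \<and> card W < 2 * card {w \<in> W. (x, w) \<in> connected_rel E (V - B i)}"
    by (auto simp: not_le)
  from bchoice[OF this] obtain x where x: "\<And>i. i \<in> I \<Longrightarrow> x i \<in> V - B i"
    "\<And>i. i \<in> I \<Longrightarrow> card W < 2 * card {w \<in> W. (x i, w) \<in> connected_rel E (V - B i)}"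
    by blast
  define K where "K i = {w \<in> W. (x i, w) \<in> connected_rel E (V - B i)}" for i
  have tree: "is_tree I F" and cover: "\<And>v. v \<in> V \<Longrightarrow> \<exists>i\<in>I. v \<in> B i"
    and edge_cover: "\<And>e. e \<in> E \<Longrightarrow> \<exists>i\<in>I. e \<subseteq> B i"
    and subtree: "\<And>v. v \<in> V \<Longrightarrow> connected_on F {i \<in> I. v \<in> B i}"
    using td by (auto simp: tree_decomposition_def)
  have I: "finite I" "I \<noteq> {}" "connected_on F I"
    using tree by (auto simp: is_tree_def simple_graph_def)
  have "\<forall>i\<in>I. \<exists>l. l \<in> I \<and> x i \<in> B l" using cover x(1) by blast
  from bchoice[OF this] obtain l0 where l0: "\<And>i. i \<in> I \<Longrightarrow> l0 i \<in> I" "\<And>i. i \<in> I \<Longrightarrow> x i \<in> B (l0 i)"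
    by blast
  have same_bag: "(l, l') \<in> connected_rel F (I - {i})"
    if "v \<in> V" "v \<notin> B i" "l \<in> I" "v \<in> B l" "l' \<in> I" "v \<in> B l'" for v i l l'
  proof -
    have "(l, l') \<in> connected_rel F {i \<in> I. v \<in> B i}"
      using subtree[OF that(1)] that by (auto simp: connected_on_def)
    then show ?thesis by (rule conn_mono) (use that in auto)
  qed
  \<comment> \<open>Induction along a walk in the heavy component: consecutive vertices share a bag,
    and the bags of each vertex on it are connected in the tree without \<open>i\<close>, as the
    vertex is not in \<open>B i\<close>.\<close>
  have comp: "\<forall>l\<in>I. v \<in> B l \<longrightarrow> (l0 i, l) \<in> connected_rel F (I - {i})"
    if "i \<in> I" "(x i, v) \<in> connected_rel E (V - B i)" for i v
    using that(2)
  proof (induction rule: conn_induct)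
    case base
    then show ?case using same_bag[of "x i" i "l0 i"] x(1) l0 that(1) by auto
  next
    case (step y z)
    obtain l where l: "l \<in> I" "{y, z} \<subseteq> B l" using edge_cover step.hyps(4) by blast
    then have yl: "(l0 i, l) \<in> connected_rel F (I - {i})" using step.IH by auto
    show ?case
    proof (intro ballI impI)
      fix l' assume "l' \<in> I" "z \<in> B l'"
      then have "(l, l') \<in> connected_rel F (I - {i})"
        using l step.hyps by (intro same_bag[of z]) auto
      with yl show "(l0 i, l') \<in> connected_rel F (I - {i})" by (rule conn_trans)
    qed
  qed
  have "\<forall>i\<in>I. \<exists>j. j \<in> I - {i} \<and> {i, j} \<in> F \<and> (j, l0 i) \<in> connected_rel F (I - {i})"
  proof
    fix i assume i: "i \<in> I"
    have "l0 i \<noteq> i" using x(1)[OF i] l0(2)[OF i] by auto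
    moreover have "(i, l0 i) \<in> connected_rel F I" using I(3) i l0(1) by (auto simp: connected_on_def)
    ultimately show "\<exists>j. j \<in> I - {i} \<and> {i, j} \<in> F \<and> (j, l0 i) \<in> connected_rel F (I - {i})"
      using conn_first_step[of i "l0 i" F I] by blast
  qed
  from bchoice[OF this] obtain nx where nx: "\<And>i. i \<in> I \<Longrightarrow> nx i \<in> I - {i}"
    "\<And>i. i \<in> I \<Longrightarrow> {i, nx i} \<in> F" "\<And>i. i \<in> I \<Longrightarrow> (nx i, l0 i) \<in> connected_rel F (I - {i})"
    by blast
  \<comment> \<open>Orient every node towards its heavy component and follow the orientation: the part of the
    tree ahead shrinks strictly until two adjacent nodes point at each other.\<close>
  define A where "A i = {l \<in> I. (nx i, l) \<in> connected_rel F (I - {i})}" for i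
  obtain i where i: "i \<in> I" and min: "\<And>j. j \<in> I \<Longrightarrow> card (A i) \<le> card (A j)"
    using ex_has_least_nat[of "\<lambda>i. i \<in> I" _ "\<lambda>i. card (A i)"] I(2) by blast
  define j where "j = nx i"
  have j: "j \<in> I" "j \<noteq> i" "{i, j} \<in> F" using nx i by (auto simp: j_def)
  have bridge: "(i, j) \<notin> connected_rel (F - {{i, j}}) I"
    using tree_edge_is_bridge[OF tree j(3)] j(2) by blast
  have avoid: "(a, b) \<in> connected_rel (F - {{i, j}}) I"
    if "(a, b) \<in> connected_rel F (I - {k})" "k = i \<or> k = j" for a b k
    using that(1) by (rule conn_mono) (use that(2) in \<open>auto simp: doubleton_eq_iff\<close>)
  show False
  proof (cases "nx j = i")
    case True
    have "finite W" using assms finite_subset by blast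
    then have "card (K i \<union> K j) \<le> card W" by (intro card_mono) (auto simp: K_def)
    moreover have "card (K i \<union> K j) + card (K i \<inter> K j) = card (K i) + card (K j)"
      using \<open>finite W\<close> by (intro card_Un_Int[symmetric]) (auto simp: K_def)
    moreover have "card W < 2 * card (K i)" "card W < 2 * card (K j)"
      using x(2) i j(1) by (auto simp: K_def)
    ultimately have "card (K i \<inter> K j) \<noteq> 0" by linarith
    then have "K i \<inter> K j \<noteq> {}" by auto
    then obtain v where v: "v \<in> W" "(x i, v) \<in> connected_rel E (V - B i)"
      "(x j, v) \<in> connected_rel E (V - B j)"
      by (auto simp: K_def)
    then obtain l where l: "l \<in> I" "v \<in> B l" using cover assms(3) by blast
    \<comment> \<open>A bag of the common vertex \<open>v\<close> lies beyond \<open>j\<close> as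
      seen from \<open>i\<close> and beyond \<open>i\<close> as seen from \<open>j\<close>, so
      \<open>i\<close> and \<open>j\<close> are connected without their edge.\<close>
    have "(j, l) \<in> connected_rel F (I - {i})"
      using conn_trans[OF nx(3)[OF i]] comp[OF i v(2)] l by (auto simp: j_def)
    moreover have "(i, l) \<in> connected_rel F (I - {j})"
      using conn_trans[OF nx(3)[OF j(1)]] comp[OF j(1) v(3)] l True by auto
    ultimately have "(i, j) \<in> connected_rel (F - {{i, j}}) I"
      using avoid conn_sym conn_trans by metis
    then show False using bridge by contradiction
  next
    case False
    define k where "k = nx j"
    have k: "k \<in> I" "k \<noteq> j" "{j, k} \<in> F" "k \<noteq> i" using nx j(1) False by (auto simp: k_def)
    have kj: "(k, j) \<in> connected_rel F (I - {i})"
      using k j by (intro conn_edge) (auto simp: insert_commute)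
    \<comment> \<open>Otherwise \<open>i\<close> and \<open>j\<close> would be joined via
      \<open>k\<close> without the edge between them; so the branch ahead of \<open>j\<close> stays
      clear of \<open>i\<close>.\<close>
    have ki: "(k, i) \<notin> connected_rel F (I - {j})"
      using avoid[of k i j] avoid[OF kj] bridge conn_sym conn_trans by metis
    have "A j \<subseteq> A i"
    proof
      fix l assume "l \<in> A j"
      then have l: "l \<in> I" "(k, l) \<in> connected_rel F (I - {j})" by (auto simp: A_def k_def)
      have "(k, l) \<in> connected_rel F (I - {j} - {i})" using conn_avoid[OF l(2) ki] by simp
      then have "(k, l) \<in> connected_rel F (I - {i})" by (rule conn_mono) auto
      then show "l \<in> A i" using l(1) conn_trans[OF conn_sym[OF kj]] by (simp add: A_def j_def)
    qed
    moreover have "j \<in> A i" using j by (auto simp: A_def j_def intro: conn_refl)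
    moreover have "j \<notin> A j" using conn_in by (fastforce simp: A_def)
    ultimately have "A j \<subset> A i" by blast
    then have "card (A j) < card (A i)" using I(1) by (intro psubset_card_mono) (simp add: A_def)
    then show False using min[OF j(1)] by simp
  qed
qed

section \<open>Treewidth\<close>

text \<open>The one-node decomposition shows that the \<open>LEAST\<close> defining
  \<open>treewidth\<close> is taken over a non-empty set.\<close>

lemma tree_decomposition_exists:
  assumes "simple_graph V E"
  shows "tree_decomposition V E {0} {} (\<lambda>_. V)"
proof -
  have "\<not> is_cycle {} xs" for xs :: "nat list"
    unfolding is_cycle_def by (cases xs) auto
  then have "is_tree {0 :: nat} {}"
    by (auto simp: is_tree_def simple_graph_def connected_on_def conn_refl)
  then show ?thesis
    using simple_graphD(3)[OF assms]
    by (auto simp: tree_decomposition_def connected_on_def conn_refl)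
qed

lemma treewidth_decomposition:
  assumes "simple_graph V E"
  obtains I F B where "tree_decomposition V E I F B"
    "\<And>i. i \<in> I \<Longrightarrow> card (B i) \<le> treewidth V E + 1"
proof -
  have "\<exists>I F B. tree_decomposition V E I F B \<and> treewidth V E = width I B"
    unfolding treewidth_def
    by (rule LeastI_ex) (use tree_decomposition_exists[OF assms] in blast)
  then obtain I F B where *: "tree_decomposition V E I F B" "treewidth V E = width I B" by blast
  have "finite I" using *(1) by (auto simp: tree_decomposition_def is_tree_def simple_graph_def)
  then have "card (B i) \<le> Max ((\<lambda>i. card (B i)) ` I)" if "i \<in> I" for i
    using that by (intro Max_ge) auto
  then have "card (B i) \<le> treewidth V E + 1" if "i \<in> I" for i
    using *(2) that unfolding width_def by fastforce
  then show ?thesis using that *(1) by blast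
qed

lemma treewidth_pos:
  assumes "simple_graph V E" "E \<noteq> {}"
  shows "1 \<le> treewidth V E"
proof -
  obtain I F B where td: "tree_decomposition V E I F B"
    "\<And>i. i \<in> I \<Longrightarrow> card (B i) \<le> treewidth V E + 1"
    using treewidth_decomposition[OF assms(1)] by blast
  obtain e where e: "e \<in> E" using assms(2) by blast
  then obtain i where i: "i \<in> I" "e \<subseteq> B i" using td(1) by (auto simp: tree_decomposition_def)
  have "finite (B i)"
    using td(1) i(1) simple_graphD(1)[OF assms(1)] finite_subset by (auto simp: tree_decomposition_def)
  then have "card e \<le> card (B i)" using i(2) by (rule card_mono)
  then show ?thesis using td(2)[OF i(1)] simple_graphD(4)[OF assms(1) e] by simp
qed

section \<open>Partial k-trees\<close>

definition clique_edges :: "'a set \<Rightarrow> 'a set set" where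
  "clique_edges W = {{x, y} | x y. x \<in> W \<and> y \<in> W \<and> x \<noteq> y}"

lemma clique_edges_empty [simp]: "clique_edges {} = {}"
  by (simp add: clique_edges_def)

lemma clique_edgesI: "x \<in> W \<Longrightarrow> y \<in> W \<Longrightarrow> x \<noteq> y \<Longrightarrow> {x, y} \<in> clique_edges W"
  by (auto simp: clique_edges_def)

lemma clique_edges_mono: "W \<subseteq> W' \<Longrightarrow> clique_edges W \<subseteq> clique_edges W'"
  unfolding clique_edges_def by fast

lemma clique_edges_insert:
  assumes "v \<notin> W"
  shows "clique_edges (insert v W) = clique_edges W \<union> (\<lambda>x. {v, x}) ` W"
proof (intro equalityI subsetI)
  fix e assume "e \<in> clique_edges (insert v W)"
  then obtain x y where "e = {x, y}" "x \<in> insert v W" "y \<in> insert v W" "x \<noteq> y"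
    by (auto simp: clique_edges_def)
  then show "e \<in> clique_edges W \<union> (\<lambda>x. {v, x}) ` W"
    by (auto simp: insert_commute intro: clique_edgesI)
next
  fix e assume "e \<in> clique_edges W \<union> (\<lambda>x. {v, x}) ` W"
  then show "e \<in> clique_edges (insert v W)"
  proof
    assume "e \<in> clique_edges W"
    then show ?thesis using clique_edges_mono[of W "insert v W"] by auto
  next
    assume "e \<in> (\<lambda>x. {v, x}) ` W"
    then show ?thesis using assms by (auto intro!: clique_edgesI)
  qed
qed

text \<open>The insertion order, reversed, is a perfect elimination ordering relative to
  \<open>U0\<close>. The start is an arbitrary graph, not a fixed clique, so that pieces built
  separately can be glued.\<close>

inductive ktree_ext :: "nat \<Rightarrow> 'a set \<Rightarrow> 'a set set \<Rightarrow> 'a set \<Rightarrow> 'a set set \<Rightarrow> bool"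
  for K U0 F0 where
  base: "ktree_ext K U0 F0 U0 F0"
| add: "ktree_ext K U0 F0 U F \<Longrightarrow> v \<notin> U \<Longrightarrow> N \<subseteq> U \<Longrightarrow> finite N \<Longrightarrow> card N < K \<Longrightarrow>
    (\<And>x y. x \<in> N \<Longrightarrow> y \<in> N \<Longrightarrow> x \<noteq> y \<Longrightarrow> {x, y} \<in> F) \<Longrightarrow>
    ktree_ext K U0 F0 (insert v U) (F \<union> (\<lambda>x. {v, x}) ` N)"

lemma ktree_ext_trans:
  assumes "ktree_ext K U1 F1 U2 F2" "ktree_ext K U0 F0 U1 F1"
  shows "ktree_ext K U0 F0 U2 F2"
  using assms by (induction rule: ktree_ext.induct) (auto intro: ktree_ext.add)

lemma ktree_ext_subset: "ktree_ext K U0 F0 U F \<Longrightarrow> U0 \<subseteq> U"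
  by (induction rule: ktree_ext.induct) auto

text \<open>The insertions that build the piece on \<open>U0\<close> can be repeated on top of a
  larger graph, as none of the inserted vertices occurs there yet.\<close>

lemma ktree_ext_glue:
  assumes "ktree_ext K U0 F0 U F" "U0 \<subseteq> U'" "F0 \<subseteq> F'" "U' \<inter> U = U0"
  shows "ktree_ext K U' F' (U' \<union> U) (F' \<union> F)"
  using assms
proof (induction rule: ktree_ext.induct)
  case base
  then have "U' \<union> U0 = U'" "F' \<union> F0 = F'" by auto
  then show ?case by (simp add: ktree_ext.base)
next
  case (add U F v N)
  have sub: "U0 \<subseteq> U" using add.hyps(1) by (rule ktree_ext_subset)
  then have v: "v \<notin> U'" using add by auto
  then have "U' \<inter> U = U0" using add.prems by auto
  then have "ktree_ext K U' F' (U' \<union> U) (F' \<union> F)" using add by simp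
  then have "ktree_ext K U' F' (insert v (U' \<union> U)) ((F' \<union> F) \<union> (\<lambda>x. {v, x}) ` N)"
    by (rule ktree_ext.add) (use v add.hyps in auto)
  then show ?case by (simp add: Un_assoc)
qed

lemma ktree_ext_clique:
  assumes "finite W" "W0 \<subseteq> W" "card W \<le> K"
  shows "ktree_ext K W0 (clique_edges W0) W (clique_edges W)"
proof -
  have "finite D \<Longrightarrow> W0 \<inter> D = {} \<Longrightarrow> card (W0 \<union> D) \<le> K \<Longrightarrow>
      ktree_ext K W0 (clique_edges W0) (W0 \<union> D) (clique_edges (W0 \<union> D))" for D
  proof (induction D rule: finite_induct)
    case empty
    then show ?case by (simp add: ktree_ext.base)
  next
    case (insert v D)
    have fin: "finite (W0 \<union> D)" using insert.hyps assms finite_subset by auto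
    have v: "v \<notin> W0 \<union> D" using insert by auto
    then have c: "card (W0 \<union> D) < K" using insert.prems fin by simp
    then have "ktree_ext K W0 (clique_edges W0) (W0 \<union> D) (clique_edges (W0 \<union> D))"
      using insert by simp
    then have "ktree_ext K W0 (clique_edges W0) (insert v (W0 \<union> D))
        (clique_edges (W0 \<union> D) \<union> (\<lambda>x. {v, x}) ` (W0 \<union> D))"
      by (rule ktree_ext.add) (use v c fin in \<open>auto intro: clique_edgesI\<close>)
    then show ?case using v by (simp add: clique_edges_insert)
  qed
  from this[of "W - W0"] show ?thesis
    using assms by (simp add: Un_absorb1)
qed

section \<open>Completion of graphs with balanced separators\<close>

definition has_separators :: "'a set \<Rightarrow> 'a set set \<Rightarrow> nat \<Rightarrow> bool" where
  "has_separators V H s \<longleftrightarrow> (\<forall>W\<subseteq>V. \<exists>Z\<subseteq>V. card Z \<le> s \<and>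
     (\<forall>x\<in>V - Z. 2 * card {w \<in> W. (x, w) \<in> connected_rel H (V - Z)} \<le> card W))"

text \<open>The classical recursion for treewidth. The boundary \<open>W\<close> of the current
  piece \<open>U\<close> is a clique of at most \<open>2 * s + 1\<close> vertices. When it is full,
  a separator \<open>Z\<close> halving it splits the rest into components \<open>C\<close>, each
  built on the boundary made of \<open>Z\<close> and \<open>W \<inter> C\<close>, of size at most
  \<open>2 * s\<close>. The pieces are glued to the root clique \<open>W \<union> Z\<close>.\<close>

lemma ktree_completion:
  assumes "finite V" "has_separators V H s"
    and H: "\<And>e. e \<in> H \<Longrightarrow> card e = 2"
    and "U \<subseteq> V" "W \<subseteq> U" "card W \<le> 2 * s + 1"
  shows "\<exists>F. ktree_ext (3 * s + 2) W (clique_edges W) U F \<and> {e \<in> H. e \<subseteq> U} \<subseteq> F"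
  using assms(4-6)
\<comment> \<open>Either \<open>U\<close> shrinks, or \<open>U\<close> stays and \<open>W\<close>
  grows; the factor \<open>2 * s + 2\<close> makes the first effect dominate whatever happens to
  \<open>W\<close>.\<close>
proof (induction "card U * (2 * s + 2) + (2 * s + 1 - card W)" arbitrary: U W rule: less_induct)
  case less
  let ?K = "3 * s + 2"
  have finU: "finite U" and finW: "finite W" using less.prems assms(1) finite_subset by metis+
  consider "W = U" | "W \<noteq> U" "card W \<le> 2 * s" | "card W = 2 * s + 1"
    using less.prems by linarith
  then show ?case
  proof cases
    case 1
    have "e \<in> clique_edges U" if "e \<in> H" "e \<subseteq> U" for e
      using H[OF that(1)] that(2) by (auto simp: card_2_iff intro!: clique_edgesI)
    then have "{e \<in> H. e \<subseteq> U} \<subseteq> clique_edges U" by auto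
    then show ?thesis using 1 ktree_ext.base by blast
  next
    case 2
    then obtain v where v: "v \<in> U" "v \<notin> W" using less.prems by blast
    have c: "card (insert v W) = Suc (card W)" using v finW by simp
    have "\<exists>F. ktree_ext ?K (insert v W) (clique_edges (insert v W)) U F \<and> {e \<in> H. e \<subseteq> U} \<subseteq> F"
      using 2 c v less.prems by (intro less.hyps) auto
    moreover have "ktree_ext ?K W (clique_edges W) (insert v W) (clique_edges (insert v W))"
      using 2 c finW by (intro ktree_ext_clique) auto
    ultimately show ?thesis using ktree_ext_trans by blast
  next
    case 3
    have "W \<subseteq> V" using order_trans[OF less.prems(2,1)] .
    with assms(2) have "\<exists>Z\<subseteq>V. card Z \<le> s \<and>
        (\<forall>x\<in>V - Z. 2 * card {w \<in> W. (x, w) \<in> connected_rel H (V - Z)} \<le> card W)"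
      by (simp add: has_separators_def)
    then obtain Z0 where Z0: "Z0 \<subseteq> V" "card Z0 \<le> s"
      "\<And>x. x \<in> V - Z0 \<Longrightarrow> 2 * card {w \<in> W. (x, w) \<in> connected_rel H (V - Z0)} \<le> card W"
      by auto
    define Z where "Z = Z0 \<inter> U"
    define \<C> where "\<C> = induced_components H (U - Z)"
    have finZ0: "finite Z0" using Z0(1) assms(1) finite_subset by blast
    then have "card Z \<le> card Z0" by (intro card_mono) (auto simp: Z_def)
    then have Z: "finite Z" "card Z \<le> s" "Z \<subseteq> U" using Z0(2) finZ0 by (auto simp: Z_def)
    have comp_sub: "C \<subseteq> U - Z" if "C \<in> \<C>" for C
      using that unfolding \<C>_def induced_components_def by (rule in_quotient_imp_subset[OF equiv_conn])
    have comp_conn: "(x, y) \<in> connected_rel H (U - Z)" if "C \<in> \<C>" "x \<in> C" "y \<in> C" for C x y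
      using that unfolding conn_iff_component \<C>_def by auto
    have comp_eq: "C = C'" if "C \<in> \<C>" "C' \<in> \<C>" "x \<in> C" "y \<in> C'" "(x, y) \<in> connected_rel H (U - Z)"
      for C C' x y
      using that quotient_eq_iff[OF equiv_conn] unfolding \<C>_def induced_components_def by metis
    have comp_ne: "C \<noteq> {}" if "C \<in> \<C>" for C
      using that unfolding \<C>_def induced_components_def by (rule in_quotient_imp_non_empty[OF equiv_conn])
    have union: "\<Union>\<C> = U - Z"
      unfolding \<C>_def induced_components_def by (rule Union_quotient[OF equiv_conn])
    have fin\<C>: "finite \<C>"
      using union finU by (metis finite_Diff finite_UnionD)
    \<comment> \<open>\<open>C\<close> lies in one component of \<open>V - Z0\<close>, which holds
      at most half of the \<open>2 * s + 1\<close> vertices of \<open>W\<close>.\<close>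
    have light: "card (W \<inter> C) \<le> s" if C: "C \<in> \<C>" for C
    proof -
      obtain x where x: "x \<in> C" using comp_ne[OF C] by blast
      have "W \<inter> C \<subseteq> {w \<in> W. (x, w) \<in> connected_rel H (V - Z0)}"
      proof
        fix w assume w: "w \<in> W \<inter> C"
        then have "(x, w) \<in> connected_rel H (U - Z)" using comp_conn C x by blast
        then have "(x, w) \<in> connected_rel H (V - Z0)"
          by (rule conn_mono) (use less.prems in \<open>auto simp: Z_def\<close>)
        then show "w \<in> {w \<in> W. (x, w) \<in> connected_rel H (V - Z0)}" using w by simp
      qed
      then have "card (W \<inter> C) \<le> card {w \<in> W. (x, w) \<in> connected_rel H (V - Z0)}"
        using finW by (intro card_mono) auto
      moreover have "x \<in> V - Z0" using x comp_sub[OF C] less.prems by (auto simp: Z_def)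
      ultimately show ?thesis using Z0(3)[of x] 3 by linarith
    qed
    have "\<exists>F. ktree_ext ?K ((W \<inter> C) \<union> Z) (clique_edges ((W \<inter> C) \<union> Z)) (C \<union> Z) F \<and>
        {e \<in> H. e \<subseteq> C \<union> Z} \<subseteq> F" if C: "C \<in> \<C>" for C
    proof (rule less.hyps)
      show sub: "C \<union> Z \<subseteq> V" "(W \<inter> C) \<union> Z \<subseteq> C \<union> Z"
        using comp_sub[OF C] Z(3) less.prems by auto
      have c: "card ((W \<inter> C) \<union> Z) \<le> 2 * s"
        using light[OF C] Z(2) card_Un_le[of "W \<inter> C" Z] by linarith
      then show "card ((W \<inter> C) \<union> Z) \<le> 2 * s + 1" by simp
      \<comment> \<open>The full boundary is larger than \<open>(W \<inter> C) \<union> Z\<close>,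
        so it has a vertex outside the piece, which is therefore a proper subset of
        \<open>U\<close>.\<close>
      have "\<not> W \<subseteq> C \<union> Z"
      proof
        assume "W \<subseteq> C \<union> Z"
        then have "W \<subseteq> (W \<inter> C) \<union> Z" by blast
        then have "card W \<le> card ((W \<inter> C) \<union> Z)" using finW Z(1) by (intro card_mono) auto
        then show False using c 3 by simp
      qed
      then have "C \<union> Z \<subset> U" using comp_sub[OF C] Z(3) less.prems by blast
      then have "Suc (card (C \<union> Z)) \<le> card U" using finU by (simp add: Suc_le_eq psubset_card_mono)
      then have "Suc (card (C \<union> Z)) * (2 * s + 2) \<le> card U * (2 * s + 2)" by (rule mult_le_mono1)
      then show "card (C \<union> Z) * (2 * s + 2) + (2 * s + 1 - card ((W \<inter> C) \<union> Z))
          < card U * (2 * s + 2) + (2 * s + 1 - card W)"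
        by simp
    qed
    then have "\<forall>C\<in>\<C>. \<exists>F. ktree_ext ?K ((W \<inter> C) \<union> Z) (clique_edges ((W \<inter> C) \<union> Z)) (C \<union> Z) F \<and>
        {e \<in> H. e \<subseteq> C \<union> Z} \<subseteq> F" by blast
    from bchoice[OF this] obtain F where
      F: "\<And>C. C \<in> \<C> \<Longrightarrow> ktree_ext ?K ((W \<inter> C) \<union> Z) (clique_edges ((W \<inter> C) \<union> Z)) (C \<union> Z) (F C)"
        "\<And>C. C \<in> \<C> \<Longrightarrow> {e \<in> H. e \<subseteq> C \<union> Z} \<subseteq> F C"
      by blast
    define R where "R = W \<union> Z"
    have "card R \<le> ?K" using card_Un_le[of W Z] Z(2) 3 by (simp add: R_def)
    then have start: "ktree_ext ?K W (clique_edges W) R (clique_edges R)"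
      using finW Z(1) by (intro ktree_ext_clique) (auto simp: R_def)
    have "ktree_ext ?K W (clique_edges W) (R \<union> \<Union>\<D>) (clique_edges R \<union> \<Union>(F ` \<D>))"
      if "finite \<D>" "\<D> \<subseteq> \<C>" for \<D>
      using that
    proof (induction \<D> rule: finite_induct)
      case empty
      then show ?case using start by simp
    next
      case (insert C \<D>)
      have C: "C \<in> \<C>" and IH: "ktree_ext ?K W (clique_edges W) (R \<union> \<Union>\<D>) (clique_edges R \<union> \<Union>(F ` \<D>))"
        using insert by auto
      have disj: "C \<inter> \<Union>\<D> = {}"
      proof (rule ccontr)
        assume "C \<inter> \<Union>\<D> \<noteq> {}"
        then obtain x C' where "x \<in> C" "x \<in> C'" "C' \<in> \<D>" by blast
        then have "C = C'"
          using insert.prems comp_conn[OF C] by (intro comp_eq[of C C' x x]) auto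
        then show False using \<open>C' \<in> \<D>\<close> insert.hyps by simp
      qed
      have Z_disj: "Z \<inter> \<Union>\<D> = {}" using insert.prems comp_sub by blast
      \<comment> \<open>What has been built so far meets the new piece exactly in its boundary,
        which is part of the clique on \<open>R\<close>: the requirement for gluing.\<close>
      have "(R \<union> \<Union>\<D>) \<inter> (C \<union> Z) = (W \<inter> C) \<union> Z"
        using disj Z_disj comp_sub[OF C] by (auto simp: R_def)
      then have "ktree_ext ?K (R \<union> \<Union>\<D>) (clique_edges R \<union> \<Union>(F ` \<D>)) ((R \<union> \<Union>\<D>) \<union> (C \<union> Z))
          ((clique_edges R \<union> \<Union>(F ` \<D>)) \<union> F C)"
        using F(1)[OF C] clique_edges_mono[of "(W \<inter> C) \<union> Z" R]
        by (intro ktree_ext_glue) (auto simp: R_def)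
      from ktree_ext_trans[OF this IH]
      have "ktree_ext ?K W (clique_edges W) ((R \<union> \<Union>\<D>) \<union> (C \<union> Z)) ((clique_edges R \<union> \<Union>(F ` \<D>)) \<union> F C)" .
      moreover have "(R \<union> \<Union>\<D>) \<union> (C \<union> Z) = R \<union> \<Union>(insert C \<D>)" by (auto simp: R_def)
      moreover have "(clique_edges R \<union> \<Union>(F ` \<D>)) \<union> F C = clique_edges R \<union> \<Union>(F ` insert C \<D>)" by auto
      ultimately show ?case by simp
    qed
    from this[OF fin\<C> order_refl]
    have "ktree_ext ?K W (clique_edges W) U (clique_edges R \<union> \<Union>(F ` \<C>))"
      using union Z(3) less.prems(2) by (simp add: R_def Un_assoc) (metis Un_Diff_cancel Un_absorb1 Un_absorb2)
    moreover have "{e \<in> H. e \<subseteq> U} \<subseteq> clique_edges R \<union> \<Union>(F ` \<C>)"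
    proof
      fix e assume "e \<in> {e \<in> H. e \<subseteq> U}"
      then have e: "e \<in> H" "e \<subseteq> U" by auto
      show "e \<in> clique_edges R \<union> \<Union>(F ` \<C>)"
      proof (cases "e \<subseteq> Z")
        case True
        then have "e \<in> clique_edges R"
          using H[OF e(1)] by (auto simp: card_2_iff R_def intro!: clique_edgesI)
        then show ?thesis by simp
      next
        case False
        then obtain x where x: "x \<in> e" "x \<notin> Z" by blast
        obtain y where y: "e = {x, y}" using H[OF e(1)] x(1) by (auto simp: card_2_iff)
        obtain C where C: "C \<in> \<C>" "x \<in> C" using union x e(2) by blast
        have "y \<in> C \<union> Z"
        proof (rule ccontr)
          assume nin: "y \<notin> C \<union> Z"
          then have "y \<in> U - Z" using e(2) y by auto
          then obtain C' where C': "C' \<in> \<C>" "y \<in> C'" using union by blast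
          have "(x, y) \<in> connected_rel H (U - Z)"
            using x e y nin by (intro conn_edge) auto
          then have "C = C'" using comp_eq[OF C(1) C'(1) C(2) C'(2)] by simp
          then show False using nin C' by simp
        qed
        then have "e \<in> F C" using F(2)[OF C(1)] C(2) e(1) y by auto
        then show ?thesis using C(1) by blast
      qed
    qed
    ultimately show ?thesis by blast
  qed
qed

section \<open>Colourings that determine subgraphs\<close>

text \<open>The last clause stands in for the statement that two colour classes induce a forest in
  \<open>F\<close>: a subgraph of a forest is determined by its connected pairs.\<close>

definition determining_colouring :: "nat \<Rightarrow> 'a set \<Rightarrow> 'a set set \<Rightarrow> ('a \<Rightarrow> nat) \<Rightarrow> bool" where
  "determining_colouring K U F f \<longleftrightarrow>
    (\<forall>x\<in>U. f x < K) \<and> F \<subseteq> Pow U \<and> (\<forall>x y. x \<noteq> y \<longrightarrow> {x, y} \<in> F \<longrightarrow> f x \<noteq> f y) \<and>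
    (\<forall>E E'. E \<subseteq> F \<longrightarrow> E' \<subseteq> F \<longrightarrow>
      (\<forall>i<K. \<forall>j<K. connected_rel E {x \<in> U. f x = i \<or> f x = j} = connected_rel E' {x \<in> U. f x = i \<or> f x = j})
      \<longrightarrow> E = E')"

lemma determining_colouringD:
  assumes "determining_colouring K U F f"
  shows "x \<in> U \<Longrightarrow> f x < K" "F \<subseteq> Pow U" "x \<noteq> y \<Longrightarrow> {x, y} \<in> F \<Longrightarrow> f x \<noteq> f y"
    "E \<subseteq> F \<Longrightarrow> E' \<subseteq> F \<Longrightarrow>
      (\<And>i j. i < K \<Longrightarrow> j < K \<Longrightarrow>
        connected_rel E {x \<in> U. f x = i \<or> f x = j} = connected_rel E' {x \<in> U. f x = i \<or> f x = j}) \<Longrightarrow>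
      E = E'"
  using assms unfolding determining_colouring_def by simp_all

text \<open>Colour the vertices greedily in the order of insertion. The earlier neighbours of a vertex
  form a clique and get distinct colours, so a new vertex is pendant in each graph induced by
  two colour classes, and its edges can be read off from the components there.\<close>

lemma ktree_determining_colouring:
  assumes "ktree_ext K {} {} U F"
  shows "\<exists>f. determining_colouring K U F f"
  using assms
proof (induction rule: ktree_ext.induct)
  case base
  then show ?case by (simp add: determining_colouring_def)
next
  case (add U F v N)
  then obtain f where "determining_colouring K U F f" by auto
  note f = determining_colouringD[OF this]
  have "card (f ` N) < card {..<K}"
    using add.hyps(4,5) card_image_le[of N f] by simp
  then have "\<not> {..<K} \<subseteq> f ` N"
    using add.hyps(4) card_mono[of "f ` N" "{..<K}"] by (meson finite_imageI not_le)
  then obtain c where c: "c < K" "c \<notin> f ` N" by blast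
  define g where "g = f(v := c)"
  define F' where "F' = F \<union> (\<lambda>x. {v, x}) ` N"
  define S where "S i j = {x \<in> insert v U. g x = i \<or> g x = j}" for i j
  define S0 where "S0 i j = {x \<in> U. f x = i \<or> f x = j}" for i j
  have vN: "v \<notin> N" using add.hyps by blast
  have vF: "e \<notin> F" if "v \<in> e" for e using f(2) add.hyps(2) that by blast
  have nbr: "w \<in> N" if "{v, w} \<in> F'" for w
    using that vF by (auto simp: F'_def doubleton_eq_iff)
  have S_minus: "S i j - {v} = S0 i j" for i j
    using add.hyps(2) by (auto simp: S_def S0_def g_def)
  have rainbow: "w = u" if "w \<in> N" "u \<in> N" "f w = f u" for w u
    using add.hyps(6) f(3) that by blast
  have g: "\<forall>x\<in>insert v U. g x < K" using f(1) c by (auto simp: g_def)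
  moreover have "F' \<subseteq> Pow (insert v U)" using f(2) add.hyps(3) by (auto simp: F'_def)
  moreover have "g x \<noteq> g y" if "x \<noteq> y" and xy: "{x, y} \<in> F'" for x y
  proof (cases "v \<in> {x, y}")
    case True
    then consider "x = v" "y \<in> N" | "y = v" "x \<in> N"
      using xy nbr[of x] nbr[of y] by (auto simp: insert_commute)
    then show ?thesis using c(2) vN by cases (auto simp: g_def)
  next
    case False
    then have "{x, y} \<in> F" using that(2) by (auto simp: F'_def)
    then show ?thesis using f(3)[OF that(1)] False by (auto simp: g_def)
  qed
  moreover have "E = E'"
    if sub: "E \<subseteq> F'" "E' \<subseteq> F'" and same: "\<And>i j. i < K \<Longrightarrow> j < K \<Longrightarrow> connected_rel E (S i j) = connected_rel E' (S i j)"
    for E E'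
  proof -
    have pendant: "\<exists>u. \<forall>w\<in>S i j. {v, w} \<in> D \<longrightarrow> w = u" if D: "D \<subseteq> F'" and vS: "v \<in> S i j" for i j D
    proof -
      have cij: "c = i \<or> c = j" using vS by (auto simp: S_def g_def)
      have "w = w'" if "w \<in> S i j" "{v, w} \<in> D" "w' \<in> S i j" "{v, w'} \<in> D" for w w'
      proof -
        have N: "w \<in> N" "w' \<in> N" using that D nbr by auto
        then have "f w \<noteq> c" "f w' \<noteq> c" "w \<noteq> v" "w' \<noteq> v" using c(2) vN by auto
        then have "f w = f w'" using that(1,3) cij by (auto simp: S_def g_def)
        then show ?thesis using rainbow N by blast
      qed
      then show ?thesis by blast
    qed
    \<comment> \<open>The answers for the old vertices are recovered from the new ones by deleting
      the pendant vertex \<open>v\<close>, which makes the induction hypothesis applicable.\<close>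
    have restrict: "connected_rel {e \<in> D. v \<notin> e} (S0 i j) =
        {(x, y) \<in> connected_rel D (S i j). x \<noteq> v \<and> y \<noteq> v}" if D: "D \<subseteq> F'" for D i j
    proof -
      have 1: "connected_rel {e \<in> D. v \<notin> e} (S0 i j) = connected_rel D (S i j - {v})"
        unfolding S_minus
        by (intro set_eqI iffI; clarify; erule conn_mono) (use add.hyps(2) in \<open>auto simp: S0_def\<close>)
      have 2: "(x, y) \<in> connected_rel D (S i j) \<longleftrightarrow> (x, y) \<in> connected_rel D (S i j - {v})"
        if "x \<noteq> v" "y \<noteq> v" for x y
      proof (cases "v \<in> S i j \<and> x \<in> S i j \<and> y \<in> S i j")
        case True
        then obtain u where "\<And>w. w \<in> S i j \<Longrightarrow> {v, w} \<in> D \<Longrightarrow> w = u" using pendant[OF D] by blast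
        then show ?thesis using True that by (intro conn_remove_pendant) auto
      next
        case False
        then show ?thesis using conn_in[of x y] by (cases "v \<in> S i j") auto
      qed
      show ?thesis unfolding 1 using 2 conn_in by fastforce
    qed
    have old: "{e \<in> E. v \<notin> e} = {e \<in> E'. v \<notin> e}"
    proof (rule f(4))
      show "{e \<in> E. v \<notin> e} \<subseteq> F" "{e \<in> E'. v \<notin> e} \<subseteq> F" using sub by (auto simp: F'_def)
      fix i j assume "i < K" "j < K"
      from same[OF this] show "connected_rel {e \<in> E. v \<notin> e} {x \<in> U. f x = i \<or> f x = j} =
          connected_rel {e \<in> E'. v \<notin> e} {x \<in> U. f x = i \<or> f x = j}"
        using restrict[OF sub(1), of i j] restrict[OF sub(2), of i j] by (simp add: S0_def)
    qed
    have new: "{v, x} \<in> E \<longleftrightarrow> {v, x} \<in> E'" if x: "x \<in> N" for x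
    proof -
      have xv: "x \<noteq> v" "x \<in> U" "f x < K" using x vN add.hyps(3) f(1) by auto
      then have inS: "v \<in> S c (f x)" "x \<in> S c (f x)" by (auto simp: S_def g_def)
      have "(v, x) \<in> connected_rel D (S c (f x)) \<longleftrightarrow> {v, x} \<in> D" if D: "D \<subseteq> F'" for D
      proof (rule conn_pendant_iff[OF inS])
        fix w assume w: "w \<in> S c (f x)" "{v, w} \<in> D"
        then have "w \<in> N" using D nbr by blast
        then have "f w \<noteq> c" "w \<noteq> v" using c(2) vN by auto
        then have "f w = f x" using w(1) by (auto simp: S_def g_def)
        then show "w = x" using rainbow \<open>w \<in> N\<close> x by blast
      qed (use xv in simp)
      from this[OF sub(1)] this[OF sub(2)] same[OF c(1) xv(3)] show ?thesis by simp
    qed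
    have "e \<in> E \<longleftrightarrow> e \<in> E'" if e: "e \<in> F'" for e
    proof (cases "v \<in> e")
      case True
      then have "e \<in> (\<lambda>x. {v, x}) ` N" using e vF by (auto simp: F'_def)
      then show ?thesis using new by auto
    next
      case False
      have "e \<in> {e \<in> E. v \<notin> e} \<longleftrightarrow> e \<in> {e \<in> E'. v \<notin> e}" unfolding old ..
      then show ?thesis using False by simp
    qed
    then show "E = E'" using sub by auto
  qed
  ultimately have "determining_colouring K (insert v U) F' g"
    unfolding determining_colouring_def S_def by simp
  then show ?case unfolding F'_def by auto
qed

section \<open>Candidate pairs\<close>

text \<open>The pairs not ruled out by the answers on \<open>\<S>\<close>, including those contained
  in no query. Although \<open>E\<close> is an argument, the set depends on the answers only, so the
  algorithm can compute it.\<close>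

definition candidates :: "'a set \<Rightarrow> 'a set set \<Rightarrow> 'a set set \<Rightarrow> 'a set set" where
  "candidates W \<S> E = {{u, v} | u v. u \<in> W \<and> v \<in> W \<and> u \<noteq> v \<and>
     (\<forall>S\<in>\<S>. u \<in> S \<longrightarrow> v \<in> S \<longrightarrow> (u, v) \<in> connected_rel E S)}"

lemma candidates_iff:
  assumes "u \<noteq> v"
  shows "{u, v} \<in> candidates W \<S> E \<longleftrightarrow> u \<in> W \<and> v \<in> W \<and>
    (\<forall>S\<in>\<S>. u \<in> S \<longrightarrow> v \<in> S \<longrightarrow> (u, v) \<in> connected_rel E S)"
    (is "?l \<longleftrightarrow> ?r")
proof
  assume ?l
  then obtain x y where xy: "{u, v} = {x, y}" "x \<in> W" "y \<in> W"
    "\<And>S. S \<in> \<S> \<Longrightarrow> x \<in> S \<Longrightarrow> y \<in> S \<Longrightarrow> (x, y) \<in> connected_rel E S"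
    by (auto simp: candidates_def)
  then consider "u = x" "v = y" | "u = y" "v = x" by (auto simp: doubleton_eq_iff)
  then show ?r using xy(2-4) conn_sym[of x y E] by cases simp_all
next
  assume ?r
  then have "u \<in> W \<and> v \<in> W \<and> u \<noteq> v \<and> (\<forall>S\<in>\<S>. u \<in> S \<longrightarrow> v \<in> S \<longrightarrow> (u, v) \<in> connected_rel E S)"
    using assms by blast
  then show ?l unfolding candidates_def by blast
qed

lemma candidatesD:
  assumes "e \<in> candidates W \<S> E"
  shows "card e = 2" "e \<subseteq> W"
proof -
  obtain u v where "e = {u, v}" "u \<in> W" "v \<in> W" "u \<noteq> v"
    using assms unfolding candidates_def by blast
  then show "card e = 2" "e \<subseteq> W" by simp_all
qed

lemma candidates_cong:
  assumes "\<And>S. S \<in> \<S> \<Longrightarrow> induced_components E S = induced_components E' S"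
  shows "candidates W \<S> E = candidates W \<S> E'"
proof -
  have "connected_rel E S = connected_rel E' S" if "S \<in> \<S>" for S
    using assms[OF that] by (rule conn_eq_if_components_eq)
  then show ?thesis by (simp add: candidates_def cong: ball_cong)
qed

lemma edge_in_candidates:
  assumes "simple_graph V E" "e \<in> E" "e \<subseteq> W"
  shows "e \<in> candidates W \<S> E"
proof -
  obtain u v where e: "e = {u, v}" "u \<noteq> v"
    using simple_graphD(4)[OF assms(1,2)] by (auto simp: card_2_iff)
  then have "u \<in> W" "v \<in> W" "{u, v} \<in> E" using assms by auto
  then show ?thesis unfolding e(1) candidates_iff[OF e(2)] by (simp add: conn_edge)
qed

definition nbrs :: "'a set set \<Rightarrow> 'a set \<Rightarrow> 'a \<Rightarrow> 'a set" where
  "nbrs F W u = {v \<in> W. v \<noteq> u \<and> {u, v} \<in> F}"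

text \<open>Suppose \<open>D\<close> candidates \<open>L\<close> are not neighbours of
  \<open>u\<close>. Some query contains \<open>u\<close>, avoids its neighbourhood \<open>X\<close>
  and meets \<open>L\<close>; as \<open>u\<close> is isolated there, a pair from \<open>u\<close> to
  \<open>L\<close> is separated. So fewer than \<open>D\<close> false candidates join the at most
  \<open>D\<close> true ones.\<close>

lemma star_separating_degree:
  assumes "simple_graph V E" "finite W" "\<S> \<subseteq> Pow W" "star_separating W D \<S>" "u \<in> W"
    and "card (nbrs E W u) \<le> D"
  shows "card (nbrs (candidates W \<S> E) W u) < 2 * D \<or> D = 0"
proof (rule disjCI, rule ccontr)
  assume "D \<noteq> 0"
  define X where "X = nbrs E W u"
  define L0 where "L0 = nbrs (candidates W \<S> E) W u - X"
  assume "\<not> card (nbrs (candidates W \<S> E) W u) < 2 * D"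
  moreover have fin: "finite X" "finite L0" using assms(2) by (auto simp: X_def L0_def nbrs_def)
  moreover have "card (nbrs (candidates W \<S> E) W u) \<le> card (X \<union> L0)"
    using fin by (intro card_mono) (auto simp: L0_def)
  moreover have "card (X \<union> L0) \<le> card X + card L0" by (rule card_Un_le)
  ultimately have "D \<le> card L0" using assms(6) by (simp add: X_def)
  then obtain L where L: "L \<subseteq> L0" "card L = D" by (meson obtain_subset_with_card_n)
  have LW: "L \<subseteq> W - X - {u}" using L(1) by (auto simp: L0_def nbrs_def)
  have "X \<subseteq> W - {u}" by (auto simp: X_def nbrs_def)
  with assms(4,5,6) L LW obtain S where S: "S \<in> \<S>" "u \<in> S" "S \<inter> X = {}" "S \<inter> L \<noteq> {}"
    unfolding star_separating_def X_def by metis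
  then obtain v where v: "v \<in> S" "v \<in> L" by blast
  then have "{u, v} \<in> candidates W \<S> E" "v \<noteq> u" "v \<notin> X" "v \<in> W"
    using L(1) LW by (auto simp: L0_def nbrs_def)
  then have conn: "(u, v) \<in> connected_rel E S" using S v candidates_iff[of u v W \<S> E] by auto
  \<comment> \<open>\<open>S\<close> contains no neighbour of \<open>u\<close>, so the pendant
    condition holds vacuously.\<close>
  have "{u, v} \<in> E"
  proof (rule conn_pendant_iff[THEN iffD1, OF S(2) v(1) _ _ conn])
    fix w assume w: "w \<in> S" "{u, w} \<in> E"
    have "w \<noteq> u" using simple_graphD(4)[OF assms(1) w(2)] by auto
    moreover have "w \<in> W" using w(1) S(1) assms(3) by auto
    ultimately have "w \<in> X" using w(2) by (simp add: X_def nbrs_def)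
    then show "w = v" using w(1) S(3) by auto
  qed (use \<open>v \<noteq> u\<close> in simp)
  then show False using \<open>v \<notin> X\<close> \<open>v \<noteq> u\<close> \<open>v \<in> W\<close> by (simp add: X_def nbrs_def)
qed

text \<open>A balanced bag \<open>X\<close> of a tree decomposition separates the graph; fewer than \<open>D\<close> candidate pairs
  cross it, and deleting their ends as well separates the candidate graph.\<close>

lemma candidates_have_separators:
  assumes G: "simple_graph V E" and D: "treewidth V E + 1 \<le> D"
    and \<S>: "\<S> \<subseteq> Pow V" "separating V D \<S>"
  shows "has_separators V (candidates V \<S> E) (3 * D)"
  unfolding has_separators_def
proof (intro allI impI)
  fix W assume W: "W \<subseteq> V"
  let ?H = "candidates V \<S> E"
  have finV: "finite V" using G by (rule simple_graphD)
  obtain I F B where td: "tree_decomposition V E I F B"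
    and small: "\<And>i. i \<in> I \<Longrightarrow> card (B i) \<le> treewidth V E + 1"
    using treewidth_decomposition[OF G] by metis
  obtain i where i: "i \<in> I"
    and bal: "\<And>x. x \<in> V - B i \<Longrightarrow> 2 * card {w \<in> W. (x, w) \<in> connected_rel E (V - B i)} \<le> card W"
    using balanced_bag[OF td finV W] by metis
  define X where "X = B i"
  have X: "X \<subseteq> V" "card X \<le> D" "finite X"
    using td i small[OF i] D finV finite_subset by (auto simp: tree_decomposition_def X_def)
  \<comment> \<open>Candidate pairs whose ends lie in different components of \<open>V - X\<close>.
    A query avoiding \<open>X\<close> and containing such a pair would separate it, so it would not
    be a candidate.\<close>
  define Bad where "Bad = {e \<in> ?H. e \<subseteq> V - X \<and> (\<exists>u\<in>e. \<exists>v\<in>e. (u, v) \<notin> connected_rel E (V - X))}"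
  have finBad: "finite Bad" by (rule finite_subset[of _ "Pow V"]) (use finV in \<open>auto simp: Bad_def\<close>)
  have "card Bad < D"
  proof (rule ccontr)
    assume "\<not> card Bad < D"
    then obtain M where M: "M \<subseteq> Bad" "card M = D" using obtain_subset_with_card_n[of D Bad] by auto
    have "e \<subseteq> V - X \<and> card e = 2" if "e \<in> M" for e
      using that M(1) candidatesD(1)[of e] by (auto simp: Bad_def)
    from separatingD[OF \<S>(2) X(1,2) M(2) this]
    obtain S e where S: "S \<in> \<S>" "S \<inter> X = {}" "e \<in> M" "e \<subseteq> S" by metis
    have e: "e \<in> ?H" using S(3) M(1) by (auto simp: Bad_def)
    obtain u v where uv: "u \<in> e" "v \<in> e" "(u, v) \<notin> connected_rel E (V - X)"
      using S(3) M(1) by (auto simp: Bad_def)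
    have sub: "S \<subseteq> V - X" using S(1,2) \<S>(1) by auto
    have "u \<noteq> v" using uv conn_refl[of u "V - X" E] S(4) sub by auto
    then have "e = {u, v}" using uv(1,2) candidatesD(1)[OF e] by (auto simp: card_2_iff)
    then have "(u, v) \<in> connected_rel E S"
      using e candidates_iff[OF \<open>u \<noteq> v\<close>] S(1,4) by auto
    then have "(u, v) \<in> connected_rel E (V - X)" by (rule conn_mono) (use sub in auto)
    then show False using uv(3) by contradiction
  qed
  define Z where "Z = X \<union> \<Union>Bad"
  \<comment> \<open>Two ends for each of fewer than \<open>D\<close> bad pairs, besides the at most
    \<open>D\<close> vertices of \<open>X\<close>, give the size \<open>3 * D\<close>.\<close>
  have "card (\<Union>Bad) \<le> (\<Sum>e\<in>Bad. card e)" by (rule card_Union_le_sum_card)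
  also have "\<dots> = (\<Sum>e\<in>Bad. 2)" by (intro sum.cong) (auto simp: Bad_def candidatesD)
  finally have "card (\<Union>Bad) \<le> 2 * card Bad" by simp
  then have "card Z \<le> 3 * D" using card_Un_le[of X "\<Union>Bad"] \<open>card Bad < D\<close> X(2) by (simp add: Z_def)
  moreover have "Z \<subseteq> V" using X(1) by (auto simp: Z_def Bad_def)
  moreover have "2 * card {w \<in> W. (x, w) \<in> connected_rel ?H (V - Z)} \<le> card W" if x: "x \<in> V - Z" for x
  proof -
    have "(x, w) \<in> connected_rel E (V - X)" if "(x, w) \<in> connected_rel ?H (V - Z)" for w
      using that
    proof (induction rule: conn_induct)
      case base
      then show ?case using x by (intro conn_refl) (auto simp: Z_def)
    next
      case (step y z)
      have yz: "y \<in> V - X" "z \<in> V - X" using step.hyps by (auto simp: Z_def)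
      have "{y, z} \<notin> Bad" using step.hyps(2) by (auto simp: Z_def)
      then have "(y, z) \<in> connected_rel E (V - X)"
        using step.hyps(4) yz by (auto simp: Bad_def)
      with step.IH show ?case by (rule conn_trans)
    qed
    then have "card {w \<in> W. (x, w) \<in> connected_rel ?H (V - Z)}
        \<le> card {w \<in> W. (x, w) \<in> connected_rel E (V - X)}"
      using finite_subset[OF W finV] by (intro card_mono) auto
    moreover have "x \<in> V - B i" using x by (simp add: Z_def X_def)
    ultimately show ?thesis using bal[of x] by (simp add: X_def)
  qed
  ultimately show "\<exists>Z\<subseteq>V. card Z \<le> 3 * D \<and>
      (\<forall>x\<in>V - Z. 2 * card {w \<in> W. (x, w) \<in> connected_rel ?H (V - Z)} \<le> card W)"
    by (intro exI[of _ Z]) simp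
qed

text \<open>The queries are the unions of two colour classes, at most one for each pair of the
  \<open>K\<close> colours. They depend on \<open>F\<close> only.\<close>

lemma learnable_ktree:
  assumes "ktree_ext K {} {} V F" "\<And>E. E \<in> \<G> \<Longrightarrow> E \<subseteq> F"
  shows "learnable V \<G> P (\<lambda>_. (real K)\<^sup>2)"
proof -
  obtain f where f: "determining_colouring K V F f"
    using ktree_determining_colouring[OF assms(1)] by auto
  define \<Q> where "\<Q> = (\<lambda>(i, j). {x \<in> V. f x = i \<or> f x = j}) ` ({..<K} \<times> {..<K})"
  have learn: "learnable V \<G> P (\<lambda>_. real (card \<Q>))"
  proof (rule learnable_determined)
    show "finite \<Q>" "\<Q> \<subseteq> Pow V" by (auto simp: \<Q>_def)
    fix E E' assume E: "E \<in> \<G>" "E' \<in> \<G>" and same: "\<And>S. S \<in> \<Q> \<Longrightarrow> connected_rel E S = connected_rel E' S"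
    show "E = E'"
    proof (rule determining_colouringD(4)[OF f assms(2)[OF E(1)] assms(2)[OF E(2)]])
      fix i j assume "i < K" "j < K"
      then have "{x \<in> V. f x = i \<or> f x = j} \<in> \<Q>" unfolding \<Q>_def by (intro rev_image_eqI[of "(i, j)"]) auto
      then show "connected_rel E {x \<in> V. f x = i \<or> f x = j} = connected_rel E' {x \<in> V. f x = i \<or> f x = j}"
        by (rule same)
    qed
  qed
  have "card \<Q> \<le> K * K"
    using card_image_le[of "{..<K} \<times> {..<K}" "\<lambda>(i, j). {x \<in> V. f x = i \<or> f x = j}"]
    by (simp add: \<Q>_def)
  then have "real (card \<Q>) \<le> (real K)\<^sup>2"
    by (metis of_nat_le_iff of_nat_mult power2_eq_square)
  then show ?thesis by (intro learnable_mono[OF learn order_refl])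
qed

section \<open>Graphs with few edges\<close>

lemma greedy_colouring:
  assumes "finite A" "\<And>a. a \<in> A \<Longrightarrow> card {b \<in> A. R a b} \<le> d" "\<And>a b. R a b \<Longrightarrow> R b a"
  shows "\<exists>f. (\<forall>a\<in>A. f a \<le> (d :: nat)) \<and> (\<forall>a\<in>A. \<forall>b\<in>A. a \<noteq> b \<longrightarrow> R a b \<longrightarrow> f a \<noteq> f b)"
  using assms(1,2)
proof (induction A rule: finite_induct)
  case empty
  then show ?case by simp
next
  case (insert x A)
  have "card {b \<in> A. R a b} \<le> d" if "a \<in> A" for a
  proof -
    have "card {b \<in> A. R a b} \<le> card {b \<in> insert x A. R a b}"
      using insert.hyps by (intro card_mono) auto
    then show ?thesis using insert.prems[of a] that by simp
  qed
  then obtain f where f: "\<forall>a\<in>A. f a \<le> d" "\<forall>a\<in>A. \<forall>b\<in>A. a \<noteq> b \<longrightarrow> R a b \<longrightarrow> f a \<noteq> f b"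
    using insert.IH by auto
  have "card (f ` {b \<in> A. R x b}) \<le> card {b \<in> A. R x b}"
    using insert.hyps by (intro card_image_le) simp
  also have "\<dots> \<le> card {b \<in> insert x A. R x b}"
    using insert.hyps by (intro card_mono) auto
  also have "\<dots> \<le> d" using insert.prems by simp
  finally have "card (f ` {b \<in> A. R x b}) < card {..d}" by simp
  then have "\<not> {..d} \<subseteq> f ` {b \<in> A. R x b}"
    using insert.hyps card_mono[of "f ` {b \<in> A. R x b}" "{..d}"] by auto
  then obtain c where c: "c \<le> d" "c \<notin> f ` {b \<in> A. R x b}" by auto
  then have "\<forall>b\<in>A. R x b \<longrightarrow> f b \<noteq> c" by auto
  then show ?case
    using f c(1) insert.hyps(2) assms(3)
    by (intro exI[of _ "f(x := c)"]) auto
qed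

text \<open>Only \<open>u\<close> has to be pendant in \<open>S\<close>; \<open>v\<close> may have
  further neighbours there. The one-sided form also serves pairs whose second vertex has high
  degree.\<close>

definition isolates :: "'a set set \<Rightarrow> 'a set \<Rightarrow> 'a \<Rightarrow> 'a \<Rightarrow> bool" where
  "isolates H S u v \<longleftrightarrow> u \<in> S \<and> v \<in> S \<and> (\<forall>w\<in>S. {u, w} \<in> H \<longrightarrow> w = v)"

lemma isolates_determines:
  assumes "isolates H S u v" "u \<noteq> v" "E \<subseteq> H" "E' \<subseteq> H" "connected_rel E S = connected_rel E' S"
  shows "{u, v} \<in> E \<longleftrightarrow> {u, v} \<in> E'"
proof -
  have "(u, v) \<in> connected_rel D S \<longleftrightarrow> {u, v} \<in> D" if "D \<subseteq> H" for D
    using assms(1,2) that by (intro conn_pendant_iff) (auto simp: isolates_def)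
  from this[OF assms(3)] this[OF assms(4)] show ?thesis using assms(5) by simp
qed

text \<open>Two kinds of queries. Inside \<open>L\<close>, the classes of a strong edge colouring of
  \<open>H\<close>: each class is an induced matching. For a vertex \<open>v\<close> outside
  \<open>L\<close>, one of \<open>2 * D\<close> independent classes of a proper colouring of
  \<open>L\<close>, together with \<open>v\<close>: the only possible neighbour of \<open>u\<close>
  in it is \<open>v\<close>.\<close>

lemma low_degree_queries:
  fixes V :: "'a set"
  assumes "finite V" and H: "\<And>e. e \<in> H \<Longrightarrow> card e = 2 \<and> e \<subseteq> V" and "1 \<le> D"
    and L: "L \<subseteq> V" "\<And>u. u \<in> L \<Longrightarrow> card (nbrs H V u) < 2 * D"
  shows "\<exists>\<Q>\<subseteq>Pow V. finite \<Q> \<and> card \<Q> \<le> 8 * D\<^sup>2 + 1 + 2 * D * card (V - L) \<and>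
    (\<forall>u\<in>L. \<forall>v\<in>V. u \<noteq> v \<longrightarrow> {u, v} \<in> H \<longrightarrow> (\<exists>S\<in>\<Q>. isolates H S u v))"
proof -
  have finL: "finite L" using L(1) assms(1) finite_subset by blast
  have no_loop: "{u} \<notin> H" for u using H[of "{u}"] by auto
  have fin_nbrs: "finite (nbrs H V u)" for u using assms(1) by (simp add: nbrs_def)
  have "\<exists>g. (\<forall>a\<in>L. g a \<le> 2 * D - 1) \<and> (\<forall>a\<in>L. \<forall>b\<in>L. a \<noteq> b \<longrightarrow> {a, b} \<in> H \<longrightarrow> g a \<noteq> g b)"
  proof (rule greedy_colouring[OF finL])
    fix a assume a: "a \<in> L"
    have "{b \<in> L. {a, b} \<in> H} \<subseteq> nbrs H V a" using L(1) no_loop by (auto simp: nbrs_def)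
    then have "card {b \<in> L. {a, b} \<in> H} \<le> card (nbrs H V a)" using fin_nbrs by (rule card_mono[rotated])
    then show "card {b \<in> L. {a, b} \<in> H} \<le> 2 * D - 1" using L(2)[OF a] by simp
  qed (simp add: insert_commute)
  then obtain g where g: "\<And>a. a \<in> L \<Longrightarrow> g a \<le> 2 * D - 1"
    "\<And>a b. a \<in> L \<Longrightarrow> b \<in> L \<Longrightarrow> a \<noteq> b \<Longrightarrow> {a, b} \<in> H \<Longrightarrow> g a \<noteq> g b" by auto
  define A where "A = {e \<in> H. e \<subseteq> L}"
  \<comment> \<open>Edges conflict if they meet or are joined by an edge of \<open>H\<close>. An
    edge has two ends, each with at most \<open>2 * D\<close> vertices of \<open>L\<close> at
    distance at most 1, each of these in at most \<open>2 * D\<close> edges of \<open>A\<close>;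
    this gives \<open>8 * D^2\<close>.\<close>
  define R where "R e e' \<longleftrightarrow> (\<exists>x\<in>e. \<exists>y\<in>e'. x = y \<or> {x, y} \<in> H)" for e e' :: "'a set"
  have finA: "finite A" by (rule finite_subset[of _ "Pow L"]) (use finL in \<open>auto simp: A_def\<close>)
  have at: "card {e \<in> A. y \<in> e} \<le> 2 * D" if y: "y \<in> L" for y
  proof -
    have "{e \<in> A. y \<in> e} \<subseteq> (\<lambda>z. {y, z}) ` nbrs H V y"
    proof
      fix e assume e: "e \<in> {e \<in> A. y \<in> e}"
      then have eH: "e \<in> H" "y \<in> e" by (auto simp: A_def)
      then obtain z where z: "e = {y, z}" "z \<noteq> y" using H[OF eH(1)] by (auto simp: card_2_iff)
      then have "z \<in> nbrs H V y" using eH H[OF eH(1)] by (auto simp: nbrs_def)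
      then show "e \<in> (\<lambda>z. {y, z}) ` nbrs H V y" using z by auto
    qed
    then have "card {e \<in> A. y \<in> e} \<le> card ((\<lambda>z. {y, z}) ` nbrs H V y)"
      using fin_nbrs by (intro card_mono) auto
    also have "\<dots> \<le> card (nbrs H V y)" using fin_nbrs by (rule card_image_le)
    finally show ?thesis using L(2)[OF y] by simp
  qed
  have "\<exists>f. (\<forall>a\<in>A. f a \<le> 8 * D\<^sup>2) \<and> (\<forall>a\<in>A. \<forall>b\<in>A. a \<noteq> b \<longrightarrow> R a b \<longrightarrow> f a \<noteq> f b)"
  proof (rule greedy_colouring[OF finA])
    fix e assume e: "e \<in> A"
    define T where "T x = {y \<in> L. y = x \<or> {x, y} \<in> H}" for x
    have finT: "finite (T x)" for x using finL by (simp add: T_def)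
    have cT: "card (T x) \<le> 2 * D" if "x \<in> L" for x
    proof -
      have "T x \<subseteq> insert x (nbrs H V x)" using L(1) by (auto simp: T_def nbrs_def)
      then have "card (T x) \<le> card (insert x (nbrs H V x))" using fin_nbrs by (intro card_mono) auto
      also have "\<dots> \<le> Suc (card (nbrs H V x))" by (simp add: card_insert_le_m1 card_insert_if fin_nbrs)
      finally show ?thesis using L(2)[OF that] by simp
    qed
    have eL: "e \<subseteq> L" "card e = 2" "finite e" using e H[of e] finL finite_subset by (auto simp: A_def)
    have "{e' \<in> A. R e e'} \<subseteq> (\<Union>x\<in>e. \<Union>y\<in>T x. {e' \<in> A. y \<in> e'})"
      by (auto simp: R_def T_def A_def)
    then have "card {e' \<in> A. R e e'} \<le> card (\<Union>x\<in>e. \<Union>y\<in>T x. {e' \<in> A. y \<in> e'})"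
      using eL finT finA by (intro card_mono) auto
    also have "\<dots> \<le> (\<Sum>x\<in>e. card (\<Union>y\<in>T x. {e' \<in> A. y \<in> e'}))"
      using eL(3) by (rule card_UN_le)
    also have "\<dots> \<le> (\<Sum>x\<in>e. 2 * D * (2 * D))"
    proof (rule sum_mono)
      fix x assume "x \<in> e"
      then have x: "x \<in> L" using eL by auto
      have "card (\<Union>y\<in>T x. {e' \<in> A. y \<in> e'}) \<le> (\<Sum>y\<in>T x. card {e' \<in> A. y \<in> e'})"
        using finT by (rule card_UN_le)
      also have "\<dots> \<le> (\<Sum>y\<in>T x. 2 * D)" by (intro sum_mono at) (simp add: T_def)
      also have "\<dots> \<le> 2 * D * (2 * D)" using cT[OF x] by simp
      finally show "card (\<Union>y\<in>T x. {e' \<in> A. y \<in> e'}) \<le> 2 * D * (2 * D)" .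
    qed
    also have "\<dots> = 8 * D\<^sup>2" using eL by (simp add: power2_eq_square)
    finally show "card {e' \<in> A. R e e'} \<le> 8 * D\<^sup>2" .
  next
    fix e e' :: "'a set" assume "R e e'"
    then show "R e' e" unfolding R_def by (metis insert_commute)
  qed
  then obtain f where f: "\<And>e. e \<in> A \<Longrightarrow> f e \<le> 8 * D\<^sup>2"
    "\<And>e e'. e \<in> A \<Longrightarrow> e' \<in> A \<Longrightarrow> e \<noteq> e' \<Longrightarrow> R e e' \<Longrightarrow> f e \<noteq> f e'" by metis
  define \<Q>1 where "\<Q>1 = (\<lambda>c. \<Union>{e \<in> A. f e = c}) ` {..8 * D\<^sup>2}"
  define \<Q>2 where "\<Q>2 = (\<lambda>(i, v). insert v {u \<in> L. g u = i}) ` ({..<2 * D} \<times> (V - L))"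
  have "\<Q>1 \<union> \<Q>2 \<subseteq> Pow V" using L(1) by (auto simp: \<Q>1_def \<Q>2_def A_def)
  moreover have "finite (\<Q>1 \<union> \<Q>2)" using assms(1) by (simp add: \<Q>1_def \<Q>2_def)
  moreover have "card (\<Q>1 \<union> \<Q>2) \<le> 8 * D\<^sup>2 + 1 + 2 * D * card (V - L)"
  proof -
    have "card \<Q>1 \<le> 8 * D\<^sup>2 + 1"
      using card_image_le[of "{..8 * D\<^sup>2}" "\<lambda>c. \<Union>{e \<in> A. f e = c}"] by (simp add: \<Q>1_def)
    moreover have "card \<Q>2 \<le> 2 * D * card (V - L)"
      using card_image_le[of "{..<2 * D} \<times> (V - L)" "\<lambda>(i, v). insert v {u \<in> L. g u = i}"] assms(1)
      by (simp add: \<Q>2_def)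
    ultimately show ?thesis using card_Un_le[of \<Q>1 \<Q>2] by linarith
  qed
  moreover have "\<exists>S\<in>\<Q>1 \<union> \<Q>2. isolates H S u v" if u: "u \<in> L" and v: "v \<in> V" "u \<noteq> v" "{u, v} \<in> H" for u v
  proof (cases "v \<in> L")
    case True
    define e where "e = {u, v}"
    have e: "e \<in> A" using u v True by (simp add: A_def e_def)
    have "w = v" if w: "w \<in> e'" "e' \<in> A" "f e' = f e" "{u, w} \<in> H" for w e'
    proof -
      have "R e e'" using w by (auto simp: R_def e_def)
      then have "e = e'" using f(2)[OF e w(2)] w(3) by metis
      then have "w = u \<or> w = v" using w(1) by (auto simp: e_def)
      then show ?thesis using w(4) no_loop by auto
    qed
    moreover have "u \<in> e" "v \<in> e" by (simp_all add: e_def)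
    ultimately have "isolates H (\<Union>{e' \<in> A. f e' = f e}) u v" using e by (auto simp: isolates_def)
    moreover have "\<Union>{e' \<in> A. f e' = f e} \<in> \<Q>1" using f(1)[OF e] by (simp add: \<Q>1_def)
    ultimately show ?thesis by (intro bexI[of _ "\<Union>{e' \<in> A. f e' = f e}"]) simp_all
  next
    case False
    let ?S = "insert v {u' \<in> L. g u' = g u}"
    have "w = v" if w: "w \<in> ?S" "{u, w} \<in> H" for w
    proof (rule ccontr)
      assume "w \<noteq> v"
      then have "w \<in> L" "g w = g u" using w(1) by auto
      moreover have "w \<noteq> u" using w(2) no_loop by auto
      ultimately show False using g(2)[OF u, of w] w(2) by simp
    qed
    then have "isolates H ?S u v" using u by (simp add: isolates_def)
    moreover have "g u < 2 * D" using g(1)[OF u] assms(3) by simp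
    then have "?S \<in> \<Q>2" unfolding \<Q>2_def using v(1) False by (intro rev_image_eqI[of "(g u, v)"]) auto
    ultimately show ?thesis by (intro bexI[of _ ?S]) simp_all
  qed
  ultimately show ?thesis by (intro exI[of _ "\<Q>1 \<union> \<Q>2"]) simp
qed

section \<open>Degree sums and numbers of edges\<close>

lemma card_nbrs_le:
  assumes "simple_graph V E" "W \<subseteq> V"
  shows "card (nbrs E W u) \<le> card {e \<in> E. u \<in> e}"
proof -
  have "card ((\<lambda>v. {u, v}) ` nbrs E W u) = card (nbrs E W u)"
    by (rule card_star_pairs) (simp add: nbrs_def)
  moreover have "card ((\<lambda>v. {u, v}) ` nbrs E W u) \<le> card {e \<in> E. u \<in> e}"
    using simple_graphD(5)[OF assms(1)] by (intro card_mono) (auto simp: nbrs_def)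
  ultimately show ?thesis by simp
qed

text \<open>Double counting of incidences: an edge has at most two ends in \<open>W\<close>.\<close>

lemma sum_card_nbrs_le:
  assumes "simple_graph V E" "W \<subseteq> V"
  shows "(\<Sum>u\<in>W. card (nbrs E V u)) \<le> 2 * card E"
proof -
  have fin: "finite W" "finite E" using simple_graphD(1,5)[OF assms(1)] assms(2) finite_subset by auto
  have "(\<Sum>u\<in>W. card (nbrs E V u)) \<le> (\<Sum>u\<in>W. card {e \<in> E. u \<in> e})"
    by (intro sum_mono card_nbrs_le[OF assms(1)]) simp
  also have "\<dots> = (\<Sum>u\<in>W. \<Sum>e\<in>E. if u \<in> e then 1 else 0)"
    using fin by (simp add: sum.inter_filter[symmetric])
  also have "\<dots> = (\<Sum>e\<in>E. \<Sum>u\<in>W. if u \<in> e then 1 else 0)" by (rule sum.swap)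
  also have "\<dots> = (\<Sum>e\<in>E. card {u \<in> W. u \<in> e})"
    using fin by (simp add: sum.inter_filter[symmetric])
  also have "\<dots> \<le> (\<Sum>e\<in>E. 2)"
  proof (rule sum_mono)
    fix e assume e: "e \<in> E"
    have c2: "card e = 2" using simple_graphD(4)[OF assms(1) e] .
    then have "finite e" by (metis card.infinite zero_neq_numeral)
    then have "card {u \<in> W. u \<in> e} \<le> card e" by (intro card_mono) auto
    then show "card {u \<in> W. u \<in> e} \<le> 2" using c2 by simp
  qed
  finally show ?thesis by simp
qed

lemma card_le_max_degree:
  assumes "simple_graph V E" "u \<in> V"
  shows "card (nbrs E V u) \<le> max_degree V E"
proof -
  have "card {e \<in> E. u \<in> e} \<le> max_degree V E"
    unfolding max_degree_def using simple_graphD(1)[OF assms(1)] assms(2) by (intro Max_ge) auto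
  then show ?thesis using card_nbrs_le[OF assms(1) order_refl, of u] by simp
qed

lemma nbrs_mono_card: "finite V \<Longrightarrow> W \<subseteq> V \<Longrightarrow> card (nbrs E W u) \<le> card (nbrs E V u)"
  by (intro card_mono) (auto simp: nbrs_def)

lemma high_degree_imp_many_edges:
  assumes "simple_graph V E" "W \<subseteq> V" "\<And>u. u \<in> W \<Longrightarrow> D \<le> 2 * card (nbrs E V u)"
  shows "card W * D \<le> 4 * card E"
proof -
  have "card W * D = (\<Sum>u\<in>W. D)" by simp
  also have "\<dots> \<le> (\<Sum>u\<in>W. 2 * card (nbrs E V u))" by (intro sum_mono assms(3))
  also have "\<dots> = 2 * (\<Sum>u\<in>W. card (nbrs E V u))" by (simp add: sum_distrib_left)
  also have "\<dots> \<le> 4 * card E" using sum_card_nbrs_le[OF assms(1,2)] by simp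
  finally show ?thesis .
qed

section \<open>Vertices of high degree: doubling the scale\<close>

text \<open>The graphs in \<open>\<G>\<close> differ only inside \<open>W\<close>, so it suffices to
  ask all pairs of \<open>W\<close>, of which there are at most
  \<open>(4 * sqrt M)^2 / 2\<close>.\<close>

lemma learn_few_vertices:
  fixes M :: real
  assumes "finite V" "W \<subseteq> V" "real (card W) \<le> 4 * sqrt M" "0 \<le> M"
    and G: "\<And>E. E \<in> \<G> \<Longrightarrow> simple_graph V E"
    and agree: "\<And>E E' e. E \<in> \<G> \<Longrightarrow> E' \<in> \<G> \<Longrightarrow> e \<in> E \<Longrightarrow> e \<notin> E' \<Longrightarrow> e \<subseteq> W"
  shows "learnable V \<G> P (\<lambda>_. 8 * M)"
proof -
  define \<Q> where "\<Q> = {e. e \<subseteq> W \<and> card e = 2}"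
  have finW: "finite W" using assms(1,2) finite_subset by auto
  have learn: "learnable V \<G> P (\<lambda>_. real (card \<Q>))"
  proof (rule learnable_determined)
    show "finite \<Q>" "\<Q> \<subseteq> Pow V" using finW assms(2) by (auto simp: \<Q>_def)
    have sub: "E \<subseteq> E'" if E: "E \<in> \<G>" "E' \<in> \<G>"
      and same: "\<And>S. S \<in> \<Q> \<Longrightarrow> connected_rel E S = connected_rel E' S" for E E'
    proof
      fix e assume e: "e \<in> E"
      then obtain u v where uv: "e = {u, v}" "u \<noteq> v"
        using simple_graphD(4)[OF G[OF E(1)] e] by (auto simp: card_2_iff)
      show "e \<in> E'"
      proof (rule ccontr)
        assume ne: "e \<notin> E'"
        have "e \<in> \<Q>" using agree[OF E e ne] simple_graphD(4)[OF G[OF E(1)] e] by (simp add: \<Q>_def)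
        from same[OF this] show False
          using conn_pair_iff[OF G[OF E(1)] uv(2)] conn_pair_iff[OF G[OF E(2)] uv(2)] e ne
          by (simp add: uv(1))
      qed
    qed
    fix E E' assume "E \<in> \<G>" "E' \<in> \<G>" "\<And>S. S \<in> \<Q> \<Longrightarrow> connected_rel E S = connected_rel E' S"
    then show "E = E'" using sub[of E E'] sub[of E' E] by simp
  qed
  have "card \<Q> = card W choose 2" unfolding \<Q>_def using finW by (rule n_subsets)
  then have "2 * card \<Q> \<le> card W * (card W - 1)" by (simp add: choose_two)
  also have "\<dots> \<le> card W * card W" by (intro mult_le_mono) auto
  finally have "2 * card \<Q> \<le> card W * card W" .
  then have "real (2 * card \<Q>) \<le> real (card W * card W)" by (simp only: of_nat_le_iff)
  also have "\<dots> \<le> (4 * sqrt M) * (4 * sqrt M)"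
    unfolding of_nat_mult using assms(3,4) by (intro mult_mono) auto
  also have "\<dots> = 16 * M" using assms(4) by simp
  finally have "real (card \<Q>) \<le> 8 * M" by simp
  then show ?thesis by (intro learnable_mono[OF learn order_refl])
qed

text \<open>With \<open>y = sqrt M / D\<close>, the logarithm is that of \<open>(2 * y)^2\<close>
  and hence at most linear in \<open>y\<close>, which cancels one factor \<open>D\<close>. A bound
  linear in \<open>D\<close> makes the costs of successive doublings a geometric sum.\<close>

lemma star_family_cost:
  fixes M D :: real
  assumes "0 < D" "D \<le> sqrt M"
  shows "25 * D\<^sup>2 * (1 + ln (4 * M / D / D)) \<le> 125 * D * sqrt M"
proof -
  define y where "y = sqrt M / D"
  have y: "1 \<le> y" using assms by (simp add: y_def field_simps)
  have M: "0 \<le> M" using assms by (meson less_le_trans less_imp_le real_sqrt_ge_0_iff order_trans)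
  then have eq: "4 * M / D / D = (2 * y)\<^sup>2"
    by (simp add: y_def power_divide power2_eq_square)
  have "ln ((2 * y)\<^sup>2) = 2 * ln (2 * y)" using y ln_realpow[of "2 * y" 2] by (simp only: of_nat_numeral)
  also have "\<dots> \<le> 2 * (2 * y - 1)" using y by (intro mult_left_mono ln_le_minus_one) auto
  also have "\<dots> \<le> 5 * y - 1" using y by simp
  finally have "1 + ln (4 * M / D / D) \<le> 5 * y" unfolding eq by (simp only: le_diff_eq add.commute)
  then have "25 * D\<^sup>2 * (1 + ln (4 * M / D / D)) \<le> 25 * D\<^sup>2 * (5 * y)"
    by (intro mult_left_mono) auto
  also have "\<dots> = 125 * D * sqrt M" using assms by (simp add: y_def power2_eq_square)
  finally show ?thesis .
qed

lemma many_edges: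
  fixes M :: real
  assumes "simple_graph V E" "W \<subseteq> V" "\<And>u. u \<in> W \<Longrightarrow> D \<le> 2 * card (nbrs E V u)"
    and "\<not> real (card W) * real D \<le> 4 * M"
  shows "\<not> real (card E) \<le> M"
proof -
  have "real (card W * D) \<le> real (4 * card E)"
    using high_degree_imp_many_edges[OF assms(1-3)] by (simp only: of_nat_le_iff)
  then show ?thesis using assms(4) by simp
qed

text \<open>The last scale, with \<open>D\<close> between \<open>sqrt M\<close> and
  \<open>2 * sqrt M\<close>. Either \<open>W\<close> has at most \<open>4 * sqrt M\<close> vertices
  and its pairs cost \<open>8 * M\<close>, or the degrees contradict \<open>card E <= M\<close>. The
  constant 258 is 250 + 8, since \<open>125 * D * sqrt M\<close> can reach
  \<open>250 * M\<close>.\<close>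

lemma learn_high_degree_final:
  fixes M :: real
  assumes "finite V" "0 < M" "W \<subseteq> V" "real D \<le> 2 * sqrt M" "sqrt M \<le> real D"
    and G: "\<And>E. E \<in> \<G> \<Longrightarrow> simple_graph V E"
    and agree: "\<And>E E' e. E \<in> \<G> \<Longrightarrow> E' \<in> \<G> \<Longrightarrow> e \<in> E \<Longrightarrow> e \<notin> E' \<Longrightarrow> e \<subseteq> W"
    and deg: "\<And>E u. E \<in> \<G> \<Longrightarrow> u \<in> W \<Longrightarrow> D \<le> 2 * card (nbrs E V u)"
  shows "learnable V \<G> (\<lambda>E. real (card E) \<le> M)
      (\<lambda>E. 258 * M - 125 * real D * sqrt M + 4 * real (\<Sum>u\<in>W. card (nbrs E V u)))"
proof (cases "real (card W) * real D \<le> 4 * M")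
  case True
  have sM: "0 < sqrt M" "sqrt M * sqrt M = M" using assms(2) by auto
  have "real (card W) * sqrt M \<le> real (card W) * real D" using assms(5) by (intro mult_left_mono) auto
  also have "\<dots> \<le> 4 * M" by (rule True)
  also have "4 * M = (4 * sqrt M) * sqrt M" using sM(2) by simp
  finally have "real (card W) * sqrt M \<le> (4 * sqrt M) * sqrt M" .
  then have cW: "real (card W) \<le> 4 * sqrt M" using sM(1) by (rule mult_right_le_imp_le)
  have learn: "learnable V \<G> (\<lambda>E. real (card E) \<le> M) (\<lambda>_. 8 * M)"
    using learn_few_vertices[OF assms(1,3) cW _ G agree] assms(2) by simp
  have "real D * sqrt M \<le> 2 * sqrt M * sqrt M" using assms(4) sM by (intro mult_right_mono) auto
  also have "\<dots> = 2 * M" using assms(2) by (simp add: mult.assoc)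
  finally have *: "125 * real D * sqrt M \<le> 250 * M" by simp
  show ?thesis
  proof (rule learnable_mono[OF learn order_refl])
    fix E
    have "0 \<le> real (\<Sum>u\<in>W. card (nbrs E V u))" by (rule of_nat_0_le_iff)
    with * show "8 * M \<le> 258 * M - 125 * real D * sqrt M + 4 * real (\<Sum>u\<in>W. card (nbrs E V u))"
      by linarith
  qed
next
  case False
  then have "\<not> real (card E) \<le> M" if "E \<in> \<G>" for E
    using many_edges[OF G[OF that] assms(3), of D] deg[OF that] by auto
  then show ?thesis by (intro learnable_brute_force assms(1) G)
qed

text \<open>Everything outside \<open>W\<close> is known and all vertices of \<open>W\<close> have degree at least \<open>D/2\<close>. Vertices
  of degree at most \<open>D\<close> have fewer than \<open>2 D\<close> candidate neighbours, at most four times their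
  degree, so that testing these candidates one by one is paid for by the edges; \<open>D\<close> is doubled
  for the others. The term \<open>- 125 D \<surd>M\<close> absorbs the geometric sum of the family sizes.\<close>

lemma learn_high_degree:
  fixes M :: real and D k :: nat
  assumes "finite V" "0 < M"
  shows "W \<subseteq> V \<Longrightarrow> 2 \<le> D \<Longrightarrow> real D \<le> 2 * sqrt M \<Longrightarrow> sqrt M \<le> real D * 2 ^ k \<Longrightarrow>
    (\<And>E. E \<in> \<G> \<Longrightarrow> simple_graph V E) \<Longrightarrow>
    (\<And>E E' e. E \<in> \<G> \<Longrightarrow> E' \<in> \<G> \<Longrightarrow> e \<in> E \<Longrightarrow> e \<notin> E' \<Longrightarrow> e \<subseteq> W) \<Longrightarrow>
    (\<And>E u. E \<in> \<G> \<Longrightarrow> u \<in> W \<Longrightarrow> D \<le> 2 * card (nbrs E V u)) \<Longrightarrow>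
    learnable V \<G> (\<lambda>E. real (card E) \<le> M)
      (\<lambda>E. 258 * M - 125 * real D * sqrt M + 4 * real (\<Sum>u\<in>W. card (nbrs E V u)))"
proof (induction k arbitrary: D W \<G>)
  case 0
  then show ?case
    by (intro learn_high_degree_final[OF assms]) auto
next
  case (Suc k)
  show ?case
  proof (cases "sqrt M \<le> real D")
    case True
    then show ?thesis using Suc.prems by (intro learn_high_degree_final[OF assms]) auto
  next
    case False
    note G = Suc.prems(5) and agree = Suc.prems(6) and deg = Suc.prems(7)
    have W: "W \<subseteq> V" "finite W" using Suc.prems(1) assms(1) finite_subset by auto
    have D: "2 \<le> real D" "real D < sqrt M" using Suc.prems(2) False by auto
    show ?thesis
    proof (cases "real (card W) * real D \<le> 4 * M")
      case False
      then have "\<not> real (card E) \<le> M" if "E \<in> \<G>" for E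
        using many_edges[OF G[OF that] W(1), of D] deg[OF that] by auto
      then show ?thesis by (intro learnable_brute_force assms(1) G)
    next
      case True
      let ?B = "4 * M / real D"
      have "real D * real D \<le> sqrt M * sqrt M" using D assms(2) by (intro mult_mono) auto
      then have "real D * real D \<le> 4 * M" using assms(2) by simp
      then have B: "real (card W) \<le> ?B" "real D \<le> ?B" using True D by (simp_all add: field_simps)
      obtain \<S> where \<S>: "\<S> \<subseteq> Pow W" "finite \<S>" "star_separating W D \<S>"
        "real (card \<S>) \<le> 25 * (real D)\<^sup>2 * (1 + ln (?B / real D))"
        using star_separating_family[OF W(2) Suc.prems(2) B] by auto
      have cS: "real (card \<S>) \<le> 125 * real D * sqrt M"
        using \<S>(4) star_family_cost[of "real D" M] D by auto
      \<comment> \<open>This is the bound at scale \<open>2 * D\<close>, but with the degrees still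
        summed over \<open>W\<close>. It is \<open>125 * D * sqrt M\<close> below the claimed bound,
        which pays for \<open>\<S>\<close>.\<close>
      let ?c = "\<lambda>E. 258 * M - 250 * real D * sqrt M + 4 * real (\<Sum>u\<in>W. card (nbrs E V u))"
      have learn: "learnable V \<G> (\<lambda>E. real (card E) \<le> M) (\<lambda>E. real (card \<S>) + ?c E)"
      proof (rule learnable_ask)
        show "finite \<S>" "\<S> \<subseteq> Pow V" using \<S>(1,2) W(1) by auto
        fix E0 assume E0: "E0 \<in> \<G>"
        define \<G>1 where "\<G>1 = {E \<in> \<G>. \<forall>S\<in>\<S>. induced_components E S = induced_components E0 S}"
        define H where "H = candidates W \<S> E0"
        have H: "candidates W \<S> E = H" if "E \<in> \<G>1" for E
          unfolding H_def using that by (intro candidates_cong) (simp add: \<G>1_def)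
        \<comment> \<open>Vertices of \<open>W\<close> outside \<open>W'\<close> have fewer than
          \<open>2 * D\<close> candidates, all tested by \<open>\<Q>\<close>; those in
          \<open>W'\<close> have degree above \<open>D\<close>.\<close>
        define W' where "W' = {u \<in> W. 2 * D \<le> card (nbrs H W u)}"
        define \<Q> where "\<Q> = (\<Union>u\<in>W - W'. (\<lambda>v. {u, v}) ` nbrs H W u)"
        have W': "W' \<subseteq> W" by (auto simp: W'_def)
        have fin_nbrs: "finite (nbrs H W u)" for u using W(2) by (simp add: nbrs_def)
        have fQ: "finite \<Q>" using W(2) fin_nbrs by (simp add: \<Q>_def)
        have QV: "\<Q> \<subseteq> Pow V" using W(1) by (auto simp: \<Q>_def nbrs_def)
        have "card \<Q> \<le> (\<Sum>u\<in>W - W'. card ((\<lambda>v. {u, v}) ` nbrs H W u))"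
          unfolding \<Q>_def using W(2) by (intro card_UN_le) simp
        also have "\<dots> \<le> (\<Sum>u\<in>W - W'. 2 * D)"
        proof (rule sum_mono)
          fix u assume "u \<in> W - W'"
          then show "card ((\<lambda>v. {u, v}) ` nbrs H W u) \<le> 2 * D"
            using card_image_le[OF fin_nbrs, of "\<lambda>v. {u, v}" u] by (auto simp: W'_def)
        qed
        finally have cQ: "card \<Q> \<le> (\<Sum>u\<in>W - W'. 2 * D)" .
        let ?c' = "\<lambda>E. 258 * M - 125 * real (2 * D) * sqrt M + 4 * real (\<Sum>u\<in>W'. card (nbrs E V u))"
        have learn': "learnable V \<G>1 (\<lambda>E. real (card E) \<le> M) (\<lambda>E. real (card \<Q>) + ?c' E)"
        proof (rule learnable_ask[OF fQ QV])
          fix E1 assume "E1 \<in> \<G>1"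
          define \<G>2 where "\<G>2 = {E \<in> \<G>1. \<forall>S\<in>\<Q>. induced_components E S = induced_components E1 S}"
          have sub: "E \<in> \<G>1" "E \<in> \<G>" if "E \<in> \<G>2" for E using that by (auto simp: \<G>2_def \<G>1_def)
          \<comment> \<open>An edge in which two remaining graphs differ is a candidate; with an end
            outside \<open>W'\<close> it would have been asked as a pair.\<close>
          have agree': "e \<subseteq> W'" if E: "E \<in> \<G>2" "E' \<in> \<G>2" and e: "e \<in> E" "e \<notin> E'" for E E' e
          proof -
            have eW: "e \<subseteq> W" using agree[OF sub(2)[OF E(1)] sub(2)[OF E(2)] e] .
            have eH: "e \<in> H"
              using edge_in_candidates[OF G[OF sub(2)[OF E(1)]] e(1) eW, of \<S>] H[OF sub(1)[OF E(1)]] by simp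
            have "u \<in> W'" if u: "u \<in> e" for u
            proof (rule ccontr)
              assume "u \<notin> W'"
              then have uL: "u \<in> W - W'" using u eW by auto
              obtain v where v: "e = {u, v}" "u \<noteq> v"
                using simple_graphD(4)[OF G[OF sub(2)[OF E(1)]] e(1)] u by (auto simp: card_2_iff)
              have "v \<in> nbrs H W u" using v eW eH by (simp add: nbrs_def)
              then have "{u, v} \<in> \<Q>" unfolding \<Q>_def using uL by blast
              then have "induced_components E {u, v} = induced_components E' {u, v}"
                using E by (simp add: \<G>2_def)
              then have "connected_rel E {u, v} = connected_rel E' {u, v}"
                by (rule conn_eq_if_components_eq)
              then show False
                using conn_pair_iff[OF G[OF sub(2)[OF E(1)]] v(2)]
                  conn_pair_iff[OF G[OF sub(2)[OF E(2)]] v(2)] e by (simp add: v(1))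
            qed
            then show ?thesis by auto
          qed
          have deg': "2 * D \<le> 2 * card (nbrs E V u)" if E: "E \<in> \<G>2" and u: "u \<in> W'" for E u
          proof -
            have uW: "u \<in> W" "\<not> card (nbrs H W u) < 2 * D" using u by (auto simp: W'_def)
            have "\<not> card (nbrs E W u) \<le> D"
              using star_separating_degree[OF G[OF sub(2)[OF E]] W(2) \<S>(1,3) uW(1)] uW(2)
                H[OF sub(1)[OF E]] Suc.prems(2) by auto
            then show ?thesis using nbrs_mono_card[OF assms(1) W(1), of E u] by simp
          qed
          have "learnable V \<G>2 (\<lambda>E. real (card E) \<le> M) ?c'"
          proof (rule Suc.IH)
            show "W' \<subseteq> V" using W' W(1) by auto
            show "2 \<le> 2 * D" using Suc.prems(2) by simp
            show "real (2 * D) \<le> 2 * sqrt M" using D by simp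
            show "sqrt M \<le> real (2 * D) * 2 ^ k" using Suc.prems(4) by simp
          qed (use G sub agree' deg' in auto)
          then show "learnable V {E \<in> \<G>1. \<forall>S\<in>\<Q>. induced_components E S = induced_components E1 S}
              (\<lambda>E. real (card E) \<le> M) ?c'"
            unfolding \<G>2_def .
        qed
        have "learnable V \<G>1 (\<lambda>E. real (card E) \<le> M) ?c"
        proof (rule learnable_mono[OF learn' order_refl])
          fix E assume "E \<in> \<G>1"
          then have E: "E \<in> \<G>" by (simp add: \<G>1_def)
          have "card \<Q> \<le> (\<Sum>u\<in>W - W'. 4 * card (nbrs E V u))"
            using cQ by (rule order_trans) (intro sum_mono, use deg[OF E] in fastforce)
          also have "\<dots> + (\<Sum>u\<in>W'. 4 * card (nbrs E V u)) = (\<Sum>u\<in>W. 4 * card (nbrs E V u))"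
            using W' W(2) by (rule sum.subset_diff[symmetric])
          finally have "card \<Q> + 4 * (\<Sum>u\<in>W'. card (nbrs E V u)) \<le> 4 * (\<Sum>u\<in>W. card (nbrs E V u))"
            by (simp add: sum_distrib_left)
          then have "real (card \<Q> + 4 * (\<Sum>u\<in>W'. card (nbrs E V u))) \<le> real (4 * (\<Sum>u\<in>W. card (nbrs E V u)))"
            by (simp only: of_nat_le_iff)
          then show "real (card \<Q>) + ?c' E \<le> ?c E"
            by (simp only: of_nat_add of_nat_mult of_nat_numeral)
        qed
        then show "learnable V {E \<in> \<G>. \<forall>S\<in>\<S>. induced_components E S = induced_components E0 S}
            (\<lambda>E. real (card E) \<le> M) ?c"
          unfolding \<G>1_def .
      qed
      show ?thesis
        by (rule learnable_mono[OF learn order_refl]) (use cS in auto)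
    qed
  qed
qed

section \<open>The adaptive algorithm\<close>

text \<open>The algorithm branches on what it can compute: whether the candidate graph has a
  \<open>K\<close>-tree completion with \<open>K = 9 * D + 2\<close>, the value
  \<open>3 * s + 2\<close> for separators of size \<open>s = 3 * D\<close>. If not, the treewidth is
  at least \<open>D\<close>, and the vertices are split by their number of candidates.\<close>

lemma learn_at_scale:
  assumes "finite V" "2 \<le> card V" "2 \<le> D"
  defines "M \<equiv> (real D)\<^sup>2 * log 2 (real (card V))"
  shows "learnable V {E. simple_graph V E}
    (\<lambda>E. treewidth V E + 1 \<le> D \<or> max_degree V E \<le> D \<or> real (card E) \<le> M) (\<lambda>_. 500 * M)"
    (is "learnable V _ ?P _")
proof -
  have D: "2 \<le> real D" using assms(3) by simp
  have "1 \<le> log 2 (real (card V))" using assms(2) by simp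
  then have "(real D)\<^sup>2 * 1 \<le> M" unfolding M_def by (intro mult_left_mono) auto
  then have M: "(real D)\<^sup>2 \<le> M" by simp
  have "2 * 2 \<le> real D * real D" using D by (intro mult_mono) auto
  then have M1: "4 \<le> M" using M by (simp add: power2_eq_square)
  have DM: "real D \<le> sqrt M" using M by (rule real_le_rsqrt)
  obtain \<S> where \<S>: "\<S> \<subseteq> Pow V" "finite \<S>" "separating V D \<S>" "real (card \<S>) \<le> 33 * M"
    using separating_family[OF assms(1-3)] by (auto simp: M_def mult.assoc)
  have star: "star_separating V D \<S>" using \<S>(3) by (rule separating_imp_star_separating)
  have learn: "learnable V {E. simple_graph V E} ?P (\<lambda>E. real (card \<S>) + 400 * M)"
  proof (rule learnable_ask[OF \<S>(2,1)])
    fix E0 assume "E0 \<in> {E. simple_graph V E}"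
    define \<G> where "\<G> = {E \<in> {E. simple_graph V E}. \<forall>S\<in>\<S>. induced_components E S = induced_components E0 S}"
    define H where "H = candidates V \<S> E0"
    have G: "simple_graph V E" if "E \<in> \<G>" for E using that by (simp add: \<G>_def)
    have H: "candidates V \<S> E = H" if "E \<in> \<G>" for E
      unfolding H_def using that by (intro candidates_cong) (simp add: \<G>_def)
    have EH: "E \<subseteq> H" if "E \<in> \<G>" for E
      using edge_in_candidates[OF G[OF that], of _ V \<S>] simple_graphD(3)[OF G[OF that]] H[OF that] by auto
    have Hpairs: "card e = 2 \<and> e \<subseteq> V" if "e \<in> H" for e using candidatesD that unfolding H_def by metis
    have "learnable V \<G> ?P (\<lambda>E. 400 * M)"
    proof (cases "\<exists>F. ktree_ext (9 * D + 2) {} {} V F \<and> H \<subseteq> F")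
      case True
      then obtain F where F: "ktree_ext (9 * D + 2) {} {} V F" "H \<subseteq> F" by auto
      have "E \<subseteq> F" if "E \<in> \<G>" for E using EH[OF that] F(2) by auto
      from learnable_ktree[OF F(1) this]
      have learn: "learnable V \<G> ?P (\<lambda>_. (real (9 * D + 2))\<^sup>2)" .
      have "(real (9 * D + 2))\<^sup>2 \<le> (10 * real D)\<^sup>2" using D by (intro power_mono) auto
      also have "\<dots> \<le> 400 * M" using M M1 by (simp add: power_mult_distrib)
      finally show ?thesis by (intro learnable_mono[OF learn order_refl])
    next
      case False
      have no_tw: "\<not> treewidth V E + 1 \<le> D" if E: "E \<in> \<G>" for E
      proof
        assume "treewidth V E + 1 \<le> D"
        then have "has_separators V H (3 * D)"
          using candidates_have_separators[OF G[OF E] _ \<S>(1,3)] H[OF E] by simp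
        then have "\<exists>F. ktree_ext (3 * (3 * D) + 2) {} (clique_edges {}) V F \<and> {e \<in> H. e \<subseteq> V} \<subseteq> F"
          using Hpairs by (intro ktree_completion[OF assms(1)]) auto
        moreover have "{e \<in> H. e \<subseteq> V} = H" using Hpairs by auto
        ultimately show False using False by simp
      qed
      define Lo where "Lo = {u \<in> V. card (nbrs H V u) < 2 * D}"
      define W where "W = V - Lo"
      have W: "W \<subseteq> V" "Lo \<subseteq> V" "V - Lo = W" by (auto simp: W_def Lo_def)
      have deg: "D < card (nbrs E V u)" if E: "E \<in> \<G>" and u: "u \<in> W" for E u
      proof (rule ccontr)
        assume "\<not> D < card (nbrs E V u)"
        moreover have "u \<in> V" "\<not> card (nbrs H V u) < 2 * D" using u by (auto simp: W_def Lo_def)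
        ultimately show False
          using star_separating_degree[OF G[OF E] assms(1) \<S>(1) star, of u] H[OF E] assms(3) by simp
      qed
      then have deg2: "2 * D \<le> 2 * card (nbrs E V u)" if "E \<in> \<G>" "u \<in> W" for E u
        using that by (simp add: less_imp_le)
      \<comment> \<open>Vertices of \<open>W\<close> have degree above \<open>D\<close>; so once
        \<open>W\<close> is non-empty, the bound on the number of edges is the only alternative of
        \<open>?P\<close> left.\<close>
      have P_imp: "real (card E) \<le> M" if E: "E \<in> \<G>" and "?P E" and "W \<noteq> {}" for E
      proof -
        obtain u where u: "u \<in> W" using \<open>W \<noteq> {}\<close> by auto
        have "D < max_degree V E"
          using deg[OF E u] card_le_max_degree[OF G[OF E], of u] u W(1) by auto
        then show ?thesis using \<open>?P E\<close> no_tw[OF E] by simp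
      qed
      show ?thesis
      proof (cases "real (card W) * real (2 * D) \<le> 4 * M")
        case False
        then have "W \<noteq> {}" using M1 by auto
        have "\<not> ?P E" if E: "E \<in> \<G>" for E
          using P_imp[OF E _ \<open>W \<noteq> {}\<close>] many_edges[OF G[OF E] W(1), of "2 * D"] deg2[OF E] False by auto
        then show ?thesis by (intro learnable_brute_force assms(1) G)
      next
        case True
        have "\<exists>\<Q>\<subseteq>Pow V. finite \<Q> \<and> card \<Q> \<le> 8 * D\<^sup>2 + 1 + 2 * D * card (V - Lo) \<and>
            (\<forall>u\<in>Lo. \<forall>v\<in>V. u \<noteq> v \<longrightarrow> {u, v} \<in> H \<longrightarrow> (\<exists>S\<in>\<Q>. isolates H S u v))"
          using assms(1,3) Hpairs W(2) by (intro low_degree_queries) (auto simp: Lo_def)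
        then obtain \<Q> where \<Q>: "\<Q> \<subseteq> Pow V" "finite \<Q>" "card \<Q> \<le> 8 * D\<^sup>2 + 1 + 2 * D * card W"
          "\<And>u v. u \<in> Lo \<Longrightarrow> v \<in> V \<Longrightarrow> u \<noteq> v \<Longrightarrow> {u, v} \<in> H \<Longrightarrow> \<exists>S\<in>\<Q>. isolates H S u v"
          unfolding W(3) by auto
        have "real (card \<Q>) \<le> real (8 * D\<^sup>2 + 1 + 2 * D * card W)" using \<Q>(3) by (simp only: of_nat_le_iff)
        also have "\<dots> = 8 * (real D)\<^sup>2 + 1 + real (card W) * real (2 * D)" by simp
        finally have c\<Q>: "real (card \<Q>) \<le> 13 * M" using M M1 True by linarith
        have learn: "learnable V \<G> ?P (\<lambda>E. real (card \<Q>) + 266 * M)"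
        proof (rule learnable_ask[OF \<Q>(2,1)])
          fix E1 assume "E1 \<in> \<G>"
          define \<G>2 where "\<G>2 = {E \<in> \<G>. \<forall>S\<in>\<Q>. induced_components E S = induced_components E1 S}"
          have sub: "E \<in> \<G>" if "E \<in> \<G>2" for E using that by (simp add: \<G>2_def)
          have agree: "e \<subseteq> W" if E: "E \<in> \<G>2" "E' \<in> \<G>2" and e: "e \<in> E" "e \<notin> E'" for E E' e
          proof
            fix u assume u: "u \<in> e"
            have eV: "e \<subseteq> V" using simple_graphD(3)[OF G[OF sub[OF E(1)]] e(1)] .
            show "u \<in> W"
            proof (rule ccontr)
              assume "u \<notin> W"
              then have uL: "u \<in> Lo" using u eV by (auto simp: W_def)
              obtain v where v: "e = {u, v}" "u \<noteq> v"
                using simple_graphD(4)[OF G[OF sub[OF E(1)]] e(1)] u by (auto simp: card_2_iff)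
              then have "v \<in> V" "{u, v} \<in> H" using eV e(1) EH[OF sub[OF E(1)]] by auto
              then obtain S where S: "S \<in> \<Q>" "isolates H S u v" using \<Q>(4)[OF uL _ v(2)] by auto
              have "induced_components E S = induced_components E' S" using E S(1) by (simp add: \<G>2_def)
              then have "connected_rel E S = connected_rel E' S" by (rule conn_eq_if_components_eq)
              from isolates_determines[OF S(2) v(2) EH[OF sub[OF E(1)]] EH[OF sub[OF E(2)]] this]
              show False using e by (simp add: v(1))
            qed
          qed
          have "learnable V \<G>2 ?P (\<lambda>E. 266 * M)"
          \<comment> \<open>With \<open>W\<close> empty all edges are settled. In the present branch
            this happens for every graph of maximum degree at most \<open>D\<close>.\<close>
          proof (cases "W = {}")
            case True
            have "E \<subseteq> E'" if E: "E \<in> \<G>2" "E' \<in> \<G>2" for E E'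
            proof
              fix e assume e: "e \<in> E"
              show "e \<in> E'"
              proof (rule ccontr)
                assume "e \<notin> E'"
                from agree[OF E e this] have "e = {}" using True by simp
                then show False using simple_graphD(4)[OF G[OF sub[OF E(1)]] e] by simp
              qed
            qed
            then have "E = E'" if "E \<in> \<G>2" "E' \<in> \<G>2" for E E' using that by (intro equalityI)
            then show ?thesis using M1 by (intro learnable_unique) auto
          next
            case False
            \<comment> \<open>Any bound on the number of doublings will do; it does not enter the
              cost.\<close>
            obtain k :: nat where k: "sqrt M < 2 ^ k" using real_arch_pow[of 2 "sqrt M"] by auto
            \<comment> \<open>The doubling starts at scale \<open>2 * D\<close>: the degrees in
              \<open>W\<close> are above half of it, and it is at most
              \<open>2 * sqrt M\<close>.\<close>
            have "learnable V \<G>2 (\<lambda>E. real (card E) \<le> M)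
                (\<lambda>E. 258 * M - 125 * real (2 * D) * sqrt M + 4 * real (\<Sum>u\<in>W. card (nbrs E V u)))"
            proof (rule learn_high_degree[OF assms(1) _ W(1)])
              have "1 * 2 ^ k \<le> real (2 * D) * 2 ^ k" using D by (intro mult_right_mono) auto
              then show "sqrt M \<le> real (2 * D) * 2 ^ k" using k by linarith
            qed (use M1 DM assms(3) G sub agree deg2 in auto)
            then show ?thesis
            proof (rule learnable_mono)
              fix E assume E: "E \<in> \<G>2" "?P E"
              show *: "real (card E) \<le> M" using P_imp[OF sub[OF E(1)] E(2) False] .
              have "real (\<Sum>u\<in>W. card (nbrs E V u)) \<le> real (2 * card E)"
                using sum_card_nbrs_le[OF G[OF sub[OF E(1)]] W(1)] by (simp only: of_nat_le_iff)
              then have "real (\<Sum>u\<in>W. card (nbrs E V u)) \<le> 2 * M" using * by simp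
              moreover have "0 \<le> 125 * real (2 * D) * sqrt M" using M1 by simp
              ultimately show "258 * M - 125 * real (2 * D) * sqrt M + 4 * real (\<Sum>u\<in>W. card (nbrs E V u)) \<le> 266 * M"
                by linarith
            qed simp
          qed
          then show "learnable V {E \<in> \<G>. \<forall>S\<in>\<Q>. induced_components E S = induced_components E1 S} ?P (\<lambda>E. 266 * M)"
            unfolding \<G>2_def .
        qed
        show ?thesis by (rule learnable_mono[OF learn order_refl]) (use c\<Q> M1 in auto)
      qed
    qed
    then show "learnable V {E \<in> {E. simple_graph V E}. \<forall>S\<in>\<S>. induced_components E S = induced_components E0 S}
        ?P (\<lambda>E. 400 * M)"
      unfolding \<G>_def .
  qed
  show ?thesis by (rule learnable_mono[OF learn order_refl]) (use \<S>(4) M1 in auto)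
qed

text \<open>Edgeless graphs are treated apart: their bound is a constant, whereas every scale has a
  budget proportional to \<open>log n\<close>. The single query \<open>V\<close> recognises
  them.\<close>

lemma learn_empty:
  assumes "finite V"
  shows "learnable V {E. simple_graph V E} (\<lambda>E. E = {}) (\<lambda>_. 1)"
proof -
  have "learnable V {E. simple_graph V E} (\<lambda>E. E = {}) (\<lambda>E. real (card {V}) + (\<lambda>_. 0) E)"
  proof (rule learnable_ask)
    fix E0
    let ?\<G> = "{E \<in> {E. simple_graph V E}. \<forall>S\<in>{V}. induced_components E S = induced_components E0 S}"
    show "learnable V ?\<G> (\<lambda>E. E = {}) (\<lambda>_. 0)"
    proof (cases "{} \<in> ?\<G>")
      case True
      have "E = {}" if E: "E \<in> ?\<G>" for E
      proof (rule ccontr)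
        assume "E \<noteq> {}"
        then obtain e where e: "e \<in> E" by auto
        have G: "simple_graph V E" using E by simp
        obtain u v where uv: "e = {u, v}" "u \<noteq> v"
          using simple_graphD(4)[OF G e] by (auto simp: card_2_iff)
        have V: "u \<in> V" "v \<in> V" using simple_graphD(3)[OF G e] uv by auto
        have "induced_components E V = induced_components {} V" using E True by simp
        then have "connected_rel E V = connected_rel {} V" by (rule conn_eq_if_components_eq)
        moreover have "(u, v) \<in> connected_rel E V" using V e uv by (intro conn_edge) auto
        moreover have "(u, v) \<notin> connected_rel {} V" using conn_pendant_iff[of u V v "{}"] V uv by simp
        ultimately show False by simp
      qed
      then show ?thesis by (intro learnable_unique) auto
    next
      case False
      then show ?thesis by (intro learnable_brute_force assms) auto
    qed
  qed (use assms in auto)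
  then show ?thesis by simp
qed

text \<open>Dovetailing over the scales \<open>D = 2 * 2 ^ i\<close>. The budgets grow fourfold, so
  their sum is dominated by the first scale that fits; as the preceding one was too small,
  \<open>4 ^ i\<close> is at most four times the minimum in \<open>query_bound\<close>.\<close>

lemma deterministic_algorithm:
  assumes "finite V"
  shows "\<exists>B. queries_within V B \<and> (\<forall>E. simple_graph V E \<longrightarrow> result (induced_components E) B = E \<and>
    real (num_queries (induced_components E) B) \<le> 12000 * query_bound V E)"
proof (cases "2 \<le> card V")
  case False
  have empty: "E = {}" if "simple_graph V E" for E
  proof (rule ccontr)
    assume "E \<noteq> {}"
    then obtain e where e: "e \<in> E" by auto
    have "card e \<le> card V" using simple_graphD(3)[OF that e] assms by (rule card_mono[rotated])
    then show False using simple_graphD(4)[OF that e] False by simp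
  qed
  have "0 \<le> query_bound V E" for E unfolding query_bound_def Let_def by (rule max.coboundedI1) simp
  then show ?thesis by (intro exI[of _ "Output {}"]) (auto dest: empty)
next
  case True
  define n where "n = real (card V)"
  have n: "2 \<le> n" using True by (simp add: n_def)
  then have L: "1 \<le> log 2 n" by simp
  define M where "M i = (real (2 * 2 ^ i))\<^sup>2 * log 2 n" for i :: nat
  have M_eq: "M i = 4 * (4 ^ i * log 2 n)" for i
    by (simp add: M_def power_mult_distrib power2_eq_square power_mult[symmetric])
      (simp add: power_mult_distrib[symmetric])
  have learn: "learnable V {E. simple_graph V E}
    (\<lambda>E. treewidth V E + 1 \<le> 2 * 2 ^ i \<or> max_degree V E \<le> 2 * 2 ^ i \<or> real (card E) \<le> M i) (\<lambda>_. 500 * M i)" for i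
    using learn_at_scale[OF assms True, of "2 * 2 ^ i"] by (simp add: M_def n_def)
  have "\<forall>i. \<exists>A. queries_within V A \<and> (\<forall>E. simple_graph V E \<longrightarrow> result (induced_components E) A = E \<and>
      (treewidth V E + 1 \<le> 2 * 2 ^ i \<or> max_degree V E \<le> 2 * 2 ^ i \<or> real (card E) \<le> M i \<longrightarrow>
        real (num_queries (induced_components E) A) \<le> 500 * M i))"
    using learn unfolding learnable_def by simp
  from choice[OF this] obtain A where A: "\<And>i. queries_within V (A i)"
    "\<And>i E. simple_graph V E \<Longrightarrow> result (induced_components E) (A i) = E"
    "\<And>i E. simple_graph V E \<Longrightarrow>
      treewidth V E + 1 \<le> 2 * 2 ^ i \<or> max_degree V E \<le> 2 * 2 ^ i \<or> real (card E) \<le> M i \<Longrightarrow>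
        real (num_queries (induced_components E) (A i)) \<le> 500 * M i"
    by metis
  obtain A0 where A0: "queries_within V A0"
    "\<And>E. simple_graph V E \<Longrightarrow> result (induced_components E) A0 = E"
    "\<And>E. simple_graph V E \<Longrightarrow> E = {} \<Longrightarrow> num_queries (induced_components E) A0 \<le> 1"
    using learn_empty[OF assms] unfolding learnable_def by auto
  \<comment> \<open>Finitely many scales suffice: at scale \<open>N\<close> every treewidth is
    covered.\<close>
  define N where "N = Max (treewidth V ` {E. simple_graph V E})"
  have "finite {E. simple_graph V E}"
    by (rule finite_subset[of _ "Pow (Pow V)"]) (use assms in \<open>auto simp: simple_graph_def\<close>)
  then have N: "treewidth V E \<le> N" if "simple_graph V E" for E
    unfolding N_def using that by (intro Max_ge) auto
  \<comment> \<open>Position 0 is taken by the test for edgeless graphs, so scale \<open>i\<close>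
    sits at position \<open>Suc i\<close>.\<close>
  define A' where "A' i = (case i of 0 \<Rightarrow> A0 | Suc j \<Rightarrow> A j)" for i
  define r where "r i = (case i of 0 \<Rightarrow> 1 | Suc j \<Rightarrow> nat \<lfloor>500 * M j\<rfloor>)" for i
  have "queries_within V (A' i)" for i using A(1) A0(1) by (simp add: A'_def split: nat.split)
  moreover have "result (induced_components E) (A' i) = E" if "E \<in> {E. simple_graph V E}" for i E
    using A(2) A0(2) that by (simp add: A'_def split: nat.split)
  ultimately obtain B where B: "queries_within V B"
    "\<And>E. simple_graph V E \<Longrightarrow> result (induced_components E) B = E"
    "\<And>E i. simple_graph V E \<Longrightarrow> i \<le> Suc N \<Longrightarrow> num_queries (induced_components E) (A' i) \<le> r i \<Longrightarrow>
       num_queries (induced_components E) B \<le> (\<Sum>j\<le>i. r j)"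
    using dovetail[of "Suc N" V A' "{E. simple_graph V E}" r] by auto
  have "real (num_queries (induced_components E) B) \<le> 12000 * query_bound V E" if E: "simple_graph V E" for E
  proof -
    define m k \<Delta> where "m = real (card E)" and "k = treewidth V E" and "\<Delta> = max_degree V E"
    define Q where "Q = Min {m / max 1 (log 2 m), (real \<Delta>)\<^sup>2, (real k)\<^sup>2}"
    have Q_min: "Q = min (m / max 1 (log 2 m)) (min ((real \<Delta>)\<^sup>2) ((real k)\<^sup>2))"
      by (simp add: Q_def)
    have qb: "query_bound V E = max 1 (Q * log 2 n)"
      by (simp add: query_bound_def Let_def Q_def m_def k_def \<Delta>_def n_def)
    show ?thesis
    proof (cases "E = {}")
      case True
      then have "num_queries (induced_components E) B \<le> 1"
        using B(3)[OF E, of 0] A0(3)[OF E] by (simp add: A'_def r_def)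
      then show ?thesis unfolding qb by simp
    next
      case False
      \<comment> \<open>The thresholds are half of \<open>D = 2 * 2 ^ i\<close>, so that
        \<open>k <= 2 ^ i\<close> leaves room for the \<open>+ 1\<close> of the bag sizes.\<close>
      define small where "small i \<longleftrightarrow> k \<le> 2 ^ i \<or> \<Delta> \<le> 2 ^ i \<or> m / max 1 (log 2 m) \<le> 4 ^ i" for i :: nat
      define i where "i = (LEAST i. small i)"
      have "k \<le> 2 ^ N" unfolding k_def using N[OF E] less_exp[of N] by linarith
      then have "small N" by (simp add: small_def)
      then have i: "small i" "i \<le> N" and least: "\<And>j. j < i \<Longrightarrow> \<not> small j"
        unfolding i_def by (auto intro: LeastI Least_le dest: not_less_Least)
      have m1: "1 \<le> m" using False simple_graphD(5)[OF E] by (simp add: m_def Suc_le_eq card_gt_0_iff)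
      \<comment> \<open>From \<open>m <= n^2\<close> follows \<open>log m <= 2 * log n\<close>,
        which converts the bound on \<open>m / log m\<close> into the edge bound \<open>M i\<close>
        of the scale.\<close>
      have "card E \<le> card V choose 2"
      proof -
        have "card E \<le> card {e. e \<subseteq> V \<and> card e = 2}"
          using simple_graphD(3,4)[OF E] assms by (intro card_mono) auto
        then show ?thesis using n_subsets[OF assms, of 2] by simp
      qed
      also have "\<dots> \<le> card V ^ 2" using True by (rule binomial_le_pow)
      finally have "m \<le> n ^ 2" unfolding m_def n_def by (metis of_nat_le_iff of_nat_power)
      then have "log 2 m \<le> log 2 (n ^ 2)" using m1 by (intro log_mono) auto
      also have "\<dots> = 2 * log 2 n" using n by (simp add: log_nat_power)
      finally have logm: "max 1 (log 2 m) \<le> 2 * log 2 n" using L by simp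
      have "treewidth V E + 1 \<le> 2 * 2 ^ i \<or> max_degree V E \<le> 2 * 2 ^ i \<or> real (card E) \<le> M i"
      proof -
        consider "k \<le> 2 ^ i" | "\<Delta> \<le> 2 ^ i" | "m / max 1 (log 2 m) \<le> 4 ^ i" using i(1) by (auto simp: small_def)
        then show ?thesis
        proof cases
          case 1
          have "(1 :: nat) \<le> 2 ^ i" by simp
          with 1 have "k + 1 \<le> 2 * 2 ^ i" by linarith
          then show ?thesis by (simp add: k_def)
        next
          case 2
          then show ?thesis by (simp add: \<Delta>_def)
        next
          case 3
          then have "m \<le> 4 ^ i * max 1 (log 2 m)" by (simp add: pos_divide_le_eq)
          also have "\<dots> \<le> 4 ^ i * (2 * log 2 n)" using logm by (intro mult_left_mono) auto
          also have "\<dots> \<le> M i" unfolding M_eq using L by simp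
          finally show ?thesis by (simp add: m_def)
        qed
      qed
      then have "real (num_queries (induced_components E) (A i)) \<le> 500 * M i" by (rule A(3)[OF E])
      then have "num_queries (induced_components E) (A' (Suc i)) \<le> r (Suc i)"
        by (simp add: A'_def r_def le_nat_floor)
      then have "num_queries (induced_components E) B \<le> (\<Sum>j\<le>Suc i. r j)"
        using i(2) by (intro B(3)[OF E]) auto
      then have "real (num_queries (induced_components E) B) \<le> real (\<Sum>j\<le>Suc i. r j)"
        by (simp only: of_nat_le_iff)
      also have "\<dots> = 1 + (\<Sum>j\<le>i. real (r (Suc j)))"
        unfolding sum.atMost_Suc_shift by (simp add: r_def)
      also have "\<dots> \<le> 1 + (\<Sum>j\<le>i. 500 * M j)"
        using L by (intro add_left_mono sum_mono) (simp add: r_def M_eq)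
      also have "\<dots> = 1 + 2000 * log 2 n * (\<Sum>j\<le>i. 4 ^ j)"
        unfolding sum_distrib_left by (simp add: M_eq mult_ac)
      also have "\<dots> \<le> 1 + 2000 * log 2 n * (4 / 3 * 4 ^ i)"
      proof -
        have "(\<Sum>j\<le>i. 4 ^ j :: real) \<le> 4 / 3 * 4 ^ i" by (induction i) auto
        then show ?thesis using L by (intro add_left_mono mult_left_mono) auto
      qed
      also have "\<dots> \<le> 3000 * (4 ^ i * log 2 n)"
      proof -
        have "1 * 1 \<le> 4 ^ i * log 2 n" using L by (intro mult_mono) auto
        moreover have "2000 * log 2 n * (4 / 3 * 4 ^ i) = 8000 / 3 * (4 ^ i * log 2 n)" by simp
        ultimately show ?thesis by linarith
      qed
      finally have total: "real (num_queries (induced_components E) B) \<le> 3000 * (4 ^ i * log 2 n)" .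
      \<comment> \<open>For \<open>i = 0\<close> all three quantities have to be at least 1, which
        holds since \<open>E\<close> is non-empty; for larger \<open>i\<close>, \<open>small\<close>
        fails at \<open>i - 1\<close>.\<close>
      have "4 ^ i \<le> 4 * Q"
      proof (cases i)
        case 0
        have "1 \<le> treewidth V E" using treewidth_pos[OF E False] .
        then have "1 \<le> (real k)\<^sup>2" by (simp add: k_def)
        moreover have "1 \<le> (real \<Delta>)\<^sup>2"
        proof -
          obtain e where e: "e \<in> E" using False by auto
          then obtain u v where uv: "e = {u, v}" "u \<noteq> v"
            using simple_graphD(4)[OF E e] by (auto simp: card_2_iff)
          then have "u \<in> V" "v \<in> nbrs E V u" using e simple_graphD(3)[OF E e] by (auto simp: nbrs_def)
          moreover have "finite (nbrs E V u)" using assms by (simp add: nbrs_def)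
          ultimately have "0 < card (nbrs E V u)" by (auto simp: card_gt_0_iff)
          then have "1 \<le> \<Delta>" using card_le_max_degree[OF E \<open>u \<in> V\<close>] by (simp add: \<Delta>_def)
          then show ?thesis by simp
        qed
        moreover have "1 \<le> m / max 1 (log 2 m)"
        proof -
          have "log 2 m \<le> m"
            using log2_of_power_le[OF less_imp_le[OF less_exp], of "card E"] m1 by (simp add: m_def)
          then show ?thesis using m1 by (simp add: pos_le_divide_eq)
        qed
        ultimately have "1 \<le> Q" unfolding Q_min by (simp only: min.bounded_iff simp_thms)
        then show ?thesis using 0 by simp
      next
        case (Suc j)
        then have "\<not> small j" using least by simp
        then have "2 ^ j < real k" "2 ^ j < real \<Delta>" and m: "4 ^ j < m / max 1 (log 2 m)"
          by (simp_all add: small_def not_le)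
        then have "(2 ^ j)\<^sup>2 \<le> (real k)\<^sup>2" "(2 ^ j)\<^sup>2 \<le> (real \<Delta>)\<^sup>2"
          by (intro power_mono; simp)+
        moreover have "(2 ^ j)\<^sup>2 = (4 ^ j :: real)" by (simp add: power2_eq_square flip: power_mult_distrib)
        ultimately have "4 ^ j \<le> Q"
          using less_imp_le[OF m] unfolding Q_min by (simp only: min.bounded_iff simp_thms)
        then show ?thesis using Suc by simp
      qed
      then have "4 ^ i * log 2 n \<le> 4 * Q * log 2 n" using L by (intro mult_right_mono) auto
      with total have "real (num_queries (induced_components E) B) \<le> 12000 * (Q * log 2 n)" by simp
      then show ?thesis unfolding qb by simp
    qed
  qed
  with B(1,2) show ?thesis by (intro exI[of _ B]) simp
qed

theorem theorem8:
  shows "\<exists>(A :: 'a set \<Rightarrow> 'a cc_alg pmf) (C :: real) (\<delta> :: nat \<Rightarrow> real).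
    \<delta> \<longlonglongrightarrow> 0 \<and>
    (\<forall>V E. simple_graph V E \<longrightarrow>
       (\<forall>D \<in> set_pmf (A V).
          queries_within V D \<and>
          real (num_queries (induced_components E) D) \<le> C * query_bound V E) \<and>
       measure_pmf.prob (A V) {D. result (induced_components E) D = E} \<ge> 1 - \<delta> (card V))"
proof -
  have "\<exists>B. \<forall>E. simple_graph V E \<longrightarrow> queries_within V B \<and> result (induced_components E) B = E \<and>
    real (num_queries (induced_components E) B) \<le> 12000 * query_bound V E" for V :: "'a set"
  proof (cases "finite V")
    case True
    from deterministic_algorithm[OF this] obtain B where "queries_within V B \<and>
        (\<forall>E. simple_graph V E \<longrightarrow> result (induced_components E) B = E \<and>
          real (num_queries (induced_components E) B) \<le> 12000 * query_bound V E)" ..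
    then show ?thesis by (intro exI[of _ B]) simp
  next
    case False
    then show ?thesis by (simp add: simple_graph_def)
  qed
  then obtain B where B: "\<And>V E. simple_graph V E \<Longrightarrow> queries_within V (B V)"
    "\<And>V E. simple_graph V E \<Longrightarrow> result (induced_components E) (B V) = E"
    "\<And>V E. simple_graph V E \<Longrightarrow>
      real (num_queries (induced_components E) (B V :: 'a cc_alg)) \<le> 12000 * query_bound V E"
    by metis
  have "measure_pmf.prob (return_pmf (B V)) {D. result (induced_components E) D = E} = 1"
    if "simple_graph V E" for V E
    using B(2)[OF that] by (simp add: measure_return_pmf)
  \<comment> \<open>The distribution is a point mass, and the error is 0 for every
    \<open>n\<close>.\<close>
  then show ?thesis
    using B(1,3)
    by (intro exI[of _ "\<lambda>V. return_pmf (B V)"] exI[of _ 12000] exI[of _ "\<lambda>_. 0"]) auto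
qed

end
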